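(* Let $d\ge1$ and let $m>n>1$ be coprime integers. For any $D=(y_{i,j})\in\mathcal{Y}(dn,dm)$: (1) The indices $\mathbf{p}_u$ $(1\le u\le d-1)$ are well-defined and satisfy $0<\mathbf{p}_1<\mathbf{p}_2<\cdots<\mathbf{p}_{d-1}\le(d-1)n$. (2) The map $\Psi_d$ induces a bijection $$\Psi_d:\mathcal{Y}(dn,dm)\xrightarrow{\ \sim\ }\mathcal{A}dm(dn,dm),\qquad (y_{i,j})\mapsto(c_{i,j}):=\Psi_d((y_{i,j})),$$ such that, writing $\Delta\cong(c_{i,j})=\Psi_d(D)$, $$e(\Delta)=|(c_{i,j})|=|D|,\qquad \dim\Delta=\mathrm{co}\text{-}\mathrm{dinv}(D),$$ where $|(c_{i,j})|=\sum_{i,j}c_{i,j}$. (3) The map $\hat{\mathrm{rk}}_D$ defines a bijection $\hat{\mathrm{rk}}_D:\overline{\mathcal{R}}^+_{dn,dm}\xrightarrow{\sim}\mathbb{N}$ satisfying $\lfloor\hat{\mathrm{rk}}_D/d\rfloor=\mathrm{rk}$ and $$\hat{\mathrm{rk}}_D(\mathcal{R}^+_{dn,dm}\setminus D)=\mathbb{N}\setminus\Delta,\qquad \Delta=\Psi_d(D)\in\mathcal{A}dm(dn,dm).$$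
   Context: Notation: $\mathbb{N}=\{0,1,\dots\}$. Indices run over $0\le i\le d-1$, $0\le j\le n-1$; a family indexed by $(i,j)$ is also indexed by $x=in+j$, $0\le x\le dn-1$. Admissible subsets. $\Gamma\subset\mathbb{N}$ is the semigroup (with $0$) generated by $dn,dm,dmn+1$; $\delta=|\mathbb{N}\setminus\Gamma|$; $\hat a_{i,j}=jdm+(dmn+1)i$; $a_{i,j}=a_{in+j}=mi+\lfloor jm/n\rfloor$ (so $\delta=\sum a_{i,j}$). $\mathcal{A}dm(dn,dm)$ is the set of $\Delta\subset\mathbb{N}$ with $\min\Delta=0$, $\Gamma+\Delta\subset\Delta$, which are admissible: for every $0\le i\le d-1$ there is $a\in A(\Delta)$ with $a\equiv i\pmod d$ and $a+dm+1\in\Delta$. Here $A(\Delta)$ is the set of $dn$-generators: $\Delta=\bigsqcup_{a\in A(\Delta)}(a+dn\mathbb{N})$. One writes uniquely $A(\Delta)=\{\hat a_{i,j}-dn\,c_{i,j}\}$ with integers $0\le c_{i,j}\le a_{i,j}$, and identifies $\Delta$ with the matrix $(c_{i,j})$. Put $\delta(\Delta)=|\mathbb{N}\setminus\Delta|$, $e(\Delta)=\delta-\delta(\Delta)$, $\mathrm{Gaps}(a)=[a,\infty)\setminus\Delta$, $\dim\Delta=\sum_{a\in A(\Delta)}|\mathrm{Gaps}(a)|-\sum_{a\in A(\Delta)}|\mathrm{Gaps}(a+dm)|$. Dyck paths. $\mathcal{Y}(dn,dm)$ is the set of integer families $(y_x)_{0\le x\le dn-1}$ with $0\le y_x\le a_x$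 and $y_x\le y_{x+1}$. A unit box is identified with its top-left vertex $(x,y)\in\mathbb{Z}^2$, and $\mathrm{rk}(x,y)=mx-ny$. $\mathcal{R}^+_{dn,dm}=\{(x,y)\in\mathbb{Z}^2:0\le x\le dn-1,\ 1\le y\le \frac mn x\}$ and $\overline{\mathcal{R}}^+_{dn,dm}=\{(x,y)\in\mathbb{Z}^2:0\le x\le dn-1,\ y\le\frac mn x\}$. An element of $\mathcal{Y}(dn,dm)$ is identified with $D=\{(x,y):0\le x\le dn-1,\ 1\le y\le y_x\}\subset\mathcal{R}^+_{dn,dm}$; $|D|=\sum_x y_x$. For a box $z=(p,y)\in D$, the leg length is $\mathfrak{l}(z)=y_p-y$ (boxes of $D$ above $z$ in its column) and the arm length $\mathfrak{a}(z)$ is the number of boxes of $D$ strictly to the left of $z$ in its row. $\mathrm{dinv}(D)=\#\{z\in D:\frac{\mathfrak l(z)}{\mathfrak a(z)+1}\le\frac mn<\frac{\mathfrak l(z)+1}{\mathfrak a(z)}\}$ (with $\frac{\mathfrak l+1}{0}=+\infty$) and $\mathrm{co}\text{-}\mathrm{dinv}(D)=\delta-\mathrm{dinv}(D)$. Construction of $\mathbf{p}_u$, $\mathbf{s}_j$, $\Psi_d$. Set $\mathrm{rk}^{[0]}_{x}=mx-ny_x$ for $0\le x\le dn-1$. For $u=d-1,d-2,\dots,1$, given the vector $(\mathrm{rk}^{[d-u-1]}_x)_{0\le x\le(u+1)n-1}$ define $$\mathbf{p}_u=\max\{0\le x\le un:\ \mathrm{rk}^{[d-u-1]}_x\le\mathrm{rk}^{[d-u-1]}_{x+n-1}+m\},$$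 and for $0\le x\le un-1$ set $\mathrm{rk}^{[d-u]}_x=\mathrm{rk}^{[d-u-1]}_x$ if $x<\mathbf{p}_u$ and $\mathrm{rk}^{[d-u]}_x=\mathrm{rk}^{[d-u-1]}_{x+n}$ if $x\ge\mathbf{p}_u$. For $0\le j\le n-1$ let $\mathbf{i}_{j,u}=\min\{0\le i\le u: in+j\ge\mathbf{p}_u\}$, let $\mathbf{s}_{j,u}$ be the cyclic permutation $(\mathbf{i}_{j,u}\ \ \mathbf{i}_{j,u}{+}1\ \cdots\ u)$ of $\{0,\dots,d-1\}$ (so $i\mapsto i+1$ for $\mathbf{i}_{j,u}\le i<u$ and $u\mapsto\mathbf{i}_{j,u}$), and $\mathbf{s}_j=\mathbf{s}_{j,d-1}\circ\mathbf{s}_{j,d-2}\circ\cdots\circ\mathbf{s}_{j,1}$. Then $\Psi_d((y_{i,j}))=(c_{i,j})$ with $c_{i,j}=y_{\mathbf{s}_j(i),j}-(\mathbf{s}_j(i)-i)m$. The enhanced rank is $\hat{\mathrm{rk}}_D(in+j,y)=d\cdot\mathrm{rk}(in+j,y)+\mathbf{s}_j^{-1}(i)$. *)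

theory Defs
  imports
    Complex_Main
    "HOL-Library.FuncSet"
    "HOL-Library.Disjoint_Sets"
    "HOL-Number_Theory.Cong"
    "HOL-Combinatorics.Cycles"
begin

text \<open>Throughout, a family indexed by \<open>x < d * n\<close> is a function of \<open>x\<close>, and a matrix indexed by
  \<open>i < d\<close>, \<open>j < n\<close> is a curried function of \<open>i\<close> and \<open>j\<close>; the two indexings are
  related by \<open>x = i * n + j\<close>, i.e. \<open>i = x div n\<close> and \<open>j = x mod n\<close>.\<close>

section \<open>Admissible subsets\<close>

definition Gamma :: "nat \<Rightarrow> nat \<Rightarrow> nat \<Rightarrow> nat set" where
  "Gamma d n m = {p * (d * n) + q * (d * m) + r * (d * m * n + 1) | p q r. True}"

text \<open>The number of gaps; meaningful for cofinite sets only. \<open>Gamma d n m\<close> is cofinite for coprime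
  \<open>m\<close>, \<open>n\<close>, hence so is every subset of the naturals that contains it.\<close>

definition delta :: "nat set \<Rightarrow> nat" where
  "delta S = card (UNIV - S)"

definition ahat :: "nat \<Rightarrow> nat \<Rightarrow> nat \<Rightarrow> nat \<Rightarrow> nat \<Rightarrow> nat" where
  "ahat d n m i j = j * (d * m) + (d * m * n + 1) * i"

definition abound :: "nat \<Rightarrow> nat \<Rightarrow> nat \<Rightarrow> nat \<Rightarrow> nat" where
  "abound n m i j = m * i + (j * m) div n"

definition progression :: "nat \<Rightarrow> nat \<Rightarrow> nat set" where
  "progression N a = {a + N * k | k. True}"

definition generators :: "nat \<Rightarrow> nat set \<Rightarrow> nat set" where
  "generators N S = {a \<in> S. \<not> (\<exists>b\<in>S. a = b + N)}"

definition Adm :: "nat \<Rightarrow> nat \<Rightarrow> nat \<Rightarrow> nat set set" where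
  "Adm d n m = {\<Delta>. \<Delta> \<noteq> {} \<and> (LEAST t. t \<in> \<Delta>) = 0 \<and>
     (\<forall>g\<in>Gamma d n m. \<forall>t\<in>\<Delta>. g + t \<in> \<Delta>) \<and>
     (\<forall>i<d. \<exists>a\<in>generators (d * n) \<Delta>. [a = i] (mod d) \<and> a + d * m + 1 \<in> \<Delta>)}"

text \<open>\<open>represents d n m \<Delta> c\<close> is the identification of \<open>\<Delta>\<close> with the matrix \<open>c\<close>.\<close>

definition represents ::
    "nat \<Rightarrow> nat \<Rightarrow> nat \<Rightarrow> nat set \<Rightarrow> (nat \<Rightarrow> nat \<Rightarrow> int) \<Rightarrow> bool" where
  "represents d n m \<Delta> c \<longleftrightarrow>
     (\<forall>i<d. \<forall>j<n. 0 \<le> c i j \<and> c i j \<le> int (abound n m i j)) \<and>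
     int ` generators (d * n) \<Delta>
       = {int (ahat d n m i j) - int (d * n) * c i j | i j. i < d \<and> j < n}"

definition subset_of_matrix ::
    "nat \<Rightarrow> nat \<Rightarrow> nat \<Rightarrow> (nat \<Rightarrow> nat \<Rightarrow> int) \<Rightarrow> nat set" where
  "subset_of_matrix d n m c =
     {t. \<exists>i<d. \<exists>j<n. \<exists>k::nat.
        int t = int (ahat d n m i j) - int (d * n) * c i j + int (d * n) * int k}"

definition matrix_sum :: "nat \<Rightarrow> nat \<Rightarrow> (nat \<Rightarrow> nat \<Rightarrow> int) \<Rightarrow> int" where
  "matrix_sum d n c = (\<Sum>i<d. \<Sum>j<n. c i j)"

definition e_stat :: "nat \<Rightarrow> nat \<Rightarrow> nat \<Rightarrow> nat set \<Rightarrow> int" where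
  "e_stat d n m \<Delta> = int (delta (Gamma d n m)) - int (delta \<Delta>)"

definition Gaps :: "nat set \<Rightarrow> nat \<Rightarrow> nat set" where
  "Gaps \<Delta> a = {a..} - \<Delta>"

definition dim_stat :: "nat \<Rightarrow> nat \<Rightarrow> nat \<Rightarrow> nat set \<Rightarrow> int" where
  "dim_stat d n m \<Delta> =
     (\<Sum>a\<in>generators (d * n) \<Delta>. int (card (Gaps \<Delta> a)))
       - (\<Sum>a\<in>generators (d * n) \<Delta>. int (card (Gaps \<Delta> (a + d * m))))"

section \<open>Dyck paths\<close>

text \<open>Families are taken extensional (undefined outside \<open>{..<d * n}\<close>), so that equality
  of functions is equality of families.\<close>

definition Dyck :: "nat \<Rightarrow> nat \<Rightarrow> nat \<Rightarrow> (nat \<Rightarrow> int) set" where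
  "Dyck d n m = {y \<in> (\<Pi>\<^sub>E x\<in>{..<d * n}. {0..int (abound n m (x div n) (x mod n))}).
     \<forall>x. x + 1 < d * n \<longrightarrow> y x \<le> y (x + 1)}"

definition rk :: "nat \<Rightarrow> nat \<Rightarrow> int \<times> int \<Rightarrow> int" where
  "rk n m z = int m * fst z - int n * snd z"

definition Rplus :: "nat \<Rightarrow> nat \<Rightarrow> nat \<Rightarrow> (int \<times> int) set" where
  "Rplus d n m = {(x, y). 0 \<le> x \<and> x \<le> int (d * n) - 1 \<and> 1 \<le> y \<and>
     real_of_int y \<le> real m / real n * real_of_int x}"

definition Rplusbar :: "nat \<Rightarrow> nat \<Rightarrow> nat \<Rightarrow> (int \<times> int) set" where
  "Rplusbar d n m = {(x, y). 0 \<le> x \<and> x \<le> int (d * n) - 1 \<and>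
     real_of_int y \<le> real m / real n * real_of_int x}"

definition boxes :: "nat \<Rightarrow> nat \<Rightarrow> (nat \<Rightarrow> int) \<Rightarrow> (int \<times> int) set" where
  "boxes d n y = {(x, b). 0 \<le> x \<and> x \<le> int (d * n) - 1 \<and> 1 \<le> b \<and> b \<le> y (nat x)}"

definition path_size :: "nat \<Rightarrow> nat \<Rightarrow> (nat \<Rightarrow> int) \<Rightarrow> int" where
  "path_size d n y = (\<Sum>x<d * n. y x)"

definition leg :: "(nat \<Rightarrow> int) \<Rightarrow> int \<times> int \<Rightarrow> int" where
  "leg y z = y (nat (fst z)) - snd z"

definition arm :: "nat \<Rightarrow> nat \<Rightarrow> (nat \<Rightarrow> int) \<Rightarrow> int \<times> int \<Rightarrow> nat" where
  "arm d n y z = card {q. q < fst z \<and> (q, snd z) \<in> boxes d n y}"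

text \<open>The first disjunct of the last conjunct is the convention that a quotient by a zero arm
  length is infinite.\<close>

definition dinv :: "nat \<Rightarrow> nat \<Rightarrow> nat \<Rightarrow> (nat \<Rightarrow> int) \<Rightarrow> nat" where
  "dinv d n m y = card {z \<in> boxes d n y.
     real_of_int (leg y z) / (real (arm d n y z) + 1) \<le> real m / real n \<and>
     (arm d n y z = 0 \<or>
      real m / real n < (real_of_int (leg y z) + 1) / real (arm d n y z))}"

definition codinv :: "nat \<Rightarrow> nat \<Rightarrow> nat \<Rightarrow> (nat \<Rightarrow> int) \<Rightarrow> int" where
  "codinv d n m y = int (delta (Gamma d n m)) - int (dinv d n m y)"

section \<open>The map from Dyck paths to matrices\<close>

definition pcand :: "nat \<Rightarrow> nat \<Rightarrow> nat \<Rightarrow> (nat \<Rightarrow> int) \<Rightarrow> nat set" where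
  "pcand n m u r = {x. x \<le> u * n \<and> r x \<le> r (x + n - 1) + int m}"

text \<open>\<open>rkvec d n m y k\<close> is the \<open>k\<close>-th rank vector; only its entries at
  \<open>x < (d - k) * n\<close> are meaningful. Step \<open>k + 1\<close> treats \<open>u = d - (k + 1)\<close>.\<close>

primrec rkvec :: "nat \<Rightarrow> nat \<Rightarrow> nat \<Rightarrow> (nat \<Rightarrow> int) \<Rightarrow> nat \<Rightarrow> nat \<Rightarrow> int" where
  "rkvec d n m y 0 = (\<lambda>x. int m * int x - int n * y x)"
| "rkvec d n m y (Suc k) =
     (\<lambda>x. if x < Max (pcand n m (d - Suc k) (rkvec d n m y k))
          then rkvec d n m y k x else rkvec d n m y k (x + n))"

definition pset :: "nat \<Rightarrow> nat \<Rightarrow> nat \<Rightarrow> (nat \<Rightarrow> int) \<Rightarrow> nat \<Rightarrow> nat set" where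
  "pset d n m y u = pcand n m u (rkvec d n m y (d - u - 1))"

definition pidx :: "nat \<Rightarrow> nat \<Rightarrow> nat \<Rightarrow> (nat \<Rightarrow> int) \<Rightarrow> nat \<Rightarrow> nat" where
  "pidx d n m y u = Max (pset d n m y u)"

definition iidx :: "nat \<Rightarrow> nat \<Rightarrow> nat \<Rightarrow> (nat \<Rightarrow> int) \<Rightarrow> nat \<Rightarrow> nat \<Rightarrow> nat" where
  "iidx d n m y j u = Min {i. i \<le> u \<and> pidx d n m y u \<le> i * n + j}"

definition scyc :: "nat \<Rightarrow> nat \<Rightarrow> nat \<Rightarrow> (nat \<Rightarrow> int) \<Rightarrow> nat \<Rightarrow> nat \<Rightarrow> nat \<Rightarrow> nat" where
  "scyc d n m y j u = cycle_of_list [iidx d n m y j u..<Suc u]"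

text \<open>\<open>fold\<close> puts later factors on the left: \<open>u = 1\<close> is applied first.\<close>

definition sperm :: "nat \<Rightarrow> nat \<Rightarrow> nat \<Rightarrow> (nat \<Rightarrow> int) \<Rightarrow> nat \<Rightarrow> nat \<Rightarrow> nat" where
  "sperm d n m y j = fold (\<lambda>u s. scyc d n m y j u \<circ> s) [1..<d] id"

definition Psi :: "nat \<Rightarrow> nat \<Rightarrow> nat \<Rightarrow> (nat \<Rightarrow> int) \<Rightarrow> nat \<Rightarrow> nat \<Rightarrow> int" where
  "Psi d n m y i j =
     y (sperm d n m y j i * n + j) - (int (sperm d n m y j i) - int i) * int m"

text \<open>The same map, with values in subsets instead of matrices.\<close>

definition PsiSet :: "nat \<Rightarrow> nat \<Rightarrow> nat \<Rightarrow> (nat \<Rightarrow> int) \<Rightarrow> nat set" where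
  "PsiSet d n m y = subset_of_matrix d n m (Psi d n m y)"

definition rkhat :: "nat \<Rightarrow> nat \<Rightarrow> nat \<Rightarrow> (nat \<Rightarrow> int) \<Rightarrow> int \<times> int \<Rightarrow> int" where
  "rkhat d n m y z = int d * rk n m z
     + int (inv (sperm d n m y (nat (fst z) mod n)) (nat (fst z) div n))"

section \<open>Sanity checks for the encodings\<close>

lemma progression_self: "a \<in> progression N a"
  unfolding progression_def by (rule CollectI, rule exI[of _ 0]) simp

lemma progression_shift:
  assumes "t \<in> progression N a"
  shows "t + N \<in> progression N a"
proof -
  from assms obtain k where "t = a + N * k" unfolding progression_def by blast
  then have "t + N = a + N * Suc k" by simp
  then show ?thesis unfolding progression_def by blast
qed

text \<open>For a set closed under adding \<open>N\<close>, \<open>generators\<close> is the unique set of starting points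
  of a decomposition into disjoint arithmetic progressions of difference \<open>N\<close>.\<close>

lemma progression_generators:
  assumes N: "N > 0" and cl: "\<And>t. t \<in> S \<Longrightarrow> t + N \<in> S"
  shows "S = (\<Union>a\<in>A. progression N a) \<and> disjoint_family_on (progression N) A
    \<longleftrightarrow> A = generators N S"
proof
  assume asm: "S = (\<Union>a\<in>A. progression N a) \<and> disjoint_family_on (progression N) A"
  show "A = generators N S"
  proof
    show "A \<subseteq> generators N S"
    proof
      fix a assume a: "a \<in> A"
      have "a \<noteq> b + N" if "b \<in> S" for b
      proof
        assume eq: "a = b + N"
        from that asm obtain a' where a': "a' \<in> A" "b \<in> progression N a'" by blast
        from progression_shift[OF a'(2)] eq have "a \<in> progression N a'" by simp
        with progression_self[of a N] a a'(1) asm have "a' = a"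
          unfolding disjoint_family_on_def by blast
        with a'(2) eq N show False unfolding progression_def by auto
      qed
      with a progression_self[of a N] asm show "a \<in> generators N S" unfolding generators_def by blast
    qed
    show "generators N S \<subseteq> A"
    proof
      fix a assume a: "a \<in> generators N S"
      then have "a \<in> S" unfolding generators_def by simp
      with asm obtain a' k where a': "a' \<in> A" "a = a' + N * k"
        unfolding progression_def by blast
      show "a \<in> A"
      proof (cases k)
        case 0 with a' show ?thesis by simp
      next
        case (Suc l)
        then have "a = (a' + N * l) + N" using a' by simp
        moreover have "a' + N * l \<in> S" using asm a'(1) unfolding progression_def by blast
        ultimately show ?thesis using a unfolding generators_def by blast
      qed
    qed
  qed
next
  assume A: "A = generators N S"
  have iter: "t + N * k \<in> S" if "t \<in> S" for t k
  proof (induction k)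
    case (Suc k)
    then show ?case using cl[of "t + N * k"] by (simp add: algebra_simps)
  qed (use that in simp)
  have cover: "\<exists>a\<in>generators N S. t \<in> progression N a" if "t \<in> S" for t
    using that
  proof (induction t rule: less_induct)
    case (less t)
    show ?case
    proof (cases "t \<in> generators N S")
      case True
      then show ?thesis using progression_self by blast
    next
      case False
      with less.prems obtain b where b: "b \<in> S" "t = b + N" unfolding generators_def by blast
      with N less.IH[of b] obtain a where "a \<in> generators N S" "b \<in> progression N a"
        by auto
      then show ?thesis using b(2) progression_shift by blast
    qed
  qed
  have le: "a = b" if "a \<in> generators N S" "b \<in> generators N S" "a + N * k = b + N * l" "k \<le> l"
    for a b k l
  proof -
    obtain r where r: "l = k + r" using \<open>k \<le> l\<close> le_Suc_ex by blast
    then have ab: "a = b + N * r" using that(3) by (simp add: algebra_simps)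
    show ?thesis
    proof (cases r)
      case 0 with ab show ?thesis by simp
    next
      case (Suc q)
      then have "a = (b + N * q) + N" using ab by simp
      moreover have "b + N * q \<in> S" using iter that(2) unfolding generators_def by blast
      ultimately show ?thesis using that(1) unfolding generators_def by blast
    qed
  qed
  have "disjoint_family_on (progression N) A"
    unfolding disjoint_family_on_def
  proof (intro ballI impI)
    fix a b assume ab: "a \<in> A" "b \<in> A" "a \<noteq> b"
    show "progression N a \<inter> progression N b = {}"
    proof (rule ccontr)
      assume "progression N a \<inter> progression N b \<noteq> {}"
      then obtain k l where kl: "a + N * k = b + N * l" unfolding progression_def by auto
      have "a = b"
        using le[of a b k l] le[of b a l k] ab A kl by (cases "k \<le> l") auto
      with ab show False by simp
    qed
  qed
  moreover have "S = (\<Union>a\<in>A. progression N a)"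
  proof
    show "S \<subseteq> (\<Union>a\<in>A. progression N a)" using cover A by auto
    show "(\<Union>a\<in>A. progression N a) \<subseteq> S"
      using iter A unfolding progression_def generators_def by auto
  qed
  ultimately show "S = (\<Union>a\<in>A. progression N a) \<and> disjoint_family_on (progression N) A"
    by blast
qed

text \<open>A matrix that represents a set determines it.\<close>

lemma represents_subset_of_matrix:
  assumes N: "d * n > 0" and cl: "\<And>t. t \<in> \<Delta> \<Longrightarrow> t + d * n \<in> \<Delta>"
    and rep: "represents d n m \<Delta> c"
  shows "\<Delta> = subset_of_matrix d n m c"
proof -
  have D: "\<Delta> = (\<Union>a\<in>generators (d * n) \<Delta>. progression (d * n) a)"
    using progression_generators[OF N cl, of "generators (d * n) \<Delta>"] by blast
  have G: "int ` generators (d * n) \<Delta>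
      = {int (ahat d n m i j) - int (d * n) * c i j | i j. i < d \<and> j < n}"
    using rep unfolding represents_def by blast
  show ?thesis
  proof (intro set_eqI iffI)
    fix t assume "t \<in> \<Delta>"
    then obtain a k where a: "a \<in> generators (d * n) \<Delta>" "t = a + d * n * k"
      using D unfolding progression_def by blast
    from a(1) G obtain i j where ij: "i < d" "j < n"
      "int a = int (ahat d n m i j) - int (d * n) * c i j" by blast
    from a(2) have "int t = int a + int (d * n) * int k" by simp
    with ij show "t \<in> subset_of_matrix d n m c" unfolding subset_of_matrix_def by auto
  next
    fix t assume "t \<in> subset_of_matrix d n m c"
    then obtain i j k where ij: "i < d" "j < n"
      "int t = int (ahat d n m i j) - int (d * n) * c i j + int (d * n) * int k"
      unfolding subset_of_matrix_def by blast
    then have "int (ahat d n m i j) - int (d * n) * c i j \<in> int ` generators (d * n) \<Delta>"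
      using G by blast
    then obtain a where a: "a \<in> generators (d * n) \<Delta>"
      "int a = int (ahat d n m i j) - int (d * n) * c i j" by force
    then have "int t = int (a + d * n * k)" using ij by simp
    then have "t = a + d * n * k" using of_nat_eq_iff by blast
    with a(1) show "t \<in> \<Delta>" using D unfolding progression_def by blast
  qed
qed

lemma cycle_of_upt:
  assumes "a \<le> u"
  shows "cycle_of_list [a..<Suc u] t
    = (if a \<le> t \<and> t < u then t + 1 else if t = u then a else t)"
  using assms
proof (induction "u - a" arbitrary: a)
  case 0
  then have "[a..<Suc u] = [u]" by simp
  with 0 show ?case by auto
next
  case (Suc k)
  then have lt: "a < u" by simp
  then have "[a..<Suc u] = a # Suc a # [Suc (Suc a)..<Suc u]"
    by (simp add: upt_conv_Cons)
  moreover have "[Suc a..<Suc u] = Suc a # [Suc (Suc a)..<Suc u]"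
    using lt by (simp add: upt_conv_Cons)
  ultimately have "cycle_of_list [a..<Suc u] t
      = Transposition.transpose a (Suc a) (cycle_of_list [Suc a..<Suc u] t)"
    by simp
  also have "cycle_of_list [Suc a..<Suc u] t
      = (if Suc a \<le> t \<and> t < u then t + 1 else if t = u then Suc a else t)"
    using Suc lt by (intro Suc.hyps(1)) auto
  finally show ?case using lt by (auto simp: Transposition.transpose_def)
qed

end

theory Submission
  imports Defs
begin

text \<open>Reading a set \<open>\<Delta>\<close> modulo \<open>d\<close> cuts it into layers \<open>{q. d * q + i \<in> \<Delta>}\<close>, \<open>i < d\<close>. Invariance of
\<open>\<Delta>\<close> under \<open>d * n\<close> and \<open>d * m\<close> says that every layer is a module over the semigroup generated by \<open>n\<close> and
\<open>m\<close>. Such a module has one \<open>n\<close>-generator in each residue class modulo \<open>n\<close>; writing \<open>g x\<close> for the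
one congruent to \<open>m * x\<close>, invariance under \<open>m\<close> becomes \<open>g (x + 1) \<le> g x + m\<close>, a cyclic condition
(\<open>gen_cycle\<close>). Admissibility for \<open>i < d - 1\<close> says that some generator of layer \<open>i\<close>, raised by \<open>m\<close>,
lies in layer \<open>i + 1\<close> (\<open>linked\<close>); the condition for \<open>i = d - 1\<close> and invariance under \<open>d * m * n + 1\<close>
then follow. So an admissible set is a chain of \<open>d\<close> linked generator cycles starting at \<open>0\<close>
(\<open>modset_Adm\<close>, \<open>Adm_is_modset\<close>).

A Dyck path is determined by its ranks \<open>r x = m * x - n * y x\<close>. These form a word of length \<open>d * n\<close> that
obeys the same rule \<open>r (x + 1) \<le> r x + m\<close>, now without the cyclic closure. The index \<open>p\<close> of step \<open>u\<close> is
the last position at which \<open>n\<close> consecutive entries close up to a cycle. Cutting out this window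
leaves a shorter word of the same kind (\<open>rank_word_del\<close>) whose own last window starts further to the left
(\<open>cut_del_less\<close>) and is linked to the removed one (\<open>linked_window\<close>). Conversely, a linked cycle can
be put back in exactly one way: at the last position where it fits (\<open>ins_del_window\<close>,
\<open>window_ins\<close>, \<open>del_ins\<close>). Hence paths correspond to chains, and the windows are the layers. The permutations
\<open>sperm\<close> merely record in which column of the path a generator of a layer originally stood
(\<open>partial_sperm_props\<close>), which identifies \<open>Psi\<close> and \<open>rkhat\<close> with this correspondence; the
statements about sizes and about \<open>rkhat\<close> are then division with remainder by \<open>d\<close>.

For the dimension formula, both \<open>dinv\<close> and \<open>dim_stat\<close> are written as sums over pairs of ranks of functions
of their difference: \<open>dinv\<close> over pairs in path order (\<open>int_dinv\<close>), \<open>dim_stat\<close> over pairs of generators, with ties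
broken by the layers (\<open>dim_stat_modset\<close>). For a single difference the two summands add up to a
carry \<open>(e + m) div n - e div n\<close> (\<open>upper_lower\<close>), and the sum of carries over a complete residue system
is \<open>m\<close>. The layers are now added one at a time. An entry to the left of the new window meets it
in the order of the layers, so this identity applies directly. An entry to the right of it meets
it in the opposite order, but it and its shift by \<open>m\<close> lie below the generators of the new module in their classes, which makes
the corrections cancel (\<open>cross_after\<close>). Either way the entry contributes \<open>m\<close>, so the total of the two statistics
depends only on \<open>d\<close>, \<open>n\<close> and \<open>m\<close>, and it is \<open>\<delta>\<close> (\<open>pairs_total\<close>, \<open>dim_stat_PsiSet\<close>).\<close>

section \<open>Rank words and generator cycles\<close>

locale slope =
  fixes n m :: nat
  assumes n_gt: "1 < n" and cop: "coprime m n"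
begin

lemma n_pos: "0 < n" using n_gt by simp

lemma cong_m_iff: "[int m * int x = int m * int y] (mod int n) \<longleftrightarrow> [x = y] (mod n)"
  using cop by (simp add: cong_mult_lcancel cong_int_iff)

lemma ex_index: "\<exists>x<n. [q = int m * int x] (mod int n)"
proof -
  have "coprime (int m) (int n)" using cop by simp
  then obtain z where z: "[int m * z = q] (mod int n)"
    using cong_solve_coprime_int[of "int m" "int n"]
    by (metis cong_scalar_left mult.assoc mult.commute mult.right_neutral)
  let ?x = "nat (z mod int n)"
  have "?x < n" using n_pos by (simp add: nat_less_iff)
  moreover have "[q = int m * int ?x] (mod int n)"
    using z n_pos by (simp add: cong_def mod_mult_right_eq)
  ultimately show ?thesis by blast
qed

text \<open>The ranks of a path with \<open>k * n\<close> columns. Nonnegativity says that the path stays below the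
diagonal; the last condition says that its heights increase weakly.\<close>

definition rank_word :: "nat \<Rightarrow> (nat \<Rightarrow> int) \<Rightarrow> bool" where
  "rank_word k r \<longleftrightarrow> r 0 = 0
     \<and> (\<forall>x<k * n. 0 \<le> r x \<and> [r x = int m * int x] (mod int n))
     \<and> (\<forall>x. x + 1 < k * n \<longrightarrow> r (x + 1) \<le> r x + int m)"

text \<open>The \<open>n\<close>-generators of a module over the semigroup generated by \<open>n\<close> and \<open>m\<close>. The index runs periodically
over all naturals, so that no residue class is singled out as the start of the cycle.\<close>

definition gen_cycle :: "(nat \<Rightarrow> int) \<Rightarrow> bool" where
  "gen_cycle g \<longleftrightarrow> (\<forall>x. 0 \<le> g x \<and> [g x = int m * int x] (mod int n)
     \<and> g (x + n) = g x \<and> g (x + 1) \<le> g x + int m)"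

lemma gen_cycleD:
  assumes "gen_cycle g"
  shows "0 \<le> g x" "[g x = int m * int x] (mod int n)" "g (x + n) = g x" "g (x + 1) \<le> g x + int m"
  using assms unfolding gen_cycle_def by auto

lemma gen_cycle_mod:
  assumes "gen_cycle g" shows "g (x mod n) = g x"
proof -
  have "g (x + k * n) = g x" for x k
    by (induction k) (use gen_cycleD(3)[OF assms] in \<open>auto simp: algebra_simps\<close>,
      metis add.assoc add.commute)
  from this[of "x mod n" "x div n"] show ?thesis by simp
qed

lemma gen_cycle_cong:
  assumes "gen_cycle g" "[x = y] (mod n)" shows "g x = g y"
  using assms gen_cycle_mod unfolding cong_def by metis

text \<open>For the generators \<open>g\<close>, \<open>h\<close> of two consecutive layers: raising some generator \<open>g x\<close> by \<open>m\<close> leads into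
the next layer, whose generator in the class of \<open>m * (x + 1)\<close> is \<open>h (x + 1)\<close>.\<close>

definition linked :: "(nat \<Rightarrow> int) \<Rightarrow> (nat \<Rightarrow> int) \<Rightarrow> bool" where
  "linked g h \<longleftrightarrow> (\<exists>x. h (x + 1) \<le> g x + int m)"

text \<open>The element of \<open>{p..<p + n}\<close> congruent to \<open>x\<close>; the summand \<open>(n - 1) * p\<close> stands for \<open>- p\<close>.\<close>

definition wpos :: "nat \<Rightarrow> nat \<Rightarrow> nat" where
  "wpos p x = p + (x + (n - 1) * p) mod n"

lemma wpos_ge: "p \<le> wpos p x" by (simp add: wpos_def)
lemma wpos_less: "wpos p x < p + n" using n_pos by (simp add: wpos_def)

lemma wpos_cong: "[wpos p x = x] (mod n)"
proof -
  have "wpos p x mod n = (p + (x + (n - 1) * p)) mod n" by (simp add: wpos_def mod_add_right_eq)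
  also have "p + (x + (n - 1) * p) = x + n * p" using n_pos by (cases n) auto
  finally show ?thesis by (simp add: cong_def)
qed

lemma wpos_unique:
  assumes "p \<le> x" "x < p + n" "[x = z] (mod n)" shows "wpos p z = x"
proof -
  have c: "[wpos p z = x] (mod n)" using wpos_cong assms(3) cong_sym cong_trans by blast
  have "wpos p z - p = x - p"
  proof -
    have "[p + (wpos p z - p) = p + (x - p)] (mod n)" using c wpos_ge[of p z] assms(1) by simp
    then have "[wpos p z - p = x - p] (mod n)" by (simp only: cong_add_lcancel_nat)
    then show ?thesis using wpos_less[of p z] wpos_ge[of p z] assms n_pos
      by (metis cong_less_modulus_unique_nat less_diff_conv2 add.commute)
  qed
  then show ?thesis using wpos_ge[of p z] assms(1) by linarith
qed

lemma wpos_id: "p \<le> x \<Longrightarrow> x < p + n \<Longrightarrow> wpos p x = x" by (rule wpos_unique) auto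

section \<open>Cutting the last window out of a rank word\<close>

definition cut :: "nat \<Rightarrow> (nat \<Rightarrow> int) \<Rightarrow> nat" where
  "cut u r = Max (pcand n m u r)"

definition del :: "nat \<Rightarrow> (nat \<Rightarrow> int) \<Rightarrow> nat \<Rightarrow> int" where
  "del u r x = (if x < cut u r then r x else r (x + n))"

text \<open>The \<open>n\<close> entries that start at the cut, continued periodically.\<close>

definition window :: "nat \<Rightarrow> (nat \<Rightarrow> int) \<Rightarrow> nat \<Rightarrow> int" where
  "window u r x = r (wpos (cut u r) x)"

lemma finite_pcand: "finite (pcand n m u r)"
  by (rule finite_subset[of _ "{..u * n}"]) (auto simp: pcand_def)

context
  fixes u r
  assumes W: "rank_word (Suc u) r"
begin

lemma zero_pcand: "0 \<in> pcand n m u r"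
proof -
  have "n - 1 < Suc u * n" using n_pos by auto
  then have "0 \<le> r (n - 1)" "r 0 = 0" using W unfolding rank_word_def by blast+
  then show ?thesis by (simp add: pcand_def)
qed

lemma cut_pcand: "cut u r \<in> pcand n m u r"
  unfolding cut_def using zero_pcand by (intro Max_in finite_pcand) auto

lemma cut_le: "cut u r \<le> u * n" using cut_pcand by (simp add: pcand_def)

lemma cut_closes: "r (cut u r) \<le> r (cut u r + n - 1) + int m"
  using cut_pcand by (simp add: pcand_def)

lemma after_cut: "cut u r < x \<Longrightarrow> x \<le> u * n \<Longrightarrow> r (x + n - 1) + int m < r x"
  using Max_ge[OF finite_pcand, of x u r] unfolding cut_def pcand_def
  by (metis (mono_tags, lifting) linorder_not_le mem_Collect_eq)

lemma word_step: "x + 1 < Suc u * n \<Longrightarrow> r (x + 1) \<le> r x + int m"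
  and word_nonneg: "x < Suc u * n \<Longrightarrow> 0 \<le> r x"
  and word_cong: "x < Suc u * n \<Longrightarrow> [r x = int m * int x] (mod int n)"
  and word_zero: "r 0 = 0"
  using W unfolding rank_word_def by blast+

text \<open>Maximality of the cut and the step condition together: to the right of the cut, entries \<open>n\<close> places apart
decrease.\<close>

lemma descent:
  assumes "cut u r \<le> x" "x < u * n" shows "r (x + n) < r x"
proof -
  have "r (x + n) + int m < r (x + 1)" using after_cut[of "x + 1"] assms by simp
  moreover have "r (x + 1) \<le> r x + int m" using assms n_gt by (intro word_step) auto
  ultimately show ?thesis by simp
qed

lemma cut_pos: assumes "0 < u" shows "0 < cut u r"
proof (rule ccontr)
  assume "\<not> 0 < cut u r"
  moreover have "0 < u * n" using assms n_pos by simp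
  ultimately have "r n < 0" using descent[of 0] word_zero by simp
  moreover have "0 \<le> r n" using assms n_pos by (intro word_nonneg) auto
  ultimately show False by simp
qed

text \<open>The inequality that makes the cut a candidate is exactly the missing step from the last entry of
the window back to its first one.\<close>

lemma gen_cycle_window: "gen_cycle (window u r)"
  unfolding gen_cycle_def
proof (intro allI conjI)
  fix x
  let ?p = "cut u r" and ?y = "wpos (cut u r) x"
  have lt: "?y < Suc u * n" using wpos_less[of ?p x] cut_le by simp
  show "0 \<le> window u r x" using word_nonneg[OF lt] by (simp add: window_def)
  show "[window u r x = int m * int x] (mod int n)"
    using word_cong[OF lt] wpos_cong[of ?p x] cong_m_iff cong_trans unfolding window_def by blast
  have "wpos ?p (x + n) = ?y"
    by (rule wpos_unique) (use wpos_ge wpos_less wpos_cong in \<open>auto simp: cong_def\<close>)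
  then show "window u r (x + n) = window u r x" by (simp add: window_def)
  show "window u r (x + 1) \<le> window u r x + int m"
  proof (cases "?y + 1 < ?p + n")
    case True
    have "wpos ?p (x + 1) = ?y + 1"
      using True wpos_ge[of ?p x] wpos_cong[of ?p x]
      by (intro wpos_unique) (auto intro: cong_add simp: Suc_eq_plus1 simp del: One_nat_def)
    moreover have "?y + 1 < Suc u * n" using True cut_le by simp
    ultimately show ?thesis using word_step by (simp add: window_def)
  next
    case False
    then have y: "?y = ?p + n - 1" "?y + 1 = ?p + n" using wpos_less[of ?p x] n_pos by auto
    have "[?y + 1 = x + 1] (mod n)" using wpos_cong[of ?p x] by (intro cong_add) auto
    then have "[?p = x + 1] (mod n)" unfolding y(2) by (simp add: cong_def)
    then have "wpos ?p (x + 1) = ?p" using n_pos by (intro wpos_unique) auto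
    then show ?thesis using cut_closes y(1) by (simp add: window_def)
  qed
qed

text \<open>By descent, the window holds the largest of the entries in its residue class from the cut on.\<close>

lemma word_le_window:
  "cut u r \<le> x \<Longrightarrow> x < Suc u * n \<Longrightarrow> r x \<le> window u r x"
proof (induction x rule: less_induct)
  case (less x)
  show ?case
  proof (cases "x < cut u r + n")
    case True
    then show ?thesis using less.prems wpos_id by (simp add: window_def)
  next
    case False
    then have x: "x - n < x" "cut u r \<le> x - n" "x - n < u * n" "x - n + n = x" using less.prems n_pos by auto
    have "r x < r (x - n)" using descent[OF x(2,3)] x(4) by simp
    also have "r (x - n) \<le> window u r (x - n)" using less.IH[OF x(1,2)] x(3) by simp
    also have "\<dots> = window u r x" using gen_cycleD(3)[OF gen_cycle_window, of "x - n"] x(4) by simp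
    finally show ?thesis by simp
  qed
qed

end

context
  fixes u r
  assumes W: "rank_word (Suc (Suc u)) r"
begin

text \<open>The only new step is the one across the cut, where descent makes the right-hand entry
smaller than the one it replaces.\<close>

lemma rank_word_del: "rank_word (Suc u) (del (Suc u) r)"
  unfolding rank_word_def
proof (intro conjI allI impI)
  let ?p = "cut (Suc u) r"
  show "del (Suc u) r 0 = 0" using cut_pos[OF W] word_zero[OF W] by (simp add: del_def)
  fix x
  {
    assume x: "x < Suc u * n"
    then show "0 \<le> del (Suc u) r x" using word_nonneg[OF W] by (simp add: del_def)
    show "[del (Suc u) r x = int m * int x] (mod int n)"
    proof (cases "x < ?p")
      case True then show ?thesis using word_cong[OF W] x by (simp add: del_def)
    next
      case False
      have "[r (x + n) = int m * int (x + n)] (mod int n)" using x by (intro word_cong[OF W]) simp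
      also have "[int m * int (x + n) = int m * int x] (mod int n)"
        unfolding cong_m_iff by (simp add: cong_def)
      finally show ?thesis using False by (simp add: del_def)
    qed
  next
    assume x: "x + 1 < Suc u * n"
    consider "x + 1 < ?p" | "x + 1 = ?p" | "?p \<le> x" by linarith
    then show "del (Suc u) r (x + 1) \<le> del (Suc u) r x + int m"
    proof cases
      case 1 then show ?thesis using word_step[OF W, of x] x by (simp add: del_def)
    next
      case 2
      have "r (x + 1 + n) < r (x + 1)" using 2 x by (intro descent[OF W]) auto
      also have "\<dots> \<le> r x + int m" using x by (intro word_step[OF W]) simp
      finally have "r (x + 1 + n) \<le> r x + int m" by simp
      moreover have "\<not> x + 1 < ?p" "x < ?p" using 2 by auto
      ultimately show ?thesis unfolding del_def by (simp only: if_False if_True)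
    next
      case 3 then show ?thesis using word_step[OF W, of "x + n"] x by (simp add: del_def)
    qed
  }
qed

text \<open>A candidate of the shorter word at or behind the cut would come from a candidate of the
original word behind the cut.\<close>

lemma cut_del_less: "cut u (del (Suc u) r) < cut (Suc u) r"
proof (rule ccontr)
  let ?q = "cut u (del (Suc u) r)"
  assume a: "\<not> ?thesis"
  have "del (Suc u) r ?q \<le> del (Suc u) r (?q + n - 1) + int m" by (rule cut_closes[OF rank_word_del])
  moreover have "?q + n - 1 + n = ?q + n + n - 1" using n_pos by simp
  ultimately have "r (?q + n) \<le> r (?q + n + n - 1) + int m" using a n_pos
    by (simp add: del_def add.commute split: if_splits)
  moreover have "r (?q + n + n - 1) + int m < r (?q + n)"
    using cut_le[OF rank_word_del] a n_pos by (intro after_cut[OF W]) auto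
  ultimately show False by simp
qed

text \<open>The entry in front of the cut is at most the generator of its class in the next window to be removed,
and the first entry of the present window is at most \<open>m\<close> above that entry.\<close>

lemma linked_window: "linked (window u (del (Suc u) r)) (window (Suc u) r)"
proof -
  let ?p = "cut (Suc u) r"
  have p: "0 < ?p" "?p \<le> Suc u * n" "cut u (del (Suc u) r) \<le> ?p - 1"
    using cut_pos[OF W] cut_le[OF W] cut_del_less by auto
  have "window (Suc u) r (?p - 1 + 1) = r ?p" using p n_pos by (simp add: window_def wpos_id)
  also have "\<dots> \<le> r (?p - 1) + int m"
    using word_step[OF W, of "?p - 1"] p n_pos by simp
  also have "r (?p - 1) = del (Suc u) r (?p - 1)" using p by (simp add: del_def)
  also have "\<dots> \<le> window u (del (Suc u) r) (?p - 1)"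
    using p by (intro word_le_window[OF rank_word_del]) auto
  finally show ?thesis unfolding linked_def by auto
qed

end

section \<open>Inserting a cycle into a rank word\<close>

text \<open>The last position where an entry of the cycle \<open>g\<close> may follow the preceding entry of the word.\<close>

definition slot :: "nat \<Rightarrow> (nat \<Rightarrow> int) \<Rightarrow> (nat \<Rightarrow> int) \<Rightarrow> nat" where
  "slot u w g = Max {x. cut u w < x \<and> x \<le> Suc u * n \<and> g x \<le> w (x - 1) + int m}"

definition ins :: "nat \<Rightarrow> (nat \<Rightarrow> int) \<Rightarrow> (nat \<Rightarrow> int) \<Rightarrow> nat \<Rightarrow> int" where
  "ins u w g x = (if x < slot u w g then w x else if x < slot u w g + n then g x else w (x - n))"

text \<open>The position of the cut is recovered from the remaining word and the window alone: a later slot \<open>x\<close> would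
turn \<open>x\<close> into a candidate of the original word.\<close>

lemma ins_del_window:
  assumes W: "rank_word (Suc (Suc u)) r"
  shows "ins u (del (Suc u) r) (window (Suc u) r) = r"
proof -
  let ?p = "cut (Suc u) r" and ?w = "del (Suc u) r" and ?g = "window (Suc u) r"
  have p: "0 < ?p" "?p \<le> Suc u * n" using cut_pos[OF W] cut_le[OF W] by auto
  have "slot u ?w ?g = ?p" unfolding slot_def
  proof (rule Max_eqI)
    show "finite {x. cut u ?w < x \<and> x \<le> Suc u * n \<and> ?g x \<le> ?w (x - 1) + int m}"
      by (rule finite_subset[of _ "{..Suc u * n}"]) auto
    have "r ?p \<le> r (?p - 1) + int m" using word_step[OF W, of "?p - 1"] p n_pos by simp
    then show "?p \<in> {x. cut u ?w < x \<and> x \<le> Suc u * n \<and> ?g x \<le> ?w (x - 1) + int m}"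
      using p cut_del_less[OF W] n_pos by (simp add: window_def del_def wpos_id)
  next
    fix x assume x: "x \<in> {x. cut u ?w < x \<and> x \<le> Suc u * n \<and> ?g x \<le> ?w (x - 1) + int m}"
    show "x \<le> ?p"
    proof (rule ccontr)
      assume "\<not> x \<le> ?p"
      then have lt: "?p < x" "x \<le> Suc u * n" using x by auto
      have "r (x + n - 1) + int m < r x" using after_cut[OF W] lt by simp
      also have "r x \<le> ?g x" using lt n_pos by (intro word_le_window[OF W]) auto
      also have "?g x \<le> ?w (x - 1) + int m" using x by simp
      also have "?w (x - 1) = r (x + n - 1)" using lt by (simp add: del_def)
      finally show False by simp
    qed
  qed
  then show ?thesis by (auto simp: ins_def fun_eq_iff window_def del_def wpos_id)
qed

context
  fixes u w g
  assumes W: "rank_word (Suc u) w" and G: "gen_cycle g" and L: "linked (window u w) g"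
begin

text \<open>Linkedness provides a slot within one period behind the cut of \<open>w\<close>, so the maximum is taken over a nonempty
set.\<close>

lemma
  shows slot_gt: "cut u w < slot u w g" and slot_le: "slot u w g \<le> Suc u * n"
    and slot_fits: "g (slot u w g) \<le> w (slot u w g - 1) + int m"
    and slot_max: "slot u w g < x \<Longrightarrow> x \<le> Suc u * n \<Longrightarrow> w (x - 1) + int m < g x"
proof -
  let ?S = "{x. cut u w < x \<and> x \<le> Suc u * n \<and> g x \<le> w (x - 1) + int m}"
  have fin: "finite ?S" by (rule finite_subset[of _ "{..Suc u * n}"]) auto
  from L obtain x where x: "g (x + 1) \<le> window u w x + int m" unfolding linked_def by blast
  let ?y = "wpos (cut u w) x"
  have "[?y + 1 = x + 1] (mod n)" using wpos_cong[of "cut u w" x] by (intro cong_add) auto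
  then have "g (?y + 1) = g (x + 1)" using gen_cycle_cong[OF G] by blast
  moreover have "?y + 1 \<le> Suc u * n" using wpos_less[of "cut u w" x] cut_le[OF W] by simp
  ultimately have "?y + 1 \<in> ?S" using wpos_ge[of "cut u w" x] x by (simp add: window_def)
  then have "slot u w g \<in> ?S" unfolding slot_def by (intro Max_in[OF fin]) auto
  then show "cut u w < slot u w g" "slot u w g \<le> Suc u * n"
    "g (slot u w g) \<le> w (slot u w g - 1) + int m" by auto
  then show "slot u w g < x \<Longrightarrow> x \<le> Suc u * n \<Longrightarrow> w (x - 1) + int m < g x" for x
    using Max_ge[OF fin, of x] unfolding slot_def[symmetric] by force
qed

lemma rank_word_ins: "rank_word (Suc (Suc u)) (ins u w g)"
  unfolding rank_word_def
proof (intro conjI allI impI)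
  let ?p = "slot u w g"
  show "ins u w g 0 = 0" using slot_gt word_zero[OF W] by (simp add: ins_def)
  fix x
  {
    assume x: "x < Suc (Suc u) * n"
    then have x': "x - n < Suc u * n" using n_pos by (simp add: less_diff_conv2)
    show "0 \<le> ins u w g x"
      using x x' word_nonneg[OF W] gen_cycleD(1)[OF G] slot_le by (simp add: ins_def)
    show "[ins u w g x = int m * int x] (mod int n)"
    proof -
      consider "x < ?p" | "?p \<le> x" "x < ?p + n" | "?p + n \<le> x" by linarith
      then show ?thesis
      proof cases
        case 1 then show ?thesis using slot_le word_cong[OF W] by (simp add: ins_def)
      next
        case 2 then show ?thesis using gen_cycleD(2)[OF G] by (simp add: ins_def)
      next
        case 3
        have "[w (x - n) = int m * int (x - n)] (mod int n)" using word_cong[OF W] x' by simp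
        also have "[int m * int (x - n) = int m * int x] (mod int n)"
          unfolding cong_m_iff using 3 by (simp add: cong_def le_mod_geq)
        finally show ?thesis using 3 by (simp add: ins_def)
      qed
    qed
  next
    assume x: "x + 1 < Suc (Suc u) * n"
    consider "x + 1 < ?p" | "x + 1 = ?p" | "?p \<le> x" "x + 1 < ?p + n" | "x + 1 = ?p + n" | "?p + n \<le> x"
      by linarith
    then show "ins u w g (x + 1) \<le> ins u w g x + int m"
    proof cases
      case 1 then show ?thesis using word_step[OF W, of x] slot_le by (simp add: ins_def)
    next
      case 2
      then have "x = ?p - 1" "x < ?p" by auto
      then have "ins u w g (x + 1) = g ?p" "ins u w g x = w (?p - 1)" using 2 n_pos
        by (simp_all add: ins_def)
      then show ?thesis using slot_fits by simp
    next
      case 3 then show ?thesis using gen_cycleD(4)[OF G, of x] by (simp add: ins_def)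
    next
      case 4
      then have lt: "?p + 1 \<le> Suc u * n" and xe: "?p \<le> x" "x < ?p + n" using x n_pos by auto
      have "w ?p + int m < g (?p + 1)" using slot_max[of "?p + 1"] lt by simp
      also have "\<dots> \<le> g ?p + int m" by (rule gen_cycleD(4)[OF G])
      also have "g ?p = g (x + 1)" using 4 gen_cycleD(3)[OF G] by simp
      also have "\<dots> \<le> g x + int m" by (rule gen_cycleD(4)[OF G])
      finally show ?thesis using 4 xe by (simp add: ins_def)
    next
      case 5
      then have "x - n + 1 < Suc u * n" "x + 1 - n = x - n + 1" using x by auto
      then show ?thesis using word_step[OF W, of "x - n"] 5 by (simp add: ins_def)
    qed
  }
qed

text \<open>A candidate \<open>x\<close> behind the slot is excluded by the maximality of the slot as long as it lies
inside the inserted window, and by the maximality of the cut of \<open>w\<close> afterwards.\<close>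

lemma cut_ins: "cut (Suc u) (ins u w g) = slot u w g"
  unfolding cut_def
proof (rule Max_eqI[OF finite_pcand])
  let ?p = "slot u w g"
  have "?p + n - 1 + 1 = ?p + n" using n_pos by simp
  then have "g ?p \<le> g (?p + n - 1) + int m"
    using gen_cycleD(3,4)[OF G] by metis
  then show "?p \<in> pcand n m (Suc u) (ins u w g)"
    using slot_le n_pos by (auto simp: pcand_def ins_def)
  fix x assume x: "x \<in> pcand n m (Suc u) (ins u w g)"
  show "x \<le> ?p"
  proof (rule ccontr)
    assume "\<not> x \<le> ?p"
    then have lt: "?p < x" "x \<le> Suc u * n" using x by (auto simp: pcand_def)
    have e: "ins u w g (x + n - 1) = w (x - 1)" using lt by (auto simp: ins_def)
    have le: "ins u w g x \<le> w (x - 1) + int m" using x e by (simp add: pcand_def)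
    show False
    proof (cases "x < ?p + n")
      case True
      then show ?thesis using le lt slot_max[OF lt] by (simp add: ins_def)
    next
      case False
      then have "w (x - n + n - 1) + int m < w (x - n)"
        using slot_gt lt by (intro after_cut[OF W]) auto
      then show ?thesis using le False lt by (simp add: ins_def)
    qed
  qed
qed

lemma del_ins: "del (Suc u) (ins u w g) = w"
  by (auto simp: fun_eq_iff del_def cut_ins ins_def)

lemma window_ins: "window (Suc u) (ins u w g) = g"
proof
  fix x
  have "window (Suc u) (ins u w g) x = g (wpos (slot u w g) x)"
    using wpos_ge[of "slot u w g" x] wpos_less[of "slot u w g" x] by (simp add: window_def cut_ins ins_def)
  then show "window (Suc u) (ins u w g) x = g x" using gen_cycle_cong[OF G wpos_cong] by simp
qed

end

text \<open>The values of a word of \<open>Suc u\<close> blocks from \<open>Suc u * n\<close> on are arbitrary; they influence neither its cut nor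
its window.\<close>

lemma cut_cong:
  assumes "\<And>x. x < Suc u * n \<Longrightarrow> r x = r' x" shows "cut u r = cut u r'"
proof -
  have "pcand n m u r = pcand n m u r'"
  proof -
    have "r x = r' x \<and> r (x + n - 1) = r' (x + n - 1)" if "x \<le> u * n" for x
      using that n_pos by (intro conjI assms) auto
    then show ?thesis unfolding pcand_def by auto
  qed
  then show ?thesis by (simp add: cut_def)
qed

lemma window_cong:
  assumes "rank_word (Suc u) r" "\<And>x. x < Suc u * n \<Longrightarrow> r x = r' x" shows "window u r = window u r'"
proof
  fix x
  have "wpos (cut u r) x < Suc u * n" using wpos_less[of "cut u r" x] cut_le[OF assms(1)] by simp
  then show "window u r x = window u r' x" using assms(2) cut_cong[OF assms(2)] by (simp add: window_def)
qed

lemma del_cong: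
  assumes "\<And>x. x < Suc (Suc u) * n \<Longrightarrow> r x = r' x" "x < Suc u * n"
  shows "del (Suc u) r x = del (Suc u) r' x"
proof -
  have "x + n < Suc (Suc u) * n" "x < Suc (Suc u) * n" using assms(2) by auto
  then have "r x = r' x" "r (x + n) = r' (x + n)" by (auto intro: assms(1))
  moreover have "cut (Suc u) r = cut (Suc u) r'" by (rule cut_cong) (rule assms(1))
  ultimately show ?thesis by (simp add: del_def)
qed

lemma ins_cong:
  assumes "\<And>x. x < Suc u * n \<Longrightarrow> w x = w' x" "slot u w g \<le> Suc u * n" "x < Suc (Suc u) * n"
  shows "ins u w g x = ins u w' g x"
proof -
  have "w (x - 1) = w' (x - 1)" if "cut u w < x" "x \<le> Suc u * n" for x
    using that by (intro assms(1)) linarith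
  then have s: "slot u w g = slot u w' g"
    using cut_cong[of u w w'] assms(1) unfolding slot_def
    by (intro arg_cong[of _ _ Max] Collect_cong) auto
  have "x - n < Suc u * n" using assms(3) n_pos by (simp add: less_diff_conv2)
  then show ?thesis using assms(1,2) s by (simp add: ins_def)
qed

section \<open>Counting multiples and gaps\<close>

text \<open>The number of positive multiples of \<open>n\<close> up to \<open>z\<close>.\<close>

definition steps :: "int \<Rightarrow> int" where
  "steps z = max 0 (z div int n)"

lemma le_div_iff: "(b::int) \<le> a div int n \<longleftrightarrow> int n * b \<le> a"
proof
  assume "b \<le> a div int n"
  then have "int n * b \<le> int n * (a div int n)" by (rule mult_left_mono) simp
  also have "\<dots> \<le> a" using mult_div_mod_eq[of "int n" a] pos_mod_sign[of "int n" a] n_pos by linarith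
  finally show "int n * b \<le> a" .
next
  assume "int n * b \<le> a"
  from zdiv_mono1[OF this, of "int n"] show "b \<le> a div int n" using n_pos by simp
qed

text \<open>The gaps of a module in an interval and the boxes that contribute to \<open>dinv\<close> are both counted with this
lemma; expressing them through \<open>steps\<close> is what makes the two statistics comparable.\<close>

lemma card_multiples:
  assumes "lo \<le> hi"
  shows "finite {b::int. b \<le> Y \<and> lo \<le> int n * b \<and> int n * b < hi}"
    and "int (card {b::int. b \<le> Y \<and> lo \<le> int n * b \<and> int n * b < hi})
      = steps (int n * Y - lo + int n) - steps (int n * Y - hi + int n)"
proof -
  define ce where "ce a = - ((- a) div int n)" for a
  have ce: "ce a \<le> b \<longleftrightarrow> a \<le> int n * b" for a b
    using le_div_iff[of "- b" "- a"] by (auto simp: ce_def)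
  have st: "steps (int n * Y - a + int n) = max 0 (Y + 1 - ce a)" for a
  proof -
    have "int n * Y - a + int n = - a + int n * (Y + 1)" by (simp add: algebra_simps)
    then have "(int n * Y - a + int n) div int n = Y + 1 + (- a) div int n"
      using n_pos by (metis div_mult_self2 of_nat_0_eq_iff less_irrefl)
    then show ?thesis by (simp add: steps_def ce_def)
  qed
  have "ce lo \<le> ce hi" using assms ce order_trans by blast
  moreover have S: "{b::int. b \<le> Y \<and> lo \<le> int n * b \<and> int n * b < hi} = {ce lo..min Y (ce hi - 1)}"
  proof -
    have "int n * b < hi \<longleftrightarrow> b \<le> ce hi - 1" for b using ce[of hi b] by linarith
    then show ?thesis using ce[of lo] by auto
  qed
  ultimately show "int (card {b::int. b \<le> Y \<and> lo \<le> int n * b \<and> int n * b < hi})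
      = steps (int n * Y - lo + int n) - steps (int n * Y - hi + int n)"
    unfolding st S by (auto simp: min_def max_def)
  show "finite {b::int. b \<le> Y \<and> lo \<le> int n * b \<and> int n * b < hi}" unfolding S by simp
qed

lemma index_unique:
  "[q = int m * int x] (mod int n) \<Longrightarrow> [q = int m * int y] (mod int n) \<Longrightarrow> [x = y] (mod n)"
  unfolding cong_m_iff[symmetric] by (simp add: cong_def)

text \<open>The module with generators \<open>g\<close>.\<close>

definition module_of :: "(nat \<Rightarrow> int) \<Rightarrow> int set" where
  "module_of g = {q. \<exists>x. [q = int m * int x] (mod int n) \<and> g x \<le> q}"

lemma mem_module_iff:
  assumes "gen_cycle g" "[q = int m * int x] (mod int n)" shows "q \<in> module_of g \<longleftrightarrow> g x \<le> q"
proof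
  assume "q \<in> module_of g"
  then obtain y where y: "[q = int m * int y] (mod int n)" "g y \<le> q" unfolding module_of_def by blast
  then have "[x = y] (mod n)" using assms(2) index_unique by blast
  then show "g x \<le> q" using gen_cycle_cong[OF assms(1)] y by simp
qed (use assms in \<open>auto simp: module_of_def\<close>)

text \<open>The gaps in the class of \<open>g j\<close> are the numbers \<open>g j + n * b\<close> with \<open>b \<le> -1\<close>.\<close>

lemma card_gaps:
  assumes g: "gen_cycle g" and "s \<le> t"
  shows "int (card ({s..<t} - module_of g)) = (\<Sum>j<n. steps (g j - s) - steps (g j - t))"
proof -
  define B where "B j = {b::int. b \<le> -1 \<and> s - g j \<le> int n * b \<and> int n * b < t - g j}" for j
  define A where "A j = (\<lambda>b. g j + int n * b) ` B j" for j
  have cA: "[q = int m * int j] (mod int n)" if "q \<in> A j" for q j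
    using that gen_cycleD(2)[OF g, of j] unfolding A_def by (auto simp: cong_def)
  have U: "{s..<t} - module_of g = (\<Union>j<n. A j)"
  proof (intro set_eqI iffI)
    fix q assume q: "q \<in> {s..<t} - module_of g"
    obtain j where j: "j < n" "[q = int m * int j] (mod int n)" using ex_index by blast
    then have "q < g j" using mem_module_iff[OF g] q by force
    have "[q = g j] (mod int n)" using j gen_cycleD(2)[OF g, of j] by (simp add: cong_def)
    then obtain b where b: "q = g j + int n * b" by (metis cong_iff_lin cong_sym)
    then have "b < 0" using \<open>q < g j\<close> n_pos by (simp add: mult_less_0_iff)
    then have "b \<in> B j" using b q unfolding B_def by auto
    then show "q \<in> (\<Union>j<n. A j)" using j b unfolding A_def by blast
  next
    fix q assume "q \<in> (\<Union>j<n. A j)"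
    then obtain j where j: "j < n" "q \<in> A j" by blast
    then obtain b where b: "b \<in> B j" "q = g j + int n * b" unfolding A_def by blast
    then have "int n * b < 0" using n_pos unfolding B_def by (simp add: mult_less_0_iff)
    then have "q < g j" using b by simp
    then show "q \<in> {s..<t} - module_of g" using mem_module_iff[OF g cA[OF j(2)]] b unfolding B_def by auto
  qed
  have cm: "finite (B j)" "int (card (B j)) = steps (g j - s) - steps (g j - t)" for j
  proof -
    have le: "s - g j \<le> t - g j" using assms(2) by simp
    show "finite (B j)" unfolding B_def by (rule card_multiples(1)[OF le])
    have "int n * - 1 - (a - g j) + int n = g j - a" for a by simp
    then show "int (card (B j)) = steps (g j - s) - steps (g j - t)"
      using card_multiples(2)[OF le, of "- 1"] unfolding B_def by simp
  qed
  have fin: "finite (A j)" for j using cm(1) unfolding A_def by simp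
  have dj: "A i \<inter> A j = {}" if "i < n" "j < n" "i \<noteq> j" for i j
  proof (rule ccontr)
    assume "A i \<inter> A j \<noteq> {}"
    then obtain q where "q \<in> A i" "q \<in> A j" by blast
    then have "[i = j] (mod n)" using cA index_unique by blast
    then show False using that by (simp add: cong_def)
  qed
  have "int (card (A j)) = steps (g j - s) - steps (g j - t)" for j
  proof -
    have "card (A j) = card (B j)"
      unfolding A_def using n_pos by (intro card_image) (auto simp: inj_on_def)
    then show ?thesis using cm(2)[of j] by simp
  qed
  moreover have "card (\<Union>j<n. A j) = (\<Sum>j<n. card (A j))"
    using fin dj by (intro card_UN_disjoint) auto
  ultimately show ?thesis unfolding U by simp
qed

section \<open>Admissible subsets as chains of modules\<close>

text \<open>The set with layers \<open>module_of (G i)\<close>.\<close>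

definition modset :: "nat \<Rightarrow> (nat \<Rightarrow> nat \<Rightarrow> int) \<Rightarrow> nat set" where
  "modset d G = {t. int (t div d) \<in> module_of (G (t mod d))}"

definition chain :: "nat \<Rightarrow> (nat \<Rightarrow> nat \<Rightarrow> int) \<Rightarrow> bool" where
  "chain d G \<longleftrightarrow> (\<forall>i<d. gen_cycle (G i)) \<and> G 0 0 = 0 \<and> (\<forall>i. Suc i < d \<longrightarrow> linked (G i) (G (Suc i)))"

lemma mem_modset: "i < d \<Longrightarrow> d * q + i \<in> modset d G \<longleftrightarrow> int q \<in> module_of (G i)"
  by (simp add: modset_def)

lemma gen_cycle_iter:
  assumes "gen_cycle g" shows "g (x + k) \<le> g x + int m * int k"
proof (induction k)
  case (Suc k)
  have "g (x + k + 1) \<le> g (x + k) + int m" by (rule gen_cycleD(4)[OF assms])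
  with Suc show ?case by (simp add: algebra_simps)
qed simp

text \<open>Going once around the cycle, from \<open>x\<close> to the place where \<open>g\<close> and \<open>h\<close> are linked along \<open>g\<close> and onwards
along \<open>h\<close>, takes \<open>n\<close> steps of height at most \<open>m\<close>. This is why linkedness already implies invariance
under \<open>d * m * n + 1\<close> between consecutive layers.\<close>

lemma linked_le:
  assumes g: "gen_cycle g" and h: "gen_cycle h" and "linked g h"
  shows "h x \<le> g x + int m * int n"
proof -
  from assms(3) obtain z where z: "h (z + 1) \<le> g z + int m" unfolding linked_def by blast
  define k where "k = wpos x z - x"
  have k: "wpos x z = x + k" "k < n" using wpos_ge[of x z] wpos_less[of x z] by (auto simp: k_def)
  have c: "[x + k = z] (mod n)" using wpos_cong[of x z] k by simp
  have "h x = h (x + n)" using gen_cycleD(3)[OF h] by simp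
  also have "x + n = x + k + 1 + (n - 1 - k)" using k by simp
  also have "h \<dots> \<le> h (x + k + 1) + int m * int (n - 1 - k)" by (rule gen_cycle_iter[OF h])
  also have "h (x + k + 1) = h (z + 1)"
    by (rule gen_cycle_cong[OF h cong_add[OF c cong_refl]])
  also have "\<dots> \<le> g z + int m" by (rule z)
  also have "g z = g (x + k)" by (rule gen_cycle_cong[OF g cong_sym[OF c]])
  also have "\<dots> \<le> g x + int m * int k" by (rule gen_cycle_iter[OF g])
  finally have "h x \<le> g x + (int m * int k + int m + int m * int (n - 1 - k))" by simp
  also have "int m * int k + int m + int m * int (n - 1 - k) = int m * int (k + 1 + (n - 1 - k))"
    by (simp add: algebra_simps)
  also have "k + 1 + (n - 1 - k) = n" using k by simp
  finally show ?thesis .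
qed

lemma nonneg_div_mod:
  assumes "i < d" "0 \<le> q" "int a = int d * q + int i"
  shows "a = d * nat q + i"
proof -
  have "int a = int (d * nat q + i)" using assms by simp
  then show ?thesis using of_nat_eq_iff by blast
qed

lemma int_generators_modset:
  assumes G: "\<And>i. i < d \<Longrightarrow> gen_cycle (G i)" and d: "0 < d"
  shows "int ` generators (d * n) (modset d G) = {int d * G i x + int i | i x. i < d \<and> x < n}"
proof (intro set_eqI iffI)
  fix z assume "z \<in> int ` generators (d * n) (modset d G)"
  then obtain a where a: "z = int a" "a \<in> modset d G" "\<And>b. b \<in> modset d G \<Longrightarrow> a \<noteq> b + d * n"
    unfolding generators_def by blast
  let ?i = "a mod d" and ?q = "a div d"
  have i: "?i < d" using d by simp
  obtain x where x: "x < n" "[int ?q = int m * int x] (mod int n)" using ex_index by blast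
  have le: "G ?i x \<le> int ?q" using mem_module_iff[OF G[OF i] x(2)] a(2) by (simp add: modset_def)
  have "G ?i x = int ?q"
  proof (rule ccontr)
    assume ne: "G ?i x \<noteq> int ?q"
    have "[int ?q = G ?i x] (mod int n)"
      using x(2) gen_cycleD(2)[OF G[OF i], of x] by (simp add: cong_def)
    then have "int n dvd int ?q - G ?i x" by (simp add: cong_iff_dvd_diff)
    then have ge: "G ?i x + int n \<le> int ?q" using le ne zdvd_imp_le[of "int n" "int ?q - G ?i x"] by simp
    then have nq: "n \<le> ?q" using gen_cycleD(1)[OF G[OF i], of x] by simp
    have "[int (?q - n) = int m * int x] (mod int n)" using x(2) nq by (simp add: cong_def of_nat_diff)
    then have "int (?q - n) \<in> module_of (G ?i)" using mem_module_iff[OF G[OF i]] ge nq by (simp add: of_nat_diff)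
    then have "d * (?q - n) + ?i \<in> modset d G" using i mem_modset by simp
    moreover have "a = d * (?q - n) + ?i + d * n"
    proof -
      have "a = d * (?q - n + n) + ?i" using nq by simp
      then show ?thesis by (simp only: distrib_left add_ac)
    qed
    ultimately show False using a(3) by blast
  qed
  then have "z = int d * G ?i x + int ?i" using a(1)
    by (metis mult_div_mod_eq of_nat_add of_nat_mult)
  then show "z \<in> {int d * G i x + int i | i x. i < d \<and> x < n}" using i x by blast
next
  fix z assume "z \<in> {int d * G i x + int i | i x. i < d \<and> x < n}"
  then obtain i x where z: "z = int d * G i x + int i" "i < d" "x < n" by blast
  note g = G[OF z(2)]
  let ?a = "d * nat (G i x) + i"
  have za: "z = int ?a" using z gen_cycleD(1)[OF g, of x] by simp
  have "?a \<in> modset d G"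
    using mem_modset[OF z(2)] mem_module_iff[OF g gen_cycleD(2)[OF g, of x]] gen_cycleD(1)[OF g, of x] by simp
  moreover have False if b: "b \<in> modset d G" "?a = b + d * n" for b
  proof -
    have "int b = int d * (G i x - int n) + int i" using b(2) z za by (simp add: algebra_simps)
    moreover have "0 \<le> G i x - int n"
    proof (rule ccontr)
      assume "\<not> ?thesis"
      then have "int d * (G i x - int n) \<le> int d * (-1)" by (intro mult_left_mono) auto
      then show False using \<open>int b = _\<close> z(2) by simp
    qed
    ultimately have "b = d * nat (G i x - int n) + i" "0 \<le> G i x - int n"
      using nonneg_div_mod z(2) by blast+
    then have "G i x - int n \<in> module_of (G i)" using b(1) mem_modset[OF z(2)] by simp
    moreover have "[G i x - int n = int m * int x] (mod int n)"
      using gen_cycleD(2)[OF g, of x] by (simp add: cong_def)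
    ultimately show False using mem_module_iff[OF g] n_pos by simp
  qed
  ultimately show "z \<in> int ` generators (d * n) (modset d G)"
    using za unfolding generators_def by blast
qed

context
  fixes d G
  assumes C: "chain d G" and d: "0 < d"
begin

lemma chain_cycle: "i < d \<Longrightarrow> gen_cycle (G i)" and chain_zero: "G 0 0 = 0"
  and chain_linked: "Suc i < d \<Longrightarrow> linked (G i) (G (Suc i))"
  using C unfolding chain_def by auto

lemma chain_bound: "i < d \<Longrightarrow> G i x \<le> int m * (int i * int n + int x)"
proof (induction i)
  case 0
  then show ?case using gen_cycle_iter[OF chain_cycle[OF 0], of 0 x] chain_zero by simp
next
  case (Suc i)
  then have "G (Suc i) x \<le> G i x + int m * int n"
    by (intro linked_le chain_cycle chain_linked) auto
  then show ?case using Suc by (simp add: algebra_simps)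
qed

lemma module_of_add_n: "i < d \<Longrightarrow> q \<in> module_of (G i) \<Longrightarrow> q + int n \<in> module_of (G i)"
proof -
  assume i: "i < d" and q: "q \<in> module_of (G i)"
  then obtain x where x: "[q = int m * int x] (mod int n)" "G i x \<le> q" unfolding module_of_def by blast
  then have "[q + int n = int m * int x] (mod int n)" by (simp add: cong_def)
  then show ?thesis using x unfolding module_of_def by force
qed

lemma module_of_add_m: "i < d \<Longrightarrow> q \<in> module_of (G i) \<Longrightarrow> q + int m \<in> module_of (G i)"
proof -
  assume i: "i < d" and q: "q \<in> module_of (G i)"
  then obtain x where x: "[q = int m * int x] (mod int n)" "G i x \<le> q" unfolding module_of_def by blast
  have "[q + int m = int m * int (x + 1)] (mod int n)"
    using cong_add[OF x(1) cong_refl[of "int m"]] by (simp add: algebra_simps)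
  moreover have "G i (x + 1) \<le> q + int m" using gen_cycleD(4)[OF chain_cycle[OF i], of x] x by simp
  ultimately show ?thesis unfolding module_of_def by blast
qed

text \<open>The shift by \<open>d * m * n + 1\<close> moves layer \<open>i\<close> to layer \<open>i + 1\<close>, where \<open>linked_le\<close> applies, and the last
layer back to layer \<open>0\<close>, where it overshoots every generator. Admissibility is linkedness
for \<open>i + 1 < d\<close>, and holds for the last layer because layer \<open>0\<close> contains every natural multiple of \<open>n\<close>.\<close>

lemma modset_Adm: "modset d G \<in> Adm d n m"
proof -
  let ?S = "modset d G"
  have zero: "0 \<in> ?S"
    using mem_module_iff[OF chain_cycle[OF d], of 0 0] chain_zero by (simp add: modset_def)
  have dec: "\<exists>q i. i < d \<and> t = d * q + i" for t
    using d by (metis mod_less_divisor mult_div_mod_eq)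
  have cl: "t + d * n \<in> ?S \<and> t + d * m \<in> ?S \<and> t + (d * m * n + 1) \<in> ?S" if "t \<in> ?S" for t
  proof -
    obtain q i where t: "i < d" "t = d * q + i" using dec by blast
    then have q: "int q \<in> module_of (G i)" using that mem_modset by simp
    have "t + d * n = d * (q + n) + i" "t + d * m = d * (q + m) + i" using t by (auto simp: algebra_simps)
    moreover have "int (q + n) \<in> module_of (G i)" "int (q + m) \<in> module_of (G i)"
      using module_of_add_n[OF t(1) q] module_of_add_m[OF t(1) q] by simp_all
    moreover have "t + (d * m * n + 1) \<in> ?S"
    proof -
      obtain x where x: "x < n" "[int q = int m * int x] (mod int n)" using ex_index by blast
      have gq: "G i x \<le> int q" using mem_module_iff[OF chain_cycle[OF t(1)] x(2)] q by simp
      have c: "[int (q + m * n) = int m * int x] (mod int n)" using x(2) by (simp add: cong_def)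
      show ?thesis
      proof (cases "Suc i < d")
        case True
        have "G (Suc i) x \<le> G i x + int m * int n"
          using True by (intro linked_le chain_cycle chain_linked) auto
        then have "int (q + m * n) \<in> module_of (G (Suc i))" using mem_module_iff[OF chain_cycle[OF True] c] gq by simp
        moreover have "t + (d * m * n + 1) = d * (q + m * n) + Suc i" using t by (simp add: algebra_simps)
        ultimately show ?thesis using mem_modset[OF True] by simp
      next
        case False
        then have "d = Suc i" using t by simp
        then have te: "t + (d * m * n + 1) = d * (q + m * n + 1) + 0" using t by (simp add: algebra_simps)
        obtain y where y: "y < n" "[int (q + m * n + 1) = int m * int y] (mod int n)" using ex_index by blast
        have "G 0 y \<le> int m * int y" using chain_bound[OF d, of y] by simp
        also have "\<dots> \<le> int m * int n" using y by (intro mult_left_mono) auto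
        finally have "G 0 y \<le> int (q + m * n + 1)" by simp
        then have "int (q + m * n + 1) \<in> module_of (G 0)" using mem_module_iff[OF chain_cycle[OF d] y(2)] by simp
        then show ?thesis unfolding te using mem_modset[OF d] by blast
      qed
    qed
    ultimately show ?thesis using mem_modset[OF t(1)] by simp
  qed
  have iter: "k * a + t \<in> ?S" if "t \<in> ?S" "\<And>t. t \<in> ?S \<Longrightarrow> t + a \<in> ?S" for k a t
  proof (induction k)
    case (Suc k) then show ?case using that(2)[OF Suc] by (simp add: algebra_simps)
  qed (use that in simp)
  have "g + t \<in> ?S" if g: "g \<in> Gamma d n m" and t: "t \<in> ?S" for g t
  proof -
    obtain p q r where "g = p * (d * n) + q * (d * m) + r * (d * m * n + 1)"
      using g unfolding Gamma_def by blast
    moreover have "p * (d * n) + (q * (d * m) + (r * (d * m * n + 1) + t)) \<in> ?S"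
      by (intro iter t) (use cl in auto)
    ultimately show ?thesis by (simp add: add.assoc)
  qed
  moreover have "\<exists>a\<in>generators (d * n) ?S. [a = i] (mod d) \<and> a + d * m + 1 \<in> ?S" if i: "i < d" for i
  proof -
    \<comment> \<open>The class from which \<open>m + 1\<close> leads to a multiple of \<open>n\<close>; used for the last layer.\<close>
    define q where "q = - int m - 1"
    obtain y where y: "y < n" "[q = int m * int y] (mod int n)" using ex_index by blast
    from i consider "Suc i < d" | "d = Suc i" by linarith
    then obtain x where x: "x < n"
      "\<And>a. a = d * nat (G i x) + i \<Longrightarrow> a + d * m + 1 \<in> ?S"
    proof cases
      case 1
      from chain_linked[OF 1] obtain x where x: "G (Suc i) (x + 1) \<le> G i x + int m" unfolding linked_def by blast
      let ?x = "x mod n"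
      have e: "G (Suc i) (?x + 1) = G (Suc i) (x + 1)" "G i ?x = G i x"
        using gen_cycle_cong[OF chain_cycle[OF 1], of "?x + 1" "x + 1"] gen_cycle_mod[OF chain_cycle[OF i]]
        by (auto simp: cong_def mod_simps)
      have "[G i ?x + int m = int m * int (?x + 1)] (mod int n)"
        using cong_add[OF gen_cycleD(2)[OF chain_cycle[OF i], of ?x] cong_refl[of "int m"]]
        by (simp add: algebra_simps)
      moreover have "G (Suc i) (?x + 1) \<le> G i ?x + int m" unfolding e by (rule x)
      ultimately have sp: "G i ?x + int m \<in> module_of (G (Suc i))" unfolding module_of_def by blast
      show ?thesis
      proof (rule that[of ?x])
        fix a assume "a = d * nat (G i ?x) + i"
        then have "a + d * m + 1 = d * (nat (G i ?x) + m) + Suc i" by (simp add: algebra_simps)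
        moreover have "int (nat (G i ?x) + m) = G i ?x + int m"
          using gen_cycleD(1)[OF chain_cycle[OF i], of ?x] by simp
        ultimately show "a + d * m + 1 \<in> ?S" using sp mem_modset[OF 1] by simp
      qed (use n_pos in simp)
    next
      case 2
      have "[G i y = q] (mod int n)"
        using gen_cycleD(2)[OF chain_cycle[OF i], of y] y(2) by (simp add: cong_def)
      from cong_add[OF this cong_refl[of "int m + 1"]]
      have "[G i y + int m + 1 = int m * int 0] (mod int n)" by (simp add: q_def add.assoc)
      moreover have nn: "0 \<le> G i y" by (rule gen_cycleD(1)[OF chain_cycle[OF i]])
      ultimately have sp: "G i y + int m + 1 \<in> module_of (G 0)"
        using mem_module_iff[OF chain_cycle[OF d], of _ 0] chain_zero by simp
      show ?thesis
      proof (rule that[OF y(1)])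
        fix a assume "a = d * nat (G i y) + i"
        then have "a + d * m + 1 = d * (nat (G i y) + m + 1) + 0" using 2 by (simp add: algebra_simps)
        moreover have "int (nat (G i y) + m + 1) = G i y + int m + 1" using nn by simp
        ultimately show "a + d * m + 1 \<in> ?S" using sp mem_modset[OF d] by metis
      qed
    qed
    let ?a = "d * nat (G i x) + i"
    have "int ?a = int d * G i x + int i" using gen_cycleD(1)[OF chain_cycle[OF i], of x] by simp
    then have "int ?a \<in> int ` generators (d * n) ?S"
      using int_generators_modset[of d G, OF chain_cycle d] i x(1) by blast
    then have "?a \<in> generators (d * n) ?S" unfolding image_iff of_nat_eq_iff by blast
    moreover have "[?a = i] (mod d)" by (simp add: cong_def)
    ultimately show ?thesis using x(2)[OF refl] by blast
  qed
  moreover have "(LEAST t. t \<in> ?S) = 0" using zero by (intro Least_equality) auto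
  ultimately show ?thesis unfolding Adm_def using zero by auto
qed

end

lemma modset_mono_cycle:
  assumes "chain d G" "chain d G'" "0 < d" "modset d G' \<subseteq> modset d G" "i < d"
  shows "G i x \<le> G' i x"
proof -
  note g = chain_cycle[OF assms(1) assms(3) assms(5)] and g' = chain_cycle[OF assms(2) assms(3) assms(5)]
  have nn: "0 \<le> G' i x" by (rule gen_cycleD(1)[OF g'])
  have "G' i x \<in> module_of (G' i)" using mem_module_iff[OF g' gen_cycleD(2)[OF g']] by simp
  then have "d * nat (G' i x) + i \<in> modset d G'" using mem_modset[OF assms(5)] nn by simp
  then have "d * nat (G' i x) + i \<in> modset d G" using assms(4) by blast
  then have "int (nat (G' i x)) \<in> module_of (G i)" by (rule iffD1[OF mem_modset[OF assms(5)]])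
  then have "G' i x \<in> module_of (G i)" using nn by simp
  then show ?thesis using mem_module_iff[OF g gen_cycleD(2)[OF g']] by simp
qed

lemma modset_inj:
  assumes "chain d G" "chain d G'" "0 < d" "modset d G = modset d G'" "i < d"
  shows "G i = G' i"
  using modset_mono_cycle[OF assms(1,2,3) _ assms(5)] modset_mono_cycle[OF assms(2,1,3) _ assms(5)] assms(4)
  by (intro ext antisym) auto

text \<open>The generator in a class is its least element; the classes are nonempty because \<open>\<Gamma>\<close> meets
all of them.\<close>

lemma Adm_is_modset:
  assumes S: "S \<in> Adm d n m" and d: "0 < d"
  obtains G where "chain d G" "modset d G = S"
proof -
  have zero: "0 \<in> S" using S LeastI_ex[of "\<lambda>t. t \<in> S"] unfolding Adm_def by auto
  have cl: "p * (d * n) + q * (d * m) + r * (d * m * n + 1) + t \<in> S" if "t \<in> S" for p q r t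
    using S that unfolding Adm_def Gamma_def by blast
  define P where "P i x q \<longleftrightarrow> d * q + i \<in> S \<and> [q = m * x] (mod n)" for i x q
  define L where "L i x = (LEAST q. P i x q)" for i x
  define G where "G i x = int (L i x)" for i x
  have PL: "P i x (L i x)" for i x
  proof -
    \<comment> \<open>The element \<open>ahat d n m i x\<close> of \<open>\<Gamma>\<close> lies in layer \<open>i\<close> and in the class of \<open>m * x\<close>.\<close>
    have "x * (d * m) + i * (d * m * n + 1) = d * (x * m + i * m * n) + i"
      by (simp add: algebra_simps)
    moreover have "x * (d * m) + i * (d * m * n + 1) \<in> S" using cl[OF zero, of 0 x i] by simp
    moreover have "[x * m + i * m * n = m * x] (mod n)" by (simp add: cong_def mult.commute)
    ultimately have "P i x (x * m + i * m * n)" unfolding P_def by metis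
    then show ?thesis unfolding L_def by (rule LeastI)
  qed
  have Pn: "P i x (q + k * n)" if "P i x q" for i x q k
  proof -
    have "d * (q + k * n) + i = k * (d * n) + (d * q + i)" by (simp add: algebra_simps)
    then have "d * (q + k * n) + i \<in> S"
      using that cl[of "d * q + i" k 0 0] unfolding P_def by (simp add: add.assoc)
    then show ?thesis using that unfolding P_def by (simp add: cong_def)
  qed
  have mem: "d * q + i \<in> S \<longleftrightarrow> L i x \<le> q" if "[q = m * x] (mod n)" for q i x
  proof
    assume "d * q + i \<in> S"
    then show "L i x \<le> q" using that Least_le[of "P i x" q] by (simp add: P_def L_def)
  next
    assume le: "L i x \<le> q"
    have "[q = L i x] (mod n)" using that PL[of i x] unfolding P_def by (simp add: cong_def)
    then obtain k where "q = L i x + k * n" using le by (metis cong_le_nat mult.commute add.commute)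
    then show "d * q + i \<in> S" using Pn[OF PL] unfolding P_def by simp
  qed
  have cyc: "gen_cycle (G i)" for i
    unfolding gen_cycle_def
  proof (intro allI conjI)
    fix x
    show "0 \<le> G i x" by (simp add: G_def)
    have "[L i x = m * x] (mod n)" using PL unfolding P_def by blast
    then show "[G i x = int m * int x] (mod int n)" unfolding G_def by (metis cong_int_iff of_nat_mult)
    have "P i (x + n) = P i x" by (simp add: P_def fun_eq_iff cong_def distrib_left)
    then show "G i (x + n) = G i x" by (simp add: G_def L_def)
    have "[L i x + m = m * (x + 1)] (mod n)" using cong_add[OF \<open>[L i x = m * x] (mod n)\<close> cong_refl[of m]]
      by (simp add: algebra_simps)
    moreover have "d * (L i x + m) + i \<in> S"
    proof -
      have "d * L i x + i \<in> S" using PL unfolding P_def by blast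
      from cl[OF this, of 0 1 0] show ?thesis by (simp add: algebra_simps)
    qed
    ultimately have "L i (x + 1) \<le> L i x + m" using mem by blast
    then show "G i (x + 1) \<le> G i x + int m" by (simp add: G_def)
  qed
  have iffS: "int q \<in> module_of (G i) \<longleftrightarrow> d * q + i \<in> S" for i q
  proof -
    obtain x where "[int q = int m * int x] (mod int n)" using ex_index by blast
    moreover from this have "[q = m * x] (mod n)" by (metis cong_int_iff of_nat_mult)
    ultimately show ?thesis using mem_module_iff[OF cyc] mem by (simp add: G_def)
  qed
  have "modset d G = S" using iffS by (simp add: modset_def)
  moreover have "chain d G"
    unfolding chain_def
  proof (intro conjI allI impI cyc)
    have "L 0 0 \<le> 0" using mem[of 0 0 0] zero by simp
    then show "G 0 0 = 0" by (simp add: G_def)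
    fix i assume i: "Suc i < d"
    then have "i < d" by simp
    then obtain a where a: "a \<in> generators (d * n) S" "[a = i] (mod d)" "a + d * m + 1 \<in> S"
      using S unfolding Adm_def by blast
    define q where "q = a div d"
    have aq: "a = d * q + i"
    proof -
      have "a mod d = i" using a(2) i by (simp add: cong_def)
      then show ?thesis using mult_div_mod_eq[of d a] by (simp add: q_def)
    qed
    obtain x where x: "[int q = int m * int x] (mod int n)" using ex_index by blast
    then have xq: "[q = m * x] (mod n)" by (metis cong_int_iff of_nat_mult)
    have "a \<in> int -` int ` generators (d * n) (modset d G)" using a(1) \<open>modset d G = S\<close> by simp
    then obtain i' x' where ix: "int a = int d * G i' x' + int i'" "i' < d" "x' < n"
      using int_generators_modset[of d G, OF cyc d] by auto
    then have "a = d * L i' x' + i'" using nonneg_div_mod[of i' d "G i' x'" a] by (simp add: G_def)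
    then have "a mod d = i'" "a div d = L i' x'" using ix(2) by simp_all
    moreover have "a mod d = i" "a div d = q" unfolding aq using \<open>i < d\<close> by simp_all
    ultimately have "i' = i \<and> L i' x' = q" by simp
    then have Gq: "G i x' = int q" by (auto simp: G_def)
    have "a + d * m + 1 = d * (q + m) + Suc i" using aq by (simp add: algebra_simps)
    then have "int (q + m) \<in> module_of (G (Suc i))" unfolding iffS using a(3) by simp
    moreover have "[int (q + m) = int m * int (x' + 1)] (mod int n)"
      using cong_add[OF gen_cycleD(2)[OF cyc, of i x'] cong_refl[of "int m"]] Gq
      by (simp add: algebra_simps)
    ultimately have "G (Suc i) (x' + 1) \<le> int (q + m)" using mem_module_iff[OF cyc] by blast
    then have "G (Suc i) (x' + 1) \<le> G i x' + int m" using Gq by simp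
    then show "linked (G i) (G (Suc i))" unfolding linked_def by blast
  qed
  ultimately show ?thesis using that by blast
qed

lemma subset_of_matrix_eq_modset:
  assumes G: "\<And>i. i < d \<Longrightarrow> gen_cycle (G i)" and d: "0 < d"
    and c: "\<And>i j. i < d \<Longrightarrow> j < n \<Longrightarrow> G i j = int m * int (i * n + j) - int n * c i j"
  shows "subset_of_matrix d n m c = modset d G"
proof -
  have e: "int (ahat d n m i j) - int (d * n) * c i j + int (d * n) * int k
      = int d * (G i j + int n * int k) + int i" if "i < d" "j < n" for i j k
  proof -
    have "int (ahat d n m i j) = int d * (int m * int (i * n + j)) + int i"
      by (simp add: ahat_def algebra_simps)
    then show ?thesis unfolding c[OF that] by (simp add: algebra_simps)
  qed
  show ?thesis
  proof (intro set_eqI iffI)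
    fix t assume "t \<in> subset_of_matrix d n m c"
    then obtain i j k where ij: "i < d" "j < n" and t: "int t = int d * (G i j + int n * int k) + int i"
      unfolding subset_of_matrix_def using e by auto
    have nn: "0 \<le> G i j + int n * int k" using gen_cycleD(1)[OF G[OF ij(1)]] by simp
    have "[G i j + int n * int k = int m * int j] (mod int n)"
      using gen_cycleD(2)[OF G[OF ij(1)], of j] by (simp add: cong_def)
    then have "G i j + int n * int k \<in> module_of (G i)" using mem_module_iff[OF G[OF ij(1)]] by simp
    then show "t \<in> modset d G" using nonneg_div_mod[OF ij(1) nn t] mem_modset[OF ij(1)] nn by simp
  next
    fix t assume t: "t \<in> modset d G"
    let ?i = "t mod d" and ?q = "t div d"
    have i: "?i < d" using d by simp
    obtain x where x: "x < n" "[int ?q = int m * int x] (mod int n)" using ex_index by blast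
    have le: "G ?i x \<le> int ?q" using mem_module_iff[OF G[OF i] x(2)] t by (simp add: modset_def)
    have "[G ?i x = int ?q] (mod int n)"
      using x(2) gen_cycleD(2)[OF G[OF i], of x] by (simp add: cong_def)
    then obtain b where b: "int ?q = G ?i x + int n * b" by (metis cong_iff_lin)
    then have "0 \<le> b" using le n_pos by (simp add: zero_le_mult_iff)
    then have "int t = int d * (G ?i x + int n * int (nat b)) + int ?i" using b
      by (metis int_nat_eq mult_div_mod_eq of_nat_add of_nat_mult)
    then show "t \<in> subset_of_matrix d n m c" 
      unfolding subset_of_matrix_def e[OF i x(1), symmetric] using i x(1) by blast
  qed
qed

section \<open>Gap numbers\<close>

lemma card_levels:
  assumes "finite S" "0 < d"
  shows "card S = (\<Sum>i<d. card {q::nat. d * q + i \<in> S})"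
proof -
  let ?T = "SIGMA i:{..<d}. {q. d * q + i \<in> S}"
  have "bij_betw (\<lambda>t. (t mod d, t div d)) S ?T"
    by (rule bij_betw_byWitness[where f' = "\<lambda>(i, q). d * q + i"]) (use assms(2) in auto)
  then have "card S = card ?T" by (rule bij_betw_same_card)
  also have "\<dots> = (\<Sum>i<d. card {q. d * q + i \<in> S})"
  proof (rule card_SigmaI)
    have "{q. d * q + i \<in> S} \<subseteq> (\<lambda>t. t div d) ` S" if "i < d" for i
    proof
      fix q assume "q \<in> {q. d * q + i \<in> S}"
      then have "d * q + i \<in> S" "q = (d * q + i) div d" using that by auto
      then show "q \<in> (\<lambda>t. t div d) ` S" by blast
    qed
    then show "\<forall>i\<in>{..<d}. finite {q. d * q + i \<in> S}" using assms(1) finite_subset by blast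
  qed simp
  finally show ?thesis .
qed

text \<open>The set \<open>X\<close> stands for an interval of naturals: on the layer \<open>i\<close> it is an interval again, with bounds
that depend on \<open>i\<close> because of the remainder modulo \<open>d\<close>.\<close>

lemma card_modset_gaps:
  assumes G: "\<And>i. i < d \<Longrightarrow> gen_cycle (G i)" and d: "0 < d" and X: "finite X"
    and lo: "\<And>i q. i < d \<Longrightarrow> d * q + i \<in> X \<longleftrightarrow> lo i \<le> int q \<and> int q < hi i"
    and ord: "\<And>i. i < d \<Longrightarrow> 0 \<le> lo i \<and> lo i \<le> hi i"
  shows "int (card (X - modset d G)) = (\<Sum>i<d. \<Sum>j<n. steps (G i j - lo i) - steps (G i j - hi i))"
proof -
  have "card {q. d * q + i \<in> X - modset d G} = card ({lo i..<hi i} - module_of (G i))" if i: "i < d" for i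
  proof -
    have "q \<in> int ` {q. d * q + i \<in> X - modset d G}" if "q \<in> {lo i..<hi i} - module_of (G i)" for q
    proof -
      have "q = int (nat q)" using that ord[OF i] by auto
      moreover have "d * nat q + i \<in> X - modset d G" using that lo[OF i] mem_modset[OF i] ord[OF i] by auto
      ultimately show ?thesis by blast
    qed
    then have "int ` {q. d * q + i \<in> X - modset d G} = {lo i..<hi i} - module_of (G i)"
      using lo[OF i] mem_modset[OF i] by auto
    then show ?thesis by (metis card_image inj_of_nat inj_on_subset subset_UNIV)
  qed
  then have "card (X - modset d G) = (\<Sum>i<d. card ({lo i..<hi i} - module_of (G i)))"
    using card_levels[of "X - modset d G" d] X d by simp
  then show ?thesis using card_gaps[OF G] ord by simp
qed

text \<open>A bound for all generators at once, behind which the set has no gaps.\<close>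

lemma chain_le:
  assumes C: "chain d G" and "i < d" "j < n"
  shows "G i j \<le> int m * int (d * n + n)"
proof -
  have "i * n \<le> d * n" "j \<le> n" using assms by auto
  then have "int m * int (i * n + j) \<le> int m * int (d * n + n)"
    by (intro mult_left_mono of_nat_mono add_mono) auto
  moreover have "0 < d" using assms(2) by simp
  ultimately show ?thesis using chain_bound[OF C _ assms(2), of j] by simp
qed

lemma modset_above:
  assumes C: "chain d G" and d: "0 < d" and t: "int m * int (d * n + n) \<le> int (t div d)"
  shows "t \<in> modset d G"
proof -
  have i: "t mod d < d" using d by simp
  obtain x where x: "x < n" "[int (t div d) = int m * int x] (mod int n)" using ex_index by blast
  show ?thesis
    using mem_module_iff[OF chain_cycle[OF C d i] x(2)] chain_le[OF C i x(1)] t by (simp add: modset_def)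
qed

text \<open>Comparing numbers layer by layer costs one unit in the quotient when the remainder drops. This is the source
of the tie-breaking in the dimension formula.\<close>

lemma level_le_iff:
  fixes q :: nat
  assumes "i < d" "i' < d"
  shows "d * s + i \<le> d * q + i' \<longleftrightarrow> s + (if i \<le> i' then 0 else 1) \<le> q"
proof -
  consider "q < s" | "q = s" | "s < q" by linarith
  then show ?thesis
  proof cases
    case 1
    then have "d * (q + 1) \<le> d * s" by (intro mult_left_mono) auto
    then show ?thesis using 1 assms by simp
  next
    case 3
    then have "d * (s + 1) \<le> d * q" by (intro mult_left_mono) auto
    then show ?thesis using 3 assms by simp
  qed auto
qed

lemma delta_modset:
  assumes C: "chain d G" and d: "0 < d"
  shows "int (delta (modset d G)) = (\<Sum>i<d. \<Sum>j<n. G i j div int n)"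
proof -
  \<comment> \<open>Any bound as in \<open>chain_le\<close> turns the set of all gaps into the gaps below a number.\<close>
  define K where "K = m * (d * n + n)"
  define X where "X = {..<d * K}"
  have lo: "d * q + i \<in> X \<longleftrightarrow> 0 \<le> int q \<and> int q < int K" if "i < d" for i q
    using level_le_iff[of 0 d i K q] that by (auto simp: X_def not_le[symmetric])
  have z: "steps (G i j - int K) = 0" if "i < d" "j < n" for i j
  proof -
    have "(G i j - int K) div int n \<le> 0"
      using chain_le[OF C that] n_pos zdiv_mono1[of "G i j - int K" 0 "int n"] by (simp add: K_def)
    then show ?thesis by (simp add: steps_def)
  qed
  have nn: "steps (G i j) = G i j div int n" if "i < d" for i j
    using gen_cycleD(1)[OF chain_cycle[OF C d that], of j] n_pos by (simp add: steps_def pos_imp_zdiv_nonneg_iff)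
  have "t \<in> modset d G" if "t \<notin> X" for t
  proof (rule modset_above[OF C d])
    have "K \<le> t div d" using that d by (simp add: X_def less_eq_div_iff_mult_less_eq mult.commute)
    then show "int m * int (d * n + n) \<le> int (t div d)"
      unfolding K_def of_nat_mult[symmetric] by (rule of_nat_mono)
  qed
  then have "UNIV - modset d G = X - modset d G" by blast
  then have "int (delta (modset d G)) = int (card (X - modset d G))" by (simp add: delta_def)
  also have "\<dots> = (\<Sum>i<d. \<Sum>j<n. steps (G i j - 0) - steps (G i j - int K))"
    by (rule card_modset_gaps[OF chain_cycle[OF C d] d _ lo]) (auto simp: X_def)
  also have "\<dots> = (\<Sum>i<d. \<Sum>j<n. G i j div int n)"
    by (intro sum.cong refl) (use z nn in auto)
  finally show ?thesis .
qed

text \<open>The semigroup itself is the smallest admissible set; it corresponds to the chain in which every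
generator has the largest value allowed by \<open>chain_bound\<close>.\<close>

lemma delta_Gamma:
  assumes d: "0 < d"
  shows "int (delta (Gamma d n m)) = (\<Sum>i<d. \<Sum>j<n. int (abound n m i j))"
proof -
  define G where "G i x = int m * int (i * n + x mod n)" for i x
  have C: "chain d G" unfolding chain_def gen_cycle_def
  proof (intro conjI allI impI)
    fix i x
    show "0 \<le> G i x" "G (i) (x + n) = G i x" "G 0 0 = 0" by (auto simp: G_def)
    show "[G i x = int m * int x] (mod int n)" unfolding G_def cong_m_iff by (simp add: cong_def)
    have "(x + 1) mod n \<le> x mod n + 1" using n_pos by (simp add: mod_Suc)
    then have "int m * int (i * n + (x + 1) mod n) \<le> int m * int (i * n + (x mod n + 1))"
      by (intro mult_left_mono of_nat_mono) auto
    then show "G i (x + 1) \<le> G i x + int m" by (simp add: G_def algebra_simps)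
    show "linked (G i) (G (Suc i))" unfolding linked_def
    proof
      have "n - 1 + 1 = n" "(n - 1) mod n = n - 1" using n_pos by auto
      then show "G (Suc i) (n - 1 + 1) \<le> G i (n - 1) + int m"
        using n_pos by (simp add: G_def algebra_simps of_nat_diff)
    qed
  qed
  have eq: "Gamma d n m = modset d G"
  proof
    have "0 \<in> modset d G" "\<And>g t. g \<in> Gamma d n m \<Longrightarrow> t \<in> modset d G \<Longrightarrow> g + t \<in> modset d G"
      using modset_Adm[OF C d] LeastI_ex[of "\<lambda>t. t \<in> modset d G"] unfolding Adm_def by auto
    then show "Gamma d n m \<subseteq> modset d G" by force
    show "modset d G \<subseteq> Gamma d n m"
    proof
      fix t assume "t \<in> modset d G"
      moreover have "subset_of_matrix d n m (\<lambda>i j. 0) = modset d G"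
        by (rule subset_of_matrix_eq_modset[OF chain_cycle[OF C d] d]) (auto simp: G_def)
      ultimately obtain i j k where
        "int t = int (ahat d n m i j) - int (d * n) * 0 + int (d * n) * int k"
        unfolding subset_of_matrix_def by blast
      then have "int t = int (k * (d * n) + j * (d * m) + i * (d * m * n + 1))"
        by (simp add: ahat_def algebra_simps)
      then have "t = k * (d * n) + j * (d * m) + i * (d * m * n + 1)" using of_nat_eq_iff by blast
      then show "t \<in> Gamma d n m" unfolding Gamma_def by blast
    qed
  qed
  have "G i j div int n = int (abound n m i j)" if "j < n" for i j
  proof -
    have "m * (i * n + j) = j * m + (m * i) * n" by (simp add: algebra_simps)
    then have "(m * (i * n + j)) div n = abound n m i j" using n_pos by (simp add: abound_def)
    then show ?thesis using that by (simp add: G_def flip: zdiv_int of_nat_mult of_nat_add)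
  qed
  then show ?thesis unfolding eq delta_modset[OF C d] by (intro sum.cong refl) auto
qed

section \<open>Towers of rank words\<close>

text \<open>The words that occur while windows are removed one by one, numbered such that \<open>W u\<close> still contains
the layers \<open>0, ..., u\<close>.\<close>

definition tower :: "nat \<Rightarrow> (nat \<Rightarrow> nat \<Rightarrow> int) \<Rightarrow> bool" where
  "tower d W \<longleftrightarrow> (\<forall>u<d. rank_word (Suc u) (W u)) \<and> (\<forall>u. Suc u < d \<longrightarrow> W u = del (Suc u) (W (Suc u)))"

definition cycles :: "(nat \<Rightarrow> nat \<Rightarrow> int) \<Rightarrow> nat \<Rightarrow> nat \<Rightarrow> int" where
  "cycles W i = window i (W i)"

lemma tower_word: "tower d W \<Longrightarrow> u < d \<Longrightarrow> rank_word (Suc u) (W u)"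
  and tower_del: "tower d W \<Longrightarrow> Suc u < d \<Longrightarrow> W u = del (Suc u) (W (Suc u))"
  unfolding tower_def by auto

lemma cut_0: "rank_word (Suc 0) r \<Longrightarrow> cut 0 r = 0"
  using cut_le[of 0 r] by simp

lemma cycles_0: "tower d W \<Longrightarrow> 0 < d \<Longrightarrow> x < n \<Longrightarrow> cycles W 0 x = W 0 x"
  using cut_0[OF tower_word, of d W] by (simp add: cycles_def window_def wpos_id)

lemma gen_cycle_cycles: "tower d W \<Longrightarrow> i < d \<Longrightarrow> gen_cycle (cycles W i)"
  unfolding cycles_def by (intro gen_cycle_window tower_word)

lemma linked_cycles: "tower d W \<Longrightarrow> Suc i < d \<Longrightarrow> linked (cycles W i) (cycles W (Suc i))"
  using linked_window[OF tower_word, of d W i] tower_del[of d W i] by (simp add: cycles_def)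

lemma chain_cycles:
  assumes "tower d W" "0 < d" shows "chain d (cycles W)"
  unfolding chain_def
  using gen_cycle_cycles[OF assms(1)] linked_cycles[OF assms(1)] cycles_0[OF assms n_pos]
    word_zero[OF tower_word[OF assms]] by auto

text \<open>A tower is determined by its cycles from the bottom up.\<close>

lemma tower_ins:
  assumes "tower d W" "Suc u < d"
  shows "W (Suc u) = ins u (W u) (cycles W (Suc u))"
  using ins_del_window[OF tower_word[OF assms]] tower_del[OF assms] by (simp add: cycles_def)

lemma sum_period:
  fixes f :: "nat \<Rightarrow> int"
  assumes "\<And>x. f (x + n) = f x"
  shows "sum f {p..<p + n} = sum f {..<n}"
proof (induction p)
  case 0 then show ?case by (simp add: atLeast0LessThan)
next
  case (Suc p)
  have "sum f {p..<p + n} = f p + sum f {Suc p..<p + n}"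
    using n_pos by (intro sum.atLeast_Suc_lessThan) auto
  moreover have "sum f {Suc p..<Suc p + n} = sum f {Suc p..<p + n} + f (p + n)"
    using n_pos by (simp add: sum.atLeastLessThan_Suc)
  ultimately show ?case using Suc assms[of p] by simp
qed

lemma sum_split_block:
  fixes f :: "nat \<Rightarrow> int"
  assumes "p \<le> k"
  shows "sum f {..<k + n} = sum f {..<p} + sum f {p..<p + n} + (\<Sum>x\<in>{p..<k}. f (x + n))"
proof -
  have "sum f {..<k + n} = sum f {0..<p} + sum f {p..<p + n} + sum f {p + n..<k + n}"
    using assms by (simp add: sum.atLeastLessThan_concat atLeast0LessThan[symmetric])
  also have "sum f {p + n..<k + n} = (\<Sum>x\<in>{p..<k}. f (x + n))" by (rule sum.shift_bounds_nat_ivl)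
  finally show ?thesis by (simp add: atLeast0LessThan)
qed

text \<open>Removing a window moves the remaining entries but does not change them, so the multiset of
ranks splits.\<close>

lemma sum_word_split:
  fixes F :: "int \<Rightarrow> int"
  assumes W: "rank_word (Suc (Suc u)) r"
  shows "(\<Sum>x<Suc (Suc u) * n. F (r x)) = (\<Sum>x<Suc u * n. F (del (Suc u) r x)) + (\<Sum>j<n. F (window (Suc u) r j))"
proof -
  let ?p = "cut (Suc u) r" and ?k = "Suc u * n"
  have p: "?p \<le> ?k" by (rule cut_le[OF W])
  have "(\<Sum>x<Suc (Suc u) * n. F (r x)) = (\<Sum>x<?k + n. F (r x))" by (simp add: add.commute)
  also have "\<dots> = (\<Sum>x<?p. F (r x)) + (\<Sum>x\<in>{?p..<?p + n}. F (r x)) + (\<Sum>x\<in>{?p..<?k}. F (r (x + n)))"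
    by (rule sum_split_block[OF p])
  also have "(\<Sum>x<?p. F (r x)) = (\<Sum>x\<in>{0..<?p}. F (del (Suc u) r x))"
    by (rule sum.cong) (auto simp: del_def)
  also have "(\<Sum>x\<in>{?p..<?k}. F (r (x + n))) = (\<Sum>x\<in>{?p..<?k}. F (del (Suc u) r x))"
    by (rule sum.cong) (auto simp: del_def)
  also have "(\<Sum>x\<in>{?p..<?p + n}. F (r x)) = (\<Sum>x\<in>{?p..<?p + n}. F (window (Suc u) r x))"
    by (rule sum.cong) (auto simp: window_def wpos_id)
  also have "\<dots> = (\<Sum>j<n. F (window (Suc u) r j))"
    by (rule sum_period) (simp add: gen_cycleD(3)[OF gen_cycle_window[OF W]])
  finally have "(\<Sum>x<Suc (Suc u) * n. F (r x)) = (\<Sum>x\<in>{0..<?p}. F (del (Suc u) r x))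
      + (\<Sum>x\<in>{?p..<?k}. F (del (Suc u) r x)) + (\<Sum>j<n. F (window (Suc u) r j))" by simp
  also have "(\<Sum>x\<in>{0..<?p}. F (del (Suc u) r x)) + (\<Sum>x\<in>{?p..<?k}. F (del (Suc u) r x))
      = (\<Sum>x\<in>{0..<?k}. F (del (Suc u) r x))"
    by (rule sum.atLeastLessThan_concat) (use p in auto)
  finally show ?thesis by (simp only: atLeast0LessThan)
qed

lemma sum_tower:
  fixes F :: "int \<Rightarrow> int"
  assumes T: "tower d W"
  shows "u < d \<Longrightarrow> (\<Sum>x<Suc u * n. F (W u x)) = (\<Sum>i<Suc u. \<Sum>j<n. F (cycles W i j))"
proof (induction u)
  case 0
  then have "(\<Sum>x<n. F (W 0 x)) = (\<Sum>x<n. F (cycles W 0 x))"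
    by (intro sum.cong) (auto simp: cycles_0[OF T])
  then show ?case by simp
next
  case (Suc u)
  have "(\<Sum>x<Suc (Suc u) * n. F (W (Suc u) x)) = (\<Sum>x<Suc u * n. F (W u x)) + (\<Sum>j<n. F (cycles W (Suc u) j))"
    using sum_word_split[OF tower_word[OF T Suc.prems]] tower_del[OF T Suc.prems] by (simp add: cycles_def)
  then show ?case using Suc by simp
qed

text \<open>The tower with prescribed cycles. At the bottom, the periodic \<open>G 0\<close> is its own rank word.\<close>

primrec build :: "(nat \<Rightarrow> nat \<Rightarrow> int) \<Rightarrow> nat \<Rightarrow> nat \<Rightarrow> int" where
  "build G 0 = G 0"
| "build G (Suc u) = ins u (build G u) (G (Suc u))"

lemma build_props:
  assumes C: "chain d G" and d: "0 < d"
  shows "u < d \<Longrightarrow> rank_word (Suc u) (build G u) \<and> window u (build G u) = G u"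
proof (induction u)
  case 0
  have W: "rank_word (Suc 0) (G 0)"
    unfolding rank_word_def using gen_cycleD[OF chain_cycle[OF C d 0]] chain_zero[OF C d] by auto
  moreover have "window 0 (G 0) = G 0"
    unfolding window_def using gen_cycle_cong[OF chain_cycle[OF C d 0] wpos_cong] by auto
  ultimately show ?case by simp
next
  case (Suc u)
  then have W: "rank_word (Suc u) (build G u)" and L: "linked (window u (build G u)) (G (Suc u))"
    using chain_linked[OF C d, of u] by auto
  note G = chain_cycle[OF C d Suc.prems]
  show ?case using rank_word_ins[OF W G L] window_ins[OF W G L] by simp
qed

lemma tower_build:
  assumes C: "chain d G" and d: "0 < d"
  shows "tower d (build G)" and "i < d \<Longrightarrow> cycles (build G) i = G i"
proof -
  have "build G u = del (Suc u) (build G (Suc u))" if "Suc u < d" for u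
  proof -
    have W: "rank_word (Suc u) (build G u)" and L: "linked (window u (build G u)) (G (Suc u))"
      using build_props[OF C d, of u] chain_linked[OF C d, of u] that by auto
    show ?thesis using del_ins[OF W chain_cycle[OF C d that] L] by simp
  qed
  then show "tower d (build G)" unfolding tower_def using build_props[OF C d] by blast
  show "i < d \<Longrightarrow> cycles (build G) i = G i" unfolding cycles_def using build_props[OF C d] by blast
qed

section \<open>Dyck paths and chains\<close>

text \<open>The rank vectors of a path, counted from the last one upwards as in a tower.\<close>

definition stage :: "nat \<Rightarrow> (nat \<Rightarrow> int) \<Rightarrow> nat \<Rightarrow> nat \<Rightarrow> int" where
  "stage d y u = rkvec d n m y (d - 1 - u)"

lemma rkvec_Suc: "rkvec d n m y (Suc k) = del (d - Suc k) (rkvec d n m y k)"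
  by (simp add: fun_eq_iff del_def cut_def)

lemma abound_eq: "int (abound n m (x div n) (x mod n)) = int m * int x div int n"
proof -
  have "m * x = m * (x div n * n + x mod n)" by simp
  also have "\<dots> = (x mod n) * m + (m * (x div n)) * n" by (simp only: distrib_left mult_ac)
  finally have "m * x div n = abound n m (x div n) (x mod n)" using n_pos by (simp add: abound_def)
  then show ?thesis by (simp flip: zdiv_int of_nat_mult)
qed

lemma DyckD:
  assumes "y \<in> Dyck d n m"
  shows "x < d * n \<Longrightarrow> 0 \<le> y x" "x < d * n \<Longrightarrow> int n * y x \<le> int m * int x"
    "x + 1 < d * n \<Longrightarrow> y x \<le> y (x + 1)" "x \<ge> d * n \<Longrightarrow> y x = undefined"
proof -
  have "y x \<in> {0..int m * int x div int n}" if "x < d * n" for x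
    using assms that PiE_mem[of y "{..<d * n}"] unfolding Dyck_def abound_eq by blast
  then show "x < d * n \<Longrightarrow> 0 \<le> y x" "x < d * n \<Longrightarrow> int n * y x \<le> int m * int x"
    using le_div_iff by auto
  show "x + 1 < d * n \<Longrightarrow> y x \<le> y (x + 1)" using assms unfolding Dyck_def by blast
  have "y \<in> (\<Pi>\<^sub>E x\<in>{..<d * n}. {0..int m * int x div int n})"
    using assms unfolding Dyck_def abound_eq by blast
  then show "x \<ge> d * n \<Longrightarrow> y x = undefined" by (rule PiE_arb) simp
qed

lemma DyckI:
  assumes "\<And>x. x < d * n \<Longrightarrow> 0 \<le> y x" "\<And>x. x < d * n \<Longrightarrow> int n * y x \<le> int m * int x"
    "\<And>x. x + 1 < d * n \<Longrightarrow> y x \<le> y (x + 1)" "\<And>x. x \<ge> d * n \<Longrightarrow> y x = undefined"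
  shows "y \<in> Dyck d n m"
  unfolding Dyck_def abound_eq using assms by (auto simp: le_div_iff PiE_def extensional_def)

lemma rank_word_Dyck:
  assumes y: "y \<in> Dyck d n m" and d: "0 < d"
  shows "rank_word d (\<lambda>x. int m * int x - int n * y x)"
  unfolding rank_word_def
proof (intro conjI allI impI)
  have "0 < d * n" using d n_pos by simp
  then have "0 \<le> y 0" "int n * y 0 \<le> 0" using DyckD(1,2)[OF y, of 0] by auto
  then show "int m * int 0 - int n * y 0 = 0" using n_pos by (simp add: mult_le_0_iff)
  fix x
  {
    assume "x < d * n"
    then show "0 \<le> int m * int x - int n * y x" using DyckD(2)[OF y] by simp
    show "[int m * int x - int n * y x = int m * int x] (mod int n)" by (simp add: cong_iff_dvd_diff)
  next
    assume "x + 1 < d * n"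
    then have "int n * y x \<le> int n * y (x + 1)" using DyckD(3)[OF y] by (intro mult_left_mono) auto
    then show "int m * int (x + 1) - int n * y (x + 1) \<le> int m * int x - int n * y x + int m"
      by (simp add: algebra_simps)
  }
qed

lemma stage_last: "0 < d \<Longrightarrow> stage d y (d - 1) = (\<lambda>x. int m * int x - int n * y x)"
  by (simp add: stage_def)

lemma tower_stage:
  assumes y: "y \<in> Dyck d n m" and d: "0 < d"
  shows "tower d (stage d y)"
proof -
  have W: "k < d \<Longrightarrow> rank_word (d - k) (rkvec d n m y k)" for k
  proof (induction k)
    case 0 then show ?case using rank_word_Dyck[OF y d] by simp
  next
    case (Suc k)
    then obtain u where u: "d - k = Suc (Suc u)" "d - Suc k = Suc u"
      by (metis Suc_diff_Suc Suc_lessD)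
    show ?case using Suc u rank_word_del[of u "rkvec d n m y k"] unfolding rkvec_Suc by simp
  qed
  show ?thesis unfolding tower_def
  proof (intro conjI allI impI)
    fix u assume "u < d"
    then have "d - 1 - u < d" "d - (d - 1 - u) = Suc u" by auto
    then show "rank_word (Suc u) (stage d y u)" using W[of "d - 1 - u"] by (simp add: stage_def)
  next
    fix u assume u: "Suc u < d"
    then have "d - 1 - u = Suc (d - 1 - Suc u)" "d - Suc (d - 1 - Suc u) = Suc u" by auto
    then show "stage d y u = del (Suc u) (stage d y (Suc u))" unfolding stage_def by (metis rkvec_Suc)
  qed
qed

text \<open>The bottom word is its own window, and every further word is an insertion of a known cycle.\<close>

lemma cycles_stage_inj:
  assumes y: "y \<in> Dyck d n m" and y': "y' \<in> Dyck d n m" and d: "0 < d"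
    and eq: "\<And>i. i < d \<Longrightarrow> cycles (stage d y) i = cycles (stage d y') i"
  shows "y = y'"
proof -
  note T = tower_stage[OF y d] and T' = tower_stage[OF y' d]
  have st: "u < d \<Longrightarrow> x < Suc u * n \<Longrightarrow> stage d y u x = stage d y' u x" for u x
  proof (induction u arbitrary: x)
    case 0
    then show ?case using cycles_0[OF T] cycles_0[OF T'] eq[of 0] by simp
  next
    case (Suc u)
    then have u: "u < d" by simp
    have "slot u (stage d y u) (cycles (stage d y) (Suc u)) \<le> Suc u * n"
      using linked_cycles[OF T Suc.prems(1)]
      by (intro slot_le tower_word[OF T u] gen_cycle_cycles[OF T Suc.prems(1)]) (simp add: cycles_def)
    then show ?case
      unfolding tower_ins[OF T Suc.prems(1)] tower_ins[OF T' Suc.prems(1)] eq[OF Suc.prems(1), symmetric]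
      using Suc.IH[OF u] Suc.prems(2) by (intro ins_cong) auto
  qed
  show ?thesis
  proof
    fix x
    show "y x = y' x"
    proof (cases "x < d * n")
      case True
      then have "stage d y (d - 1) x = stage d y' (d - 1) x" using d by (intro st) auto
      then show ?thesis using n_pos unfolding stage_last[OF d] by simp
    next
      case False then show ?thesis using DyckD(4)[OF y] DyckD(4)[OF y'] by simp
    qed
  qed
qed

text \<open>The heights are read off the top word of the tower built from the chain.\<close>

lemma cycles_stage_surj:
  assumes C: "chain d G" and d: "0 < d"
  obtains y where "y \<in> Dyck d n m" "\<And>i. i < d \<Longrightarrow> cycles (stage d y) i = G i"
proof -
  define r where "r = build G (d - 1)"
  have W: "rank_word d r" using build_props[OF C d, of "d - 1"] d by (simp add: r_def)
  define y where "y x = (if x < d * n then (int m * int x - r x) div int n else undefined)" for x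
  have yr: "int m * int x - int n * y x = r x" if "x < d * n" for x
  proof -
    have "[int m * int x = r x] (mod int n)" using W that unfolding rank_word_def by (simp add: cong_def)
    then have "int n dvd int m * int x - r x" by (simp add: cong_iff_dvd_diff)
    then show ?thesis using that by (simp add: y_def)
  qed
  have le: "x < d * n \<Longrightarrow> r x \<le> int m * int x" for x
  proof (induction x)
    case 0 then show ?case using W unfolding rank_word_def by simp
  next
    case (Suc x)
    then have "r (x + 1) \<le> r x + int m" using W unfolding rank_word_def by simp
    then show ?case using Suc by (simp add: algebra_simps)
  qed
  have y: "y \<in> Dyck d n m"
  proof (rule DyckI)
    fix x assume x: "x < d * n"
    then show "0 \<le> y x" using le[OF x] n_pos by (simp add: y_def pos_imp_zdiv_nonneg_iff)
    show "int n * y x \<le> int m * int x" using yr[OF x] W x unfolding rank_word_def by force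
  next
    fix x assume x: "x + 1 < d * n"
    then have "r (x + 1) \<le> r x + int m" using W unfolding rank_word_def by blast
    then have "int n * y x \<le> int n * y (x + 1)" using yr[of x] yr[of "x + 1"] x by (simp add: algebra_simps)
    then show "y x \<le> y (x + 1)" using n_pos by simp
  qed (simp add: y_def)
  note T = tower_build[OF C d]
  have agree: "k < d \<Longrightarrow> x < (d - k) * n \<Longrightarrow> rkvec d n m y k x = build G (d - 1 - k) x" for k x
  proof (induction k arbitrary: x)
    case 0 then show ?case using yr[of x] by (simp add: r_def)
  next
    case (Suc k)
    define u where "u = d - 2 - k"
    have u: "d - k = Suc (Suc u)" "d - Suc k = Suc u" "d - 1 - k = Suc u" "d - 1 - Suc k = u" "Suc u < d"
      using Suc.prems unfolding u_def by auto
    have "del (Suc u) (rkvec d n m y k) x = del (Suc u) (build G (Suc u)) x"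
    proof (rule del_cong)
      fix x assume "x < Suc (Suc u) * n"
      then have "x < (d - k) * n" unfolding u(1) .
      from Suc.IH[OF Suc_lessD[OF Suc.prems(1)] this]
      show "rkvec d n m y k x = build G (Suc u) x" unfolding u(3) .
    qed (use Suc.prems(2) in \<open>simp only: u(2)\<close>)
    then show ?case unfolding rkvec_Suc u(2,4) tower_del[OF T(1) u(5)] .
  qed
  have "cycles (stage d y) i = G i" if i: "i < d" for i
  proof -
    have "stage d y i x = build G i x" if "x < Suc i * n" for x
      using agree[of "d - 1 - i" x] that i by (simp add: stage_def)
    then have "window i (stage d y i) = window i (build G i)"
      using tower_word[OF tower_stage[OF y d] i] by (intro window_cong) auto
    then show ?thesis using T(2)[OF i] by (simp add: cycles_def)
  qed
  with y show ?thesis using that by blast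
qed

lemma pidx_eq: "pidx d n m y u = cut u (stage d y u)"
  by (simp add: pidx_def pset_def cut_def stage_def diff_commute)

lemma pset_eq: "pset d n m y u = pcand n m u (stage d y u)"
  by (simp add: pset_def stage_def diff_commute)

section \<open>The permutations that record the columns\<close>

text \<open>The part of \<open>sperm\<close> that concerns only the layers \<open>0, ..., u\<close>.\<close>

definition partial_sperm :: "nat \<Rightarrow> (nat \<Rightarrow> int) \<Rightarrow> nat \<Rightarrow> nat \<Rightarrow> nat \<Rightarrow> nat" where
  "partial_sperm d y j u = fold (\<lambda>u s. scyc d n m y j u \<circ> s) [1..<Suc u] id"

lemma partial_sperm_0: "partial_sperm d y j 0 = id"
  and partial_sperm_Suc: "partial_sperm d y j (Suc u) = scyc d n m y j (Suc u) \<circ> partial_sperm d y j u"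
  and sperm_eq_partial: "0 < d \<Longrightarrow> sperm d n m y j = partial_sperm d y j (d - 1)"
  by (simp_all add: partial_sperm_def sperm_def fun_eq_iff)

text \<open>In the column class \<open>j\<close>, the block number \<open>iidx\<close> locates the unique entry that belongs to the window.\<close>

lemma iidx_eq:
  assumes j: "j < n" and W: "rank_word (Suc u) (stage d y u)"
  shows "iidx d n m y j u \<le> u" "iidx d n m y j u * n + j = wpos (cut u (stage d y u)) j"
proof -
  let ?p = "cut u (stage d y u)"
  let ?q = "wpos ?p j"
  have "?q mod n = j" using wpos_cong[of ?p j] j by (simp add: cong_def)
  then have q: "?q div n * n + j = ?q" by (metis div_mult_mod_eq)
  have "?q < Suc u * n" using wpos_less[of ?p j] cut_le[OF W] by simp
  then have le: "?q div n \<le> u" using less_mult_imp_div_less[of ?q "Suc u" n] by simp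
  have "iidx d n m y j u = ?q div n"
    unfolding iidx_def pidx_eq
  proof (rule Min_eqI)
    show "finite {i. i \<le> u \<and> ?p \<le> i * n + j}" by simp
    show "?q div n \<in> {i. i \<le> u \<and> ?p \<le> i * n + j}" using le q wpos_ge[of ?p j] by simp
    fix i assume i: "i \<in> {i. i \<le> u \<and> ?p \<le> i * n + j}"
    show "?q div n \<le> i"
    proof (rule ccontr)
      assume "\<not> ?thesis"
      then have "(i + 1) * n \<le> ?q div n * n" by (intro mult_right_mono) auto
      then have "?p + n \<le> ?q" using i q by simp
      then show False using wpos_less[of ?p j] by simp
    qed
  qed
  then show "iidx d n m y j u \<le> u" "iidx d n m y j u * n + j = ?q" using le q by auto
qed

text \<open>After step \<open>u\<close>, the permutation sends a layer \<open>i\<close> to the block of \<open>W u\<close> in which its generator of class \<open>j\<close> stands: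
undoing a deletion shifts the blocks behind the cut by one, and the new layer \<open>u\<close> enters at the cut.
These two effects are the cyclic permutation \<open>scyc\<close>.\<close>

lemma partial_sperm_props:
  assumes y: "y \<in> Dyck d n m" and d: "0 < d" and j: "j < n"
  shows "u < d \<Longrightarrow> partial_sperm d y j u permutes {..u}
    \<and> (\<forall>i\<le>u. stage d y u (partial_sperm d y j u i * n + j) = cycles (stage d y) i j)"
proof (induction u)
  case 0
  then show ?case using cycles_0[OF tower_stage[OF y d] d j] by (simp add: partial_sperm_0 id_def[symmetric] permutes_id)
next
  case (Suc u)
  let ?a = "iidx d n m y j (Suc u)" and ?s = "scyc d n m y j (Suc u)" and ?t = "partial_sperm d y j u"
  let ?W = "stage d y" and ?p = "cut (Suc u) (stage d y (Suc u))"
  note T = tower_stage[OF y d]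
  note a = iidx_eq[OF j tower_word[OF T Suc.prems]]
  from Suc have t: "?t permutes {..u}" "\<And>i. i \<le> u \<Longrightarrow> ?W u (?t i * n + j) = cycles ?W i j" by auto
  have s: "?s i = (if ?a \<le> i \<and> i < Suc u then i + 1 else if i = Suc u then ?a else i)" for i
    unfolding scyc_def using a(1) by (rule cycle_of_upt)
  have "?s permutes set [?a..<Suc (Suc u)]" unfolding scyc_def by (rule cycle_permutes)
  then have "?s permutes {..Suc u}" by (rule permutes_subset) auto
  moreover have "?t permutes {..Suc u}" using t(1) by (rule permutes_subset) auto
  ultimately have "partial_sperm d y j (Suc u) permutes {..Suc u}"
    unfolding partial_sperm_Suc by (intro permutes_compose)
  moreover have "?W (Suc u) (partial_sperm d y j (Suc u) i * n + j) = cycles ?W i j" if i: "i \<le> Suc u" for i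
  proof (cases "i = Suc u")
    case True
    then have "?t i = i" using t(1) by (simp add: permutes_def)
    then show ?thesis using True a s by (simp add: partial_sperm_Suc cycles_def window_def)
  next
    case False
    then have i: "i \<le> u" using i by simp
    then have ti: "?t i \<le> u" using permutes_in_image[OF t(1), of i] by simp
    have lt: "?t i * n + j < ?p \<longleftrightarrow> ?t i < ?a"
    proof
      assume "?t i * n + j < ?p"
      also have "?p \<le> ?a * n + j" using a(2) wpos_ge[of ?p j] by simp
      finally show "?t i < ?a" by simp
    next
      assume "?t i < ?a"
      then have "(?t i + 1) * n \<le> ?a * n" by (intro mult_right_mono) auto
      then have "?t i * n + j + n \<le> wpos ?p j" using a(2) by simp
      then show "?t i * n + j < ?p" using wpos_less[of ?p j] by simp
    qed
    have "?W (Suc u) (?s (?t i) * n + j) = del (Suc u) (?W (Suc u)) (?t i * n + j)"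
      using s[of "?t i"] ti lt by (auto simp: del_def add_ac)
    also have "\<dots> = cycles ?W i j" using t(2)[OF i] tower_del[OF T Suc.prems] by simp
    finally show ?thesis by (simp add: partial_sperm_Suc)
  qed
  ultimately show ?case by blast
qed

lemma sperm_permutes:
  assumes "y \<in> Dyck d n m" "0 < d" "j < n"
  shows "sperm d n m y j permutes {..<d}"
  using partial_sperm_props[OF assms, of "d - 1"] assms(2) sperm_eq_partial[OF assms(2)]
  by (metis Suc_diff_1 diff_less lessThan_Suc_atMost zero_less_one)

lemma cycles_sperm:
  assumes "y \<in> Dyck d n m" "0 < d" "j < n" "i < d"
  shows "cycles (stage d y) i j
    = int m * int (sperm d n m y j i * n + j) - int n * y (sperm d n m y j i * n + j)"
proof -
  have "i \<le> d - 1" using assms(4) by simp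
  then have "stage d y (d - 1) (sperm d n m y j i * n + j) = cycles (stage d y) i j"
    using partial_sperm_props[OF assms(1-3), of "d - 1"] assms(2) sperm_eq_partial[OF assms(2)] by simp
  then show ?thesis unfolding stage_last[OF assms(2)] by simp
qed

lemma cycles_Psi:
  assumes "y \<in> Dyck d n m" "0 < d" "i < d" "j < n"
  shows "cycles (stage d y) i j = int m * int (i * n + j) - int n * Psi d n m y i j"
  unfolding cycles_sperm[OF assms(1,2,4,3)] by (simp add: Psi_def algebra_simps)

lemma PsiSet_eq:
  assumes "y \<in> Dyck d n m" "0 < d"
  shows "PsiSet d n m y = modset d (cycles (stage d y))"
  unfolding PsiSet_def
  by (rule subset_of_matrix_eq_modset[OF gen_cycle_cycles[OF tower_stage[OF assms]] assms(2)
        cycles_Psi[OF assms]])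

lemma bij_PsiSet:
  assumes d: "0 < d" shows "bij_betw (PsiSet d n m) (Dyck d n m) (Adm d n m)"
  unfolding bij_betw_def
proof
  note ch = chain_cycles[OF tower_stage[OF _ d] d]
  show "inj_on (PsiSet d n m) (Dyck d n m)"
  proof (rule inj_onI)
    fix y y' assume y: "y \<in> Dyck d n m" "y' \<in> Dyck d n m" "PsiSet d n m y = PsiSet d n m y'"
    then have "modset d (cycles (stage d y)) = modset d (cycles (stage d y'))" using PsiSet_eq d by simp
    then show "y = y'" using cycles_stage_inj[OF y(1,2) d] modset_inj[OF ch[OF y(1)] ch[OF y(2)] d] by blast
  qed
  show "PsiSet d n m ` Dyck d n m = Adm d n m"
  proof (intro equalityI subsetI)
    fix S assume "S \<in> PsiSet d n m ` Dyck d n m"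
    then show "S \<in> Adm d n m" using PsiSet_eq d modset_Adm[OF ch d] by auto
  next
    fix S assume "S \<in> Adm d n m"
    then obtain G where G: "chain d G" "modset d G = S" using Adm_is_modset d by blast
    then obtain y where y: "y \<in> Dyck d n m" "\<And>i. i < d \<Longrightarrow> cycles (stage d y) i = G i"
      using cycles_stage_surj[OF G(1) d] by blast
    have "modset d (cycles (stage d y)) = modset d G" using y(2) d by (simp add: modset_def)
    then show "S \<in> PsiSet d n m ` Dyck d n m" using PsiSet_eq[OF y(1) d] G(2) y(1) by blast
  qed
qed

lemma represents_PsiSet:
  assumes y: "y \<in> Dyck d n m" and d: "0 < d"
  shows "represents d n m (PsiSet d n m y) (Psi d n m y)"
proof -
  let ?G = "cycles (stage d y)"
  note T = tower_stage[OF y d] and P = cycles_Psi[OF y d]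
  have "0 \<le> Psi d n m y i j \<and> Psi d n m y i j \<le> int (abound n m i j)" if ij: "i < d" "j < n" for i j
  proof
    have "int n * Psi d n m y i j = int m * int (i * n + j) - ?G i j" using P[OF ij] by simp
    moreover have "?G i j \<le> int m * int (i * n + j)"
      using chain_bound[OF chain_cycles[OF T d] d ij(1), of j] by simp
    ultimately have "0 \<le> int n * Psi d n m y i j" by simp
    then show "0 \<le> Psi d n m y i j" using n_pos by (simp add: zero_le_mult_iff)
    have "int n * Psi d n m y i j \<le> int m * int (i * n + j)"
      using P[OF ij] gen_cycleD(1)[OF gen_cycle_cycles[OF T ij(1)], of j] by simp
    then show "Psi d n m y i j \<le> int (abound n m i j)"
      using abound_eq[of "i * n + j"] ij by (simp add: le_div_iff)
  qed
  moreover have "int ` generators (d * n) (PsiSet d n m y)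
      = {int (ahat d n m i j) - int (d * n) * Psi d n m y i j | i j. i < d \<and> j < n}"
  proof -
    have "int d * ?G i j + int i = int (ahat d n m i j) - int (d * n) * Psi d n m y i j"
      if "i < d" "j < n" for i j
      unfolding P[OF that] by (simp add: ahat_def algebra_simps)
    then have "{int d * ?G i j + int i | i j. i < d \<and> j < n}
      = {int (ahat d n m i j) - int (d * n) * Psi d n m y i j | i j. i < d \<and> j < n}"
      by (intro Collect_cong) metis
    moreover have "int ` generators (d * n) (modset d ?G) = {int d * ?G i j + int i | i j. i < d \<and> j < n}"
      by (rule int_generators_modset[OF gen_cycle_cycles[OF T] d])
    ultimately show ?thesis unfolding PsiSet_eq[OF y d] by (rule trans[rotated])
  qed
  ultimately show ?thesis unfolding represents_def by blast
qed

text \<open>The ranks of the path and the generators of the layers are the same multiset, so their sums agree.\<close>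

lemma matrix_sum_Psi:
  assumes y: "y \<in> Dyck d n m" and d: "0 < d"
  shows "matrix_sum d n (Psi d n m y) = path_size d n y"
proof -
  let ?G = "cycles (stage d y)"
  have 1: "(\<Sum>x<d * n. int m * int x - int n * y x) = (\<Sum>i<d. \<Sum>j<n. ?G i j)"
    using sum_tower[OF tower_stage[OF y d], of "d - 1" "\<lambda>z. z"] d unfolding stage_last[OF d] by simp
  have 2: "(\<Sum>x<d * n. f x) = (\<Sum>i<d. \<Sum>j<n. f (i * n + j))" for f :: "nat \<Rightarrow> int"
  proof -
    have "sum f {i * n..<i * n + n} = (\<Sum>j<n. f (i * n + j))" for i
      using sum.shift_bounds_nat_ivl[of f 0 "i * n" n] by (simp add: atLeast0LessThan add.commute)
    then show ?thesis by (simp flip: sum.nat_group)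
  qed
  have "(\<Sum>i<d. \<Sum>j<n. ?G i j) = (\<Sum>i<d. \<Sum>j<n. int m * int (i * n + j) - int n * Psi d n m y i j)"
    using cycles_Psi[OF y d] by (intro sum.cong refl) auto
  also have "\<dots> = (\<Sum>x<d * n. int m * int x) - int n * matrix_sum d n (Psi d n m y)"
    by (simp add: 2 matrix_sum_def sum_subtractf sum_distrib_left)
  finally have "int n * matrix_sum d n (Psi d n m y) = int n * path_size d n y"
    using 1 by (simp add: path_size_def sum_subtractf sum_distrib_left)
  then show ?thesis using n_pos by simp
qed

lemma e_stat_PsiSet:
  assumes y: "y \<in> Dyck d n m" and d: "0 < d"
  shows "e_stat d n m (PsiSet d n m y) = matrix_sum d n (Psi d n m y)"
proof -
  let ?G = "cycles (stage d y)"
  have "?G i j div int n = int (abound n m i j) - Psi d n m y i j" if "i < d" "j < n" for i j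
  proof -
    have "?G i j = int m * int (i * n + j) + int n * (- Psi d n m y i j)" using cycles_Psi[OF y d that] by simp
    then have "?G i j div int n = - Psi d n m y i j + int m * int (i * n + j) div int n"
      using n_pos by (metis div_mult_self2 of_nat_0_eq_iff less_irrefl)
    then show ?thesis using abound_eq[of "i * n + j"] that by simp
  qed
  then have "int (delta (PsiSet d n m y)) = (\<Sum>i<d. \<Sum>j<n. int (abound n m i j) - Psi d n m y i j)"
    unfolding PsiSet_eq[OF y d] delta_modset[OF chain_cycles[OF tower_stage[OF y d] d] d]
    by (intro sum.cong refl) auto
  then show ?thesis unfolding e_stat_def delta_Gamma[OF d] by (simp add: matrix_sum_def sum_subtractf)
qed

lemma cut_stage_props:
  assumes y: "y \<in> Dyck d n m" and d: "0 < d"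
  shows "u < d \<Longrightarrow> pset d n m y u \<noteq> {}" "1 \<le> u \<Longrightarrow> u < d \<Longrightarrow> 0 < pidx d n m y u"
    "Suc u < d \<Longrightarrow> pidx d n m y u < pidx d n m y (u + 1)" "u < d \<Longrightarrow> pidx d n m y u \<le> u * n"
proof -
  note T = tower_stage[OF y d]
  show "u < d \<Longrightarrow> pset d n m y u \<noteq> {}"
    unfolding pset_eq using zero_pcand[OF tower_word[OF T]] by blast
  show "1 \<le> u \<Longrightarrow> u < d \<Longrightarrow> 0 < pidx d n m y u"
    unfolding pidx_eq using cut_pos[OF tower_word[OF T]] by simp
  show "u < d \<Longrightarrow> pidx d n m y u \<le> u * n"
    unfolding pidx_eq by (rule cut_le[OF tower_word[OF T]])
  assume u: "Suc u < d"
  then show "pidx d n m y u < pidx d n m y (u + 1)"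
    unfolding pidx_eq tower_del[OF T u] using cut_del_less[OF tower_word[OF T u]] by simp
qed

section \<open>Ranks compared in pairs\<close>

text \<open>For two generators \<open>a\<close>, \<open>b\<close>, the value \<open>gap_count (b - a)\<close> counts the numbers below \<open>b\<close>, congruent to \<open>b\<close> modulo
\<open>n\<close>, in the interval \<open>{a..<a + m}\<close>; up to the treatment of ties, it is the contribution of the pair to the dimension.\<close>

definition gap_count :: "int \<Rightarrow> int" where "gap_count z = steps z - steps (z - int m)"
text \<open>In a column of rank \<open>s\<close>, the rows that begin in a column of rank \<open>b\<close> whose left neighbour has rank \<open>a\<close>
contribute \<open>upper (s - b) - lower (s - a)\<close> boxes to \<open>dinv\<close>; see \<open>int_dinv\<close>.\<close>

definition upper :: "int \<Rightarrow> int" where "upper e = steps (e + int m + int n) - steps e"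
definition lower :: "int \<Rightarrow> int" where "lower e = steps (e + int n) - steps (e - int m)"
text \<open>The number of multiples of \<open>n\<close> in \<open>{e<..e + m}\<close>.\<close>

definition carry :: "int \<Rightarrow> int" where "carry e = (e + int m) div int n - e div int n"

lemma div_shift: "(a + int n * c) div int n = a div int n + c"
  using n_pos by simp

text \<open>Positive part minus negative part of \<open>z div n\<close>. With this, \<open>steps\<close> of a difference is related to \<open>steps\<close> of the
opposite difference.\<close>

lemma steps_reflect: "z div int n = steps z - steps (int n - 1 - z)"
proof -
  have "int n - 1 - z = int n - 1 - z mod int n + int n * (- (z div int n))"
    using mult_div_mod_eq[of "int n" z] by (simp only: mult_minus_right)
  then have "(int n - 1 - z) div int n = (int n - 1 - z mod int n) div int n + - (z div int n)"
    by (simp only: div_shift)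
  moreover have "(int n - 1 - z mod int n) div int n = 0"
    using n_pos pos_mod_bound[of "int n" z] pos_mod_sign[of "int n" z]
    by (intro div_pos_pos_trivial) linarith+
  ultimately show ?thesis by (simp add: steps_def)
qed

lemma le_mult_iff: "int n \<le> int n * k \<longleftrightarrow> 0 < k"
proof
  assume "int n \<le> int n * k"
  then have "0 < int n * k" using n_pos by linarith
  then show "0 < k" using n_pos by (simp add: zero_less_mult_iff)
next
  assume "0 < k"
  then have "int n * 1 \<le> int n * k" by (intro mult_left_mono) auto
  then show "int n \<le> int n * k" by simp
qed

lemma steps_jump: "steps z - steps (z - 1) = (if int n dvd z \<and> int n \<le> z then 1 else 0)"
proof (cases "int n dvd z")
  case True
  then obtain k where k: "z = int n * k" by blast
  have "z - 1 = int n - 1 + int n * (k - 1)" using k by (simp add: algebra_simps)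
  then have "(z - 1) div int n = (int n - 1) div int n + (k - 1)"
    by (simp only: div_shift)
  also have "(int n - 1) div int n = 0" using n_pos by (intro div_pos_pos_trivial) auto
  finally have d: "(z - 1) div int n = k - 1" by simp
  have z: "z div int n = k" using k n_pos by simp
  have "int n \<le> z \<longleftrightarrow> 1 \<le> k" using le_mult_iff[of k] unfolding k by linarith
  then have "(if int n dvd z \<and> int n \<le> z then 1 else 0) = (if 1 \<le> k then 1 else 0::int)" using True by simp
  then show ?thesis unfolding steps_def d z by simp
next
  case False
  define s where "s = z mod int n"
  have s: "0 < s" "s < int n"
  proof -
    have "s \<noteq> 0" using False unfolding s_def by (simp only: mod_eq_0_iff_dvd not_False_eq_True)
    moreover have "0 \<le> s" using n_pos unfolding s_def by simp
    ultimately show "0 < s" by linarith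
    show "s < int n" using n_pos unfolding s_def by simp
  qed
  have "z - 1 = s - 1 + int n * (z div int n)"
    using mult_div_mod_eq[of "int n" z] unfolding s_def by linarith
  then have "(z - 1) div int n = (s - 1) div int n + z div int n"
    by (simp only: div_shift)
  also have "(s - 1) div int n = 0" using s by (intro div_pos_pos_trivial) auto
  finally show ?thesis using False by (simp add: steps_def)
qed

text \<open>The identity behind the dimension formula: for a pair of ranks in path order, the contribution to
\<open>dinv\<close> (after the summation by parts in \<open>int_dinv\<close>) and the contributions to the dimension in both orders have a sum that depends only
on the residue class of the difference. In the second order, the tie is resolved the other way, hence \<open>- e - 1\<close>.\<close>

lemma upper_lower: "upper e - lower e + gap_count e + gap_count (- e - 1) = carry e"
proof -
  have "(e + int m + int n) div int n = steps (e + int m + int n) - steps (- e - 1 - int m)"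
  proof -
    have "int n - 1 - (e + int m + int n) = - e - 1 - int m" by simp
    then show ?thesis using steps_reflect[of "e + int m + int n"] by (simp only:)
  qed
  moreover have "(e + int n) div int n = steps (e + int n) - steps (- e - 1)"
  proof -
    have "int n - 1 - (e + int n) = - e - 1" by simp
    then show ?thesis using steps_reflect[of "e + int n"] by (simp only:)
  qed
  moreover have "(e + int m + int n) div int n = (e + int m) div int n + 1"
    "(e + int n) div int n = e div int n + 1" using n_pos by auto
  ultimately show ?thesis by (simp add: upper_def lower_def gap_count_def carry_def)
qed

lemma carry_mod: "int n * carry e = int m + e mod int n - (e + int m) mod int n"
  using mult_div_mod_eq[of "int n" e] mult_div_mod_eq[of "int n" "e + int m"]
  unfolding carry_def right_diff_distrib by linarith

lemma carry_cong: assumes "[e = e'] (mod int n)" shows "carry e = carry e'"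
proof -
  have "(e + int m) mod int n = (e' + int m) mod int n"
    using assms by (metis cong_def mod_add_left_eq)
  then have "int n * carry e = int n * carry e'" using assms by (simp add: carry_mod cong_def)
  then show ?thesis using n_pos by simp
qed

text \<open>Up to the summand \<open>m\<close>, the carries are differences of remainders of consecutive terms, so the
sums telescope around the cycle.\<close>

lemma sum_carry:
  assumes g: "gen_cycle g"
  shows "(\<Sum>y<n. carry (g y - s)) = int m" "(\<Sum>y<n. carry (s - g y)) = int m"
proof -
  have c: "[g (y + 1) = g y + int m] (mod int n)" for y
    using gen_cycleD(2)[OF g, of "y + 1"] cong_add[OF gen_cycleD(2)[OF g, of y] cong_refl[of "int m"]]
    by (simp add: cong_def algebra_simps)
  have per: "g n = g 0" using gen_cycleD(3)[OF g, of 0] by simp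
  \<comment> \<open>By \<open>carry_mod\<close>, the carry compares a remainder with the remainder of the next term.\<close>
  define z where "z y = (g y - s) mod int n" for y
  have "int n * carry (g y - s) = int m + (z y - z (Suc y))" for y
  proof -
    have "[g y - s + int m = g (y + 1) - s] (mod int n)"
      using cong_diff[OF cong_sym[OF c[of y]] cong_refl[of s]] by (simp add: algebra_simps)
    then have "(g y - s + int m) mod int n = z (Suc y)" by (simp add: z_def cong_def)
    then show ?thesis by (simp add: carry_mod z_def)
  qed
  then have "int n * (\<Sum>y<n. carry (g y - s)) = int n * int m + (\<Sum>y<n. z y - z (Suc y))"
    by (simp add: sum_distrib_left sum.distrib)
  also have "(\<Sum>y<n. z y - z (Suc y)) = 0" by (simp only: sum_lessThan_telescope') (simp add: z_def per)
  finally show "(\<Sum>y<n. carry (g y - s)) = int m" using n_pos by simp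
  define z' where "z' y = (s - g y) mod int n" for y
  have "int n * carry (s - g (Suc y)) = int m + (z' (Suc y) - z' y)" for y
  proof -
    have "[s - g (y + 1) + int m = s - g y] (mod int n)"
      using cong_diff[OF cong_refl[of "s + int m"] c[of y]] by (simp add: algebra_simps)
    then have "(s - g (Suc y) + int m) mod int n = z' y" by (simp add: z'_def cong_def)
    then show ?thesis by (simp add: carry_mod z'_def)
  qed
  then have "int n * (\<Sum>y<n. carry (s - g (Suc y))) = int n * int m + (\<Sum>y<n. z' (Suc y) - z' y)"
    by (simp add: sum_distrib_left sum.distrib)
  also have "(\<Sum>y<n. z' (Suc y) - z' y) = 0" by (simp only: sum_lessThan_telescope) (simp add: z'_def per)
  finally have "(\<Sum>y<n. carry (s - g (Suc y))) = int m" using n_pos by simp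
  moreover have "(\<Sum>y<n. carry (s - g (Suc y))) = (\<Sum>y<n. carry (s - g y))"
  proof -
    have "(\<Sum>y<n. carry (s - g (Suc y))) - (\<Sum>y<n. carry (s - g y)) = 0"
      unfolding sum_subtractf[symmetric] by (subst sum_lessThan_telescope) (simp add: per)
    then show ?thesis by simp
  qed
  ultimately show "(\<Sum>y<n. carry (s - g y)) = int m" by simp
qed

text \<open>The function \<open>steps\<close> jumps only at positive multiples of \<open>n\<close>, and exactly one \<open>y < n\<close> gives a multiple of \<open>n\<close>.\<close>

lemma sum_jump:
  assumes g: "gen_cycle g" and s: "[s = int m * int x] (mod int n)"
  shows "(\<Sum>y<n. steps (g y - s) - steps (g y - s - 1)) = (if s < g x then 1 else 0)"
    and "(\<Sum>y<n. steps (s - g y) - steps (s - g y - 1)) = (if g x < s then 1 else 0)"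
proof -
  have dv: "int n dvd g y - s \<longleftrightarrow> y = x mod n" if "y < n" for y
  proof -
    have "int n dvd g y - s \<longleftrightarrow> [g y = s] (mod int n)" by (simp add: cong_iff_dvd_diff)
    also have "\<dots> \<longleftrightarrow> [int m * int y = int m * int x] (mod int n)"
      using s gen_cycleD(2)[OF g, of y] by (simp add: cong_def)
    finally show ?thesis using that by (simp add: cong_m_iff) (simp add: cong_def)
  qed
  have gx: "g (x mod n) = g x" "x mod n < n" using gen_cycle_mod[OF g] n_pos by auto
  have "int n dvd g x - s" using dv[OF gx(2)] gx(1) by simp
  then obtain k where k: "g x - s = int n * k" by blast
  have k: "int n \<le> int n * k \<longleftrightarrow> 0 < int n * k" for k :: int
    using n_pos by (simp add: le_mult_iff zero_less_mult_iff)
  have k1: "int n \<le> g x - s \<longleftrightarrow> s < g x" using k[of k] unfolding \<open>g x - s = int n * k\<close>[symmetric] by simp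
  have "s - g x = int n * (- k)" using \<open>g x - s = int n * k\<close> by simp
  then have k2: "int n \<le> s - g x \<longleftrightarrow> g x < s" using k[of "- k"] by (simp only:) linarith
  have "(\<Sum>y<n. steps (g y - s) - steps (g y - s - 1)) = (\<Sum>y<n. if y = x mod n then (if s < g x then 1 else 0) else 0)"
    unfolding steps_jump using dv k1 gx by (intro sum.cong) auto
  then show "(\<Sum>y<n. steps (g y - s) - steps (g y - s - 1)) = (if s < g x then 1 else 0)"
    using gx(2) by (simp only: sum.delta finite_lessThan lessThan_iff) simp
  have dv': "int n dvd s - g y \<longleftrightarrow> y = x mod n" if "y < n" for y
    using dv[OF that] by (simp add: dvd_diff_commute)
  have "(\<Sum>y<n. steps (s - g y) - steps (s - g y - 1)) = (\<Sum>y<n. if y = x mod n then (if g x < s then 1 else 0) else 0)"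
    unfolding steps_jump using dv' k2 gx by (intro sum.cong) auto
  then show "(\<Sum>y<n. steps (s - g y) - steps (s - g y - 1)) = (if g x < s then 1 else 0)"
    using gx(2) by (simp only: sum.delta finite_lessThan lessThan_iff) simp
qed

text \<open>The contribution to the dimension of the pairs formed by a generator \<open>s\<close> of a lower layer and the generators
\<open>g\<close> of a higher layer.\<close>

definition cross :: "(nat \<Rightarrow> int) \<Rightarrow> int \<Rightarrow> int" where
  "cross g s = (\<Sum>y<n. gap_count (g y - s) + gap_count (s - g y - 1))"

lemma cross_before:
  assumes "gen_cycle g"
  shows "(\<Sum>y<n. upper (g y - s) - lower (g y - s)) + cross g s = int m"
proof -
  have "upper (g y - s) - lower (g y - s) + (gap_count (g y - s) + gap_count (s - g y - 1)) = carry (g y - s)" for y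
    using upper_lower[of "g y - s"] by simp
  then show ?thesis using sum_carry(1)[OF assms, of s] by (simp add: cross_def sum.distrib[symmetric])
qed

text \<open>Here the entry \<open>s\<close> stands behind the window, so that path order and layer order disagree, and \<open>upper_lower\<close>
resolves the ties the wrong way round. The corrections are jumps of \<open>steps\<close>. Since \<open>s\<close> and \<open>s + m\<close>
both lie below the generators of \<open>g\<close> in their classes, two of the sums of jumps are \<open>1\<close> and cancel, and the other two vanish.\<close>

lemma cross_after:
  assumes g: "gen_cycle g" and s: "[s = int m * int x] (mod int n)"
    and lt: "s < g x" "s + int m < g (x + 1)"
  shows "(\<Sum>y<n. upper (s - g y) - lower (s - g y)) + cross g s = int m"
proof -
  have "upper (s - g y) - lower (s - g y) + (gap_count (g y - s) + gap_count (s - g y - 1)) = carry (s - g y)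
      + ((steps (g y - s) - steps (g y - s - 1)) - (steps (g y - (s + int m)) - steps (g y - (s + int m) - 1)))
      - ((steps (s - g y) - steps (s - g y - 1)) - (steps ((s - int m) - g y) - steps ((s - int m) - g y - 1)))" for y
    using upper_lower[of "s - g y"] by (simp add: gap_count_def algebra_simps)
  then have "(\<Sum>y<n. upper (s - g y) - lower (s - g y)) + cross g s = (\<Sum>y<n. carry (s - g y))
      + ((\<Sum>y<n. steps (g y - s) - steps (g y - s - 1))
        - (\<Sum>y<n. steps (g y - (s + int m)) - steps (g y - (s + int m) - 1)))
      - ((\<Sum>y<n. steps (s - g y) - steps (s - g y - 1))
        - (\<Sum>y<n. steps ((s - int m) - g y) - steps ((s - int m) - g y - 1)))"
    unfolding cross_def sum.distrib[symmetric] sum_subtractf[symmetric] by simp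
  moreover have "(\<Sum>y<n. steps (g y - s) - steps (g y - s - 1)) = 1" using sum_jump(1)[OF g s] lt by simp
  moreover have "(\<Sum>y<n. steps (g y - (s + int m)) - steps (g y - (s + int m) - 1)) = 1"
  proof -
    have "[s + int m = int m * int (x + 1)] (mod int n)"
      using cong_add[OF s cong_refl[of "int m"]] by (simp add: algebra_simps)
    from sum_jump(1)[OF g this] lt show ?thesis by simp
  qed
  moreover have "(\<Sum>y<n. steps (s - g y) - steps (s - g y - 1)) = 0" using sum_jump(2)[OF g s] lt by simp
  moreover have "(\<Sum>y<n. steps ((s - int m) - g y) - steps ((s - int m) - g y - 1)) = 0"
  proof -
    have "[s - int m = int m * int (x + n - 1)] (mod int n)"
    proof -
      have "int m * int (x + n - 1) = int m * int x - int m + int m * int n"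
        using n_pos by (simp add: of_nat_diff algebra_simps)
      then show ?thesis using cong_diff[OF s cong_refl[of "int m"]] by (simp add: cong_def)
    qed
    from sum_jump(2)[OF g this]
    have "(\<Sum>y<n. steps ((s - int m) - g y) - steps ((s - int m) - g y - 1)) = (if g (x + n - 1) < s - int m then 1 else 0)" .
    moreover have "g (x + n - 1 + 1) \<le> g (x + n - 1) + int m" by (rule gen_cycleD(4)[OF g])
    then have "g x \<le> g (x + n - 1) + int m" using gen_cycleD(3)[OF g, of x] n_pos by simp
    ultimately show ?thesis using lt by simp
  qed
  ultimately show ?thesis using sum_carry(2)[OF g, of s] by simp
qed

lemma sum_square:
  fixes f :: "nat \<Rightarrow> nat \<Rightarrow> int"
  shows "(\<Sum>p\<in>{a..<a + k}. \<Sum>q\<in>{a..<a + k}. f p q)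
    = (\<Sum>p\<in>{a..<a + k}. \<Sum>q\<in>{a..<p}. f p q + f q p) + (\<Sum>p\<in>{a..<a + k}. f p p)"
  by (induction k) (simp_all add: sum.distrib)

definition floors :: "nat \<Rightarrow> int" where "floors k = (int m * int k) div int n"

text \<open>Two different generators of a cycle are never congruent, and each is at most \<open>m\<close> above its
predecessor, so within a cycle no ties have to be resolved. The carry of a pair depends only on the
distance of its positions, and telescopes.\<close>

lemma window_pairs:
  assumes g: "gen_cycle g"
  shows "(\<Sum>p\<in>{a..<a + n}. \<Sum>q\<in>{a..<p}. upper (g p - g q) - lower (g p - g q))
      + (\<Sum>i<n. \<Sum>j<n. gap_count (g j - g i)) = (\<Sum>p<n. floors (Suc p) - floors 1)"
proof -
  have per: "(\<Sum>x\<in>{a..<a + n}. F (g x)) = (\<Sum>x<n. F (g x))" for F :: "int \<Rightarrow> int"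
    by (rule sum_period) (simp add: gen_cycleD(3)[OF g])
  have pair: "upper (g p - g q) - lower (g p - g q) + (gap_count (g q - g p) + gap_count (g p - g q))
      = floors (Suc (p - q)) - floors (p - q)" if pq: "a \<le> q" "q < p" "p < a + n" for p q
  proof -
    have nd: "\<not> int n dvd g q - g p"
    proof
      assume "int n dvd g q - g p"
      then have "[g q = int m * int p] (mod int n)"
        using gen_cycleD(2)[OF g, of p] by (simp add: cong_iff_dvd_diff[symmetric] cong_def)
      then have "[q = p] (mod n)" using index_unique gen_cycleD(2)[OF g, of q] by blast
      then have "n dvd p - q" using pq cong_altdef_nat[of q p n] cong_sym[of q p n] by simp
      then have "n \<le> p - q" using pq by (intro dvd_imp_le) auto
      then show False using pq by simp
    qed
    have nd2: "g q - g p - int m < int n" if "int n dvd g q - g p - int m"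
    proof -
      have "[g q = g p + int m] (mod int n)" using that by (simp add: cong_iff_dvd_diff diff_diff_eq)
      moreover have "[g p + int m = int m * int (p + 1)] (mod int n)"
        using cong_add[OF gen_cycleD(2)[OF g, of p] cong_refl[of "int m"]] by (simp add: algebra_simps)
      ultimately have "[g q = int m * int (p + 1)] (mod int n)" by (simp add: cong_def)
      then have "[q = p + 1] (mod n)" using index_unique gen_cycleD(2)[OF g, of q] by blast
      then have "g q = g (p + 1)" by (rule gen_cycle_cong[OF g])
      then show ?thesis using gen_cycleD(4)[OF g, of p] n_pos by simp
    qed
    have "steps (g q - g p) = steps (g q - g p - 1)" using steps_jump[of "g q - g p"] nd by simp
    moreover have "steps (g q - g p - int m) = steps (g q - g p - 1 - int m)"
      using steps_jump[of "g q - g p - int m"] nd2 by (auto simp: algebra_simps split: if_splits)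
    ultimately have "gap_count (g q - g p) = gap_count (- (g p - g q) - 1)" by (simp add: gap_count_def)
    then have "upper (g p - g q) - lower (g p - g q) + (gap_count (g q - g p) + gap_count (g p - g q)) = carry (g p - g q)"
      using upper_lower[of "g p - g q"] by simp
    also have "\<dots> = carry (int m * int (p - q))"
    proof (rule carry_cong)
      show "[g p - g q = int m * int (p - q)] (mod int n)"
        using cong_diff[OF gen_cycleD(2)[OF g, of p] gen_cycleD(2)[OF g, of q]] pq
        by (simp add: of_nat_diff algebra_simps)
    qed
    also have "\<dots> = floors (Suc (p - q)) - floors (p - q)" by (simp add: carry_def floors_def algebra_simps)
    finally show ?thesis .
  qed
  have tel: "(\<Sum>q\<in>{a..<p}. floors (Suc (p - q)) - floors (p - q)) = floors (Suc (p - a)) - floors 1"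
    if "a \<le> p" for p
    using that
  proof (induction p rule: dec_induct)
    case (step p)
    have "(\<Sum>q\<in>{a..<Suc p}. floors (Suc (Suc p - q)) - floors (Suc p - q))
      = (\<Sum>q\<in>{Suc a..<Suc p}. floors (Suc (Suc p - q)) - floors (Suc p - q))
        + (floors (Suc (Suc p - a)) - floors (Suc p - a))"
      using step.hyps by (subst sum.atLeast_Suc_lessThan) auto
    also have "(\<Sum>q\<in>{Suc a..<Suc p}. floors (Suc (Suc p - q)) - floors (Suc p - q))
      = (\<Sum>q\<in>{a..<p}. floors (Suc (p - q)) - floors (p - q))"
      by (simp only: sum.shift_bounds_Suc_ivl diff_Suc_Suc)
    finally show ?case using step by (simp add: Suc_diff_le)
  qed simp
  have "(\<Sum>i<n. \<Sum>j<n. gap_count (g j - g i)) = (\<Sum>p\<in>{a..<a + n}. \<Sum>q\<in>{a..<a + n}. gap_count (g q - g p))"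
    unfolding per[of "\<lambda>s. gap_count (s - _)"] by (rule per[symmetric])
  also have "\<dots> = (\<Sum>p\<in>{a..<a + n}. \<Sum>q\<in>{a..<p}. gap_count (g q - g p) + gap_count (g p - g q))"
  proof -
    have "gap_count 0 = 0" using zdiv_mono1[of "- int m" 0 "int n"] n_pos by (simp add: gap_count_def steps_def)
    then show ?thesis by (simp add: sum_square)
  qed
  finally have taus: "(\<Sum>i<n. \<Sum>j<n. gap_count (g j - g i))
    = (\<Sum>p\<in>{a..<a + n}. \<Sum>q\<in>{a..<p}. gap_count (g q - g p) + gap_count (g p - g q))" .
  have "(\<Sum>p\<in>{a..<a + n}. \<Sum>q\<in>{a..<p}. upper (g p - g q) - lower (g p - g q)) + (\<Sum>i<n. \<Sum>j<n. gap_count (g j - g i))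
    = (\<Sum>p\<in>{a..<a + n}. \<Sum>q\<in>{a..<p}.
        upper (g p - g q) - lower (g p - g q) + (gap_count (g q - g p) + gap_count (g p - g q)))"
    unfolding taus by (simp only: sum.distrib)
  also have "\<dots> = (\<Sum>p\<in>{a..<a + n}. \<Sum>q\<in>{a..<p}. floors (Suc (p - q)) - floors (p - q))"
    using pair by (intro sum.cong refl) auto
  also have "\<dots> = (\<Sum>p\<in>{a..<a + n}. floors (Suc (p - a)) - floors 1)"
    using tel by (intro sum.cong) auto
  also have "\<dots> = (\<Sum>p<n. floors (Suc p) - floors 1)"
    using sum.shift_bounds_nat_ivl[of "\<lambda>p. floors (Suc (p - a)) - floors 1" 0 a n]
    by (simp add: atLeast0LessThan add.commute)
  finally show ?thesis .
qed

section \<open>The two statistics add up to a constant\<close>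

definition dinv_pairs :: "nat \<Rightarrow> (nat \<Rightarrow> int) \<Rightarrow> int" where
  "dinv_pairs k r = (\<Sum>p<k. \<Sum>q<p. upper (r p - r q) - lower (r p - r q))"

lemma dinv_pairs_split:
  assumes W: "rank_word (Suc (Suc u)) r"
  defines "p \<equiv> cut (Suc u) r" and "w \<equiv> del (Suc u) r" and "g \<equiv> window (Suc u) r"
  defines "f \<equiv> \<lambda>e. upper e - lower e"
  shows "dinv_pairs (Suc (Suc u) * n) r = dinv_pairs (Suc u * n) w
    + (\<Sum>x\<in>{p..<p + n}. \<Sum>y\<in>{p..<x}. f (g x - g y))
    + (\<Sum>x<p. \<Sum>y<n. f (g y - w x)) + (\<Sum>x\<in>{p..<Suc u * n}. \<Sum>y<n. f (w x - g y))"
proof -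
  let ?k = "Suc u * n"
  have p: "p \<le> ?k" unfolding p_def by (rule cut_le[OF W])
  have rw: "x < p \<Longrightarrow> r x = w x" "p \<le> x \<Longrightarrow> r (x + n) = w x" for x by (auto simp: w_def del_def p_def)
  have rg: "p \<le> x \<Longrightarrow> x < p + n \<Longrightarrow> r x = g x" for x by (simp add: g_def window_def wpos_id p_def)
  have gc: "gen_cycle g" unfolding g_def by (rule gen_cycle_window[OF W])
  have per: "(\<Sum>x\<in>{p..<p + n}. F (g x)) = (\<Sum>x<n. F (g x))" for F :: "int \<Rightarrow> int"
    by (rule sum_period) (simp add: gen_cycleD(3)[OF gc])
  have split: "sum F {..<x} = sum F {..<p} + sum F {p..<x}" if "p \<le> x" for F :: "nat \<Rightarrow> int" and x
    using sum.atLeastLessThan_concat[of 0 p x F] that by (simp add: atLeast0LessThan)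
  define h where "h x = (\<Sum>q<x. f (r x - r q))" for x
  have "dinv_pairs (Suc (Suc u) * n) r = sum h {..<?k + n}" by (simp add: dinv_pairs_def h_def f_def add.commute)
  also have "\<dots> = sum h {..<p} + sum h {p..<p + n} + (\<Sum>x\<in>{p..<?k}. h (x + n))"
    by (rule sum_split_block[OF p])
  also have "sum h {..<p} = (\<Sum>x<p. \<Sum>q<x. f (w x - w q))"
    unfolding h_def using rw(1) by (intro sum.cong refl) auto
  also have "sum h {p..<p + n} = (\<Sum>x\<in>{p..<p + n}. (\<Sum>q<p. f (g x - w q)) + (\<Sum>q\<in>{p..<x}. f (g x - g q)))"
  proof (rule sum.cong[OF refl])
    fix x assume x: "x \<in> {p..<p + n}"
    have "(\<Sum>q<p. f (r x - r q)) = (\<Sum>q<p. f (g x - w q))" using x rw(1) rg by (intro sum.cong) auto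
    moreover have "(\<Sum>q\<in>{p..<x}. f (r x - r q)) = (\<Sum>q\<in>{p..<x}. f (g x - g q))"
      using x rg by (intro sum.cong) auto
    ultimately show "h x = (\<Sum>q<p. f (g x - w q)) + (\<Sum>q\<in>{p..<x}. f (g x - g q))"
      using split[of x] x unfolding h_def by simp
  qed
  also have "\<dots> = (\<Sum>x<p. \<Sum>y<n. f (g y - w x)) + (\<Sum>x\<in>{p..<p + n}. \<Sum>y\<in>{p..<x}. f (g x - g y))"
  proof -
    have "(\<Sum>x\<in>{p..<p + n}. \<Sum>q<p. f (g x - w q)) = (\<Sum>q<p. \<Sum>x\<in>{p..<p + n}. f (g x - w q))"
      by (rule sum.swap)
    also have "\<dots> = (\<Sum>q<p. \<Sum>y<n. f (g y - w q))" by (intro sum.cong refl per)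
    finally show ?thesis by (simp add: sum.distrib)
  qed
  also have "(\<Sum>x\<in>{p..<?k}. h (x + n))
    = (\<Sum>x\<in>{p..<?k}. (\<Sum>y<n. f (w x - g y)) + (\<Sum>q<x. f (w x - w q)))"
  proof (rule sum.cong[OF refl])
    fix x assume x: "x \<in> {p..<?k}"
    have "h (x + n) = (\<Sum>q<x + n. f (w x - r q))" using x rw(2) by (simp add: h_def)
    also have "\<dots> = (\<Sum>q<p. f (w x - r q)) + (\<Sum>q\<in>{p..<p + n}. f (w x - r q))
        + (\<Sum>q\<in>{p..<x}. f (w x - r (q + n)))"
      using x by (intro sum_split_block) auto
    also have "(\<Sum>q<p. f (w x - r q)) = (\<Sum>q<p. f (w x - w q))" using rw(1) by (intro sum.cong) auto
    also have "(\<Sum>q\<in>{p..<p + n}. f (w x - r q)) = (\<Sum>q\<in>{p..<p + n}. f (w x - g q))"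
      using rg by (intro sum.cong) auto
    also have "\<dots> = (\<Sum>y<n. f (w x - g y))" by (rule per)
    also have "(\<Sum>q\<in>{p..<x}. f (w x - r (q + n))) = (\<Sum>q\<in>{p..<x}. f (w x - w q))"
      using rw(2) by (intro sum.cong) auto
    finally show "h (x + n) = (\<Sum>y<n. f (w x - g y)) + (\<Sum>q<x. f (w x - w q))"
      using split[of x] x by simp
  qed
  finally have "dinv_pairs (Suc (Suc u) * n) r = ((\<Sum>x<p. \<Sum>q<x. f (w x - w q)) + (\<Sum>x\<in>{p..<?k}. \<Sum>q<x. f (w x - w q)))
    + (\<Sum>x\<in>{p..<p + n}. \<Sum>y\<in>{p..<x}. f (g x - g y))
    + (\<Sum>x<p. \<Sum>y<n. f (g y - w x)) + (\<Sum>x\<in>{p..<?k}. \<Sum>y<n. f (w x - g y))"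
    by (simp add: sum.distrib)
  also have "(\<Sum>x<p. \<Sum>q<x. f (w x - w q)) + (\<Sum>x\<in>{p..<?k}. \<Sum>q<x. f (w x - w q)) = dinv_pairs ?k w"
    unfolding dinv_pairs_def f_def by (rule split[OF p, symmetric])
  finally show ?thesis .
qed

text \<open>The tie-breaking of \<open>level_le_iff\<close> enters as the shift by one.\<close>

definition dim_pairs :: "nat \<Rightarrow> (nat \<Rightarrow> nat \<Rightarrow> int) \<Rightarrow> int" where
  "dim_pairs d G = (\<Sum>i<d. \<Sum>j<n. \<Sum>i'<d. \<Sum>j'<n. gap_count (G i' j' - G i j - (if i \<le> i' then 0 else 1)))"

lemma dim_pairs_Suc:
  "dim_pairs (Suc k) G = dim_pairs k G + (\<Sum>i<k. \<Sum>j<n. cross (G k) (G i j)) + (\<Sum>i<n. \<Sum>j<n. gap_count (G k j - G k i))"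
proof -
  define t where "t i j i' j' = gap_count (G i' j' - G i j - (if i \<le> i' then 0 else 1))" for i j i' j'
  have D: "dim_pairs k G = (\<Sum>i<k. \<Sum>j<n. \<Sum>i'<k. \<Sum>j'<n. t i j i' j')" for k
    by (simp add: dim_pairs_def t_def)
  have "dim_pairs (Suc k) G = dim_pairs k G + (\<Sum>i<k. \<Sum>j<n. \<Sum>y<n. t i j k y)
      + (\<Sum>y<n. \<Sum>i<k. \<Sum>j<n. t k y i j) + (\<Sum>i<n. \<Sum>j<n. t k i k j)"
    by (simp add: D sum.distrib)
  also have "(\<Sum>y<n. \<Sum>i<k. \<Sum>j<n. t k y i j) = (\<Sum>i<k. \<Sum>j<n. \<Sum>y<n. t k y i j)"
    by (subst sum.swap, intro sum.cong refl sum.swap)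
  also have "(\<Sum>i<k. \<Sum>j<n. \<Sum>y<n. t i j k y) = (\<Sum>i<k. \<Sum>j<n. \<Sum>y<n. gap_count (G k y - G i j))"
    by (intro sum.cong refl) (simp add: t_def)
  also have "(\<Sum>i<k. \<Sum>j<n. \<Sum>y<n. t k y i j) = (\<Sum>i<k. \<Sum>j<n. \<Sum>y<n. gap_count (G i j - G k y - 1))"
    by (intro sum.cong refl) (simp add: t_def)
  finally show ?thesis by (simp add: t_def cross_def sum.distrib)
qed

text \<open>Adding the layer \<open>u\<close> to a word with \<open>u * n\<close> entries contributes \<open>m\<close> for each of these entries
and a constant for the pairs inside the window.\<close>

lemma pairs_total:
  assumes T: "tower d W"
  shows "u < d \<Longrightarrow> dinv_pairs (Suc u * n) (W u) + dim_pairs (Suc u) (cycles W)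
    = (\<Sum>i<Suc u. int m * int (i * n) + (\<Sum>p<n. floors (Suc p) - floors 1))"
proof (induction u)
  case 0
  let ?g = "cycles W 0"
  have g: "gen_cycle ?g" by (rule gen_cycle_cycles[OF T 0])
  have "dinv_pairs n (W 0) = (\<Sum>p\<in>{0..<0 + n}. \<Sum>q\<in>{0..<p}. upper (?g p - ?g q) - lower (?g p - ?g q))"
    unfolding dinv_pairs_def using cycles_0[OF T 0] by (auto intro!: sum.cong simp: atLeast0LessThan)
  then show ?case using window_pairs[OF g, of 0] by (simp add: dim_pairs_def)
next
  case (Suc u)
  let ?r = "W (Suc u)" and ?p = "cut (Suc u) (W (Suc u))" and ?w = "W u" and ?g = "cycles W (Suc u)"
  let ?k = "Suc u * n" and ?E = "\<Sum>p<n. floors (Suc p) - floors 1"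
  note R = tower_word[OF T Suc.prems]
  have w: "del (Suc u) ?r = ?w" "window (Suc u) ?r = ?g" using tower_del[OF T Suc.prems] by (auto simp: cycles_def)
  have g: "gen_cycle ?g" by (rule gen_cycle_cycles[OF T Suc.prems])
  have p: "?p \<le> ?k" by (rule cut_le[OF R])
  define f where "f e = upper e - lower e" for e
  have 1: "dinv_pairs (Suc (Suc u) * n) ?r = dinv_pairs ?k ?w + (\<Sum>x\<in>{?p..<?p + n}. \<Sum>y\<in>{?p..<x}. f (?g x - ?g y))
    + (\<Sum>x<?p. \<Sum>y<n. f (?g y - ?w x)) + (\<Sum>x\<in>{?p..<?k}. \<Sum>y<n. f (?w x - ?g y))"
    using dinv_pairs_split[OF R] unfolding w f_def .
  have 2: "dim_pairs (Suc (Suc u)) (cycles W) = dim_pairs (Suc u) (cycles W)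
      + (\<Sum>x<?k. cross ?g (?w x)) + (\<Sum>i<n. \<Sum>j<n. gap_count (?g j - ?g i))"
    using sum_tower[OF T, of u "cross ?g"] Suc.prems by (simp add: dim_pairs_Suc[of "Suc u"])
  have 3: "(\<Sum>x<?k. cross ?g (?w x)) = (\<Sum>x<?p. cross ?g (?w x)) + (\<Sum>x\<in>{?p..<?k}. cross ?g (?w x))"
    using sum.atLeastLessThan_concat[of 0 ?p ?k "\<lambda>x. cross ?g (?w x)"] p by (simp only: atLeast0LessThan)
  have 4: "(\<Sum>x<?p. \<Sum>y<n. f (?g y - ?w x)) + (\<Sum>x<?p. cross ?g (?w x)) = int m * int ?p"
    using cross_before[OF g] by (simp add: sum.distrib[symmetric] f_def)
  have 5: "(\<Sum>x\<in>{?p..<?k}. \<Sum>y<n. f (?w x - ?g y)) + (\<Sum>x\<in>{?p..<?k}. cross ?g (?w x)) = int m * (int ?k - int ?p)"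
  proof -
    have "(\<Sum>y<n. f (?w x - ?g y)) + cross ?g (?w x) = int m" if x: "x \<in> {?p..<?k}" for x
      unfolding f_def
    proof (rule cross_after[OF g])
      have wx: "?w x = ?r (x + n)" using x by (simp add: w(1)[symmetric] del_def)
      show "[?w x = int m * int x] (mod int n)" using x tower_word[OF T, of u] Suc.prems by (intro word_cong[of u]) auto
      have "?r (x + n) < ?r x" using x by (intro descent[OF R]) auto
      also have "\<dots> \<le> ?g x" using x unfolding w(2)[symmetric] by (intro word_le_window[OF R]) auto
      finally show "?w x < ?g x" using wx by simp
      have "?r (x + 1 + n - 1) + int m < ?r (x + 1)" using x by (intro after_cut[OF R]) auto
      also have "\<dots> \<le> ?g (x + 1)" using x n_gt unfolding w(2)[symmetric] by (intro word_le_window[OF R]) auto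
      finally show "?w x + int m < ?g (x + 1)" using wx by simp
    qed
    then show ?thesis using p by (simp add: sum.distrib[symmetric] of_nat_diff)
  qed
  have 6: "(\<Sum>x\<in>{?p..<?p + n}. \<Sum>y\<in>{?p..<x}. f (?g x - ?g y)) + (\<Sum>i<n. \<Sum>j<n. gap_count (?g j - ?g i)) = ?E"
    unfolding f_def by (rule window_pairs[OF g])
  have "dinv_pairs (Suc (Suc u) * n) ?r + dim_pairs (Suc (Suc u)) (cycles W)
      = (dinv_pairs ?k ?w + dim_pairs (Suc u) (cycles W)) + (int m * int ?k + ?E)"
    using 1 2 3 4 5 6 by (simp add: right_diff_distrib)
  also have "dinv_pairs ?k ?w + dim_pairs (Suc u) (cycles W) = (\<Sum>i<Suc u. int m * int (i * n) + ?E)"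
    using Suc by simp
  finally show ?case by (simp only: sum.lessThan_Suc)
qed

text \<open>The gaps behind \<open>a\<close> that are not behind \<open>a + d * m\<close> lie in \<open>{a..<a + d * m}\<close>; they are counted layer by
layer.\<close>

lemma dim_stat_modset:
  assumes C: "chain d G" and d: "0 < d"
  shows "dim_stat d n m (modset d G) = dim_pairs d G"
proof -
  let ?S = "modset d G"
  define a where "a = (\<lambda>(i, j). d * nat (G i j) + i)"
  have nn: "0 \<le> G i j" if "i < d" for i j by (rule gen_cycleD(1)[OF chain_cycle[OF C d that]])
  have "int ` generators (d * n) ?S = {int d * G i x + int i | i x. i < d \<and> x < n}"
    by (rule int_generators_modset[OF chain_cycle[OF C d] d])
  also have "\<dots> = int ` a ` ({..<d} \<times> {..<n})"
  proof -
    have "int (a (i, x)) = int d * G i x + int i" if "i < d" for i x using nn[OF that] by (simp add: a_def)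
    then have "int ` a ` ({..<d} \<times> {..<n}) = (\<lambda>(i, x). int d * G i x + int i) ` ({..<d} \<times> {..<n})"
      unfolding image_image by (intro image_cong) auto
    then show ?thesis by auto
  qed
  finally have gen: "generators (d * n) ?S = a ` ({..<d} \<times> {..<n})"
    by (simp add: inj_image_eq_iff)
  have inj: "inj_on a ({..<d} \<times> {..<n})"
  proof (rule inj_onI, clarify)
    fix i j i' j' assume ij: "i < d" "j < n" "i' < d" "j' < n" "a (i, j) = a (i', j')"
    have dm: "a (i, j) mod d = i" "a (i, j) div d = nat (G i j)" if "i < d" for i j using that by (simp_all add: a_def)
    then have e: "i = i'" "G i j = G i j'" using ij nn by (metis eq_nat_nat_iff)+
    have "[j = j'] (mod n)"
      using index_unique gen_cycleD(2)[OF chain_cycle[OF C d ij(1)], of j]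
        gen_cycleD(2)[OF chain_cycle[OF C d ij(1)], of j'] e(2) by metis
    then show "i = i' \<and> j = j'" using e ij by (simp add: cong_def)
  qed
  have fin: "finite (Gaps ?S b)" for b
  proof (rule finite_subset)
    show "Gaps ?S b \<subseteq> {..<d * (m * (d * n + n))}"
    proof
      fix t assume "t \<in> Gaps ?S b"
      then have "int (t div d) < int m * int (d * n + n)"
        using modset_above[OF C d, of t] by (force simp: Gaps_def)
      then have "t div d < m * (d * n + n)" unfolding of_nat_mult[symmetric] of_nat_less_iff .
      then show "t \<in> {..<d * (m * (d * n + n))}" using d by (simp add: div_less_iff_less_mult mult.commute)
    qed
  qed simp
  have "dim_stat d n m ?S = (\<Sum>b\<in>generators (d * n) ?S. int (card ({b..<b + d * m} - ?S)))"
    unfolding dim_stat_def sum_subtractf[symmetric]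
  proof (rule sum.cong[OF refl])
    fix b
    have "Gaps ?S b = ({b..<b + d * m} - ?S) \<union> Gaps ?S (b + d * m)" by (auto simp: Gaps_def)
    moreover have "({b..<b + d * m} - ?S) \<inter> Gaps ?S (b + d * m) = {}" by (auto simp: Gaps_def)
    ultimately have "card (Gaps ?S b) = card ({b..<b + d * m} - ?S) + card (Gaps ?S (b + d * m))"
      using fin by (metis card_Un_disjoint finite_Diff finite_atLeastLessThan)
    then show "int (card (Gaps ?S b)) - int (card (Gaps ?S (b + d * m))) = int (card ({b..<b + d * m} - ?S))" by simp
  qed
  also have "\<dots> = (\<Sum>ij\<in>{..<d} \<times> {..<n}. int (card ({a ij..<a ij + d * m} - ?S)))"
    unfolding gen by (simp add: sum.reindex[OF inj])
  also have "\<dots> = (\<Sum>i<d. \<Sum>j<n. int (card ({a (i, j)..<a (i, j) + d * m} - ?S)))"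
    by (simp add: sum.cartesian_product)
  also have "\<dots> = dim_pairs d G"
    unfolding dim_pairs_def
  proof (intro sum.cong[OF refl])
    fix i j assume i: "i \<in> {..<d}"
    define lo where "lo i' = G i j + (if i \<le> i' then 0 else 1)" for i'
    have "int (card ({a (i, j)..<a (i, j) + d * m} - ?S))
      = (\<Sum>i'<d. \<Sum>j'<n. steps (G i' j' - lo i') - steps (G i' j' - (lo i' + int m)))"
    proof (rule card_modset_gaps[OF chain_cycle[OF C d] d])
      fix i' q assume i': "i' < d"
      have a2: "a (i, j) + d * m = d * (nat (G i j) + m) + i" by (simp add: a_def algebra_simps)
      show "d * q + i' \<in> {a (i, j)..<a (i, j) + d * m} \<longleftrightarrow> lo i' \<le> int q \<and> int q < lo i' + int m"
        unfolding a2 atLeastLessThan_iff not_le[symmetric]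
        using level_le_iff[of i d i' "nat (G i j)" q] level_le_iff[of i d i' "nat (G i j) + m" q] i i' nn[of i j]
        by (auto simp: a_def lo_def)
    qed (use i nn in \<open>auto simp: lo_def\<close>)
    then show "int (card ({a (i, j)..<a (i, j) + d * m} - ?S))
      = (\<Sum>i'<d. \<Sum>j'<n. gap_count (G i' j' - G i j - (if i \<le> i' then 0 else 1)))"
      by (simp add: gap_count_def lo_def diff_diff_eq)
  qed
  finally show ?thesis .
qed

section \<open>The boxes counted by dinv\<close>

lemma Dyck_mono:
  assumes y: "y \<in> Dyck d n m" and "a \<le> b" "b < d * n" shows "y a \<le> y b"
  using assms(2,3)
proof (induction b rule: dec_induct)
  case (step b)
  then show ?case using DyckD(3)[OF y, of b] by simp
qed simp

text \<open>A box in column \<open>p\<close> and row \<open>b\<close> has arm length \<open>p - q\<close>, where \<open>q\<close> is the column in which the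
row \<open>b\<close> begins, that is \<open>y (q - 1) < b \<le> y q\<close>. In terms of the rank \<open>m * q - n * b\<close> at the beginning of
the row, the two inequalities say that it lies in \<open>{r p - n<..r p + m}\<close>. For fixed \<open>p\<close> and \<open>q\<close> such boxes
number \<open>upper (r p - r q) - lower (r p - r (q - 1))\<close>. Summation by parts collects the
terms with the same \<open>q\<close>; the boundary terms are \<open>upper 0\<close> for \<open>q = p\<close> and \<open>upper (r p)\<close> for \<open>q = 0\<close>, as \<open>r 0 = 0\<close>.\<close>

lemma int_dinv:
  assumes y: "y \<in> Dyck d n m" and d: "0 < d"
  defines "r \<equiv> \<lambda>x. int m * int x - int n * y x"
  shows "int (dinv d n m y) = (\<Sum>p<d * n. upper 0 - upper (r p)) + dinv_pairs (d * n) r"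
proof -
  \<comment> \<open>The rows that begin in column \<open>q\<close> and whose box in column \<open>p\<close> is counted by \<open>dinv\<close>.\<close>
  define B where "B p q = {b. y (q - 1) < b \<and> b \<le> y q
    \<and> int m * int q - r p - int m \<le> int n * b \<and> int n * b < int m * int q - r p + int n}" for p q :: nat
  have dn: "0 < d * n" using d n_pos by simp
  have r0: "r 0 = 0" using rank_word_Dyck[OF y d] unfolding rank_word_def r_def by blast
  then have y0: "y 0 = 0" using n_pos by (simp add: r_def)
  note mono = Dyck_mono[OF y]
  define Z where "Z = {z \<in> boxes d n y.
     real_of_int (leg y z) / (real (arm d n y z) + 1) \<le> real m / real n \<and>
     (arm d n y z = 0 \<or> real m / real n < (real_of_int (leg y z) + 1) / real (arm d n y z))}"
  have arm: "arm d n y (int p, b) = p - q"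
    if p: "p < d * n" and q: "1 \<le> q" "q \<le> p" and b: "y (q - 1) < b" "b \<le> y q" for p q b
  proof -
    have "{x. x < int p \<and> (x, b) \<in> boxes d n y} = int ` {q..<p}"
    proof (intro set_eqI iffI)
      fix x assume x: "x \<in> {x. x < int p \<and> (x, b) \<in> boxes d n y}"
      then have "b \<le> y (nat x)" "0 \<le> x" "nat x < p" by (auto simp: boxes_def)
      moreover have "\<not> nat x \<le> q - 1"
      proof
        assume "nat x \<le> q - 1"
        moreover have "q - 1 < d * n" using p q by linarith
        ultimately have "y (nat x) \<le> y (q - 1)" by (rule mono)
        then show False using b(1) \<open>b \<le> y (nat x)\<close> by simp
      qed
      ultimately show "x \<in> int ` {q..<p}" by (intro image_eqI[of _ _ "nat x"]) auto
    next
      fix x assume "x \<in> int ` {q..<p}"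
      then obtain k where k: "x = int k" "q \<le> k" "k < p" by auto
      moreover have "q - 1 < d * n" using p q by linarith
      then have "1 \<le> b" using DyckD(1)[OF y, of "q - 1"] b(1) by simp
      moreover have "b \<le> y k" using mono[of q k] k p b(2) by simp
      moreover have "int k < int (d * n)" using k p by linarith
      ultimately show "x \<in> {x. x < int p \<and> (x, b) \<in> boxes d n y}" by (auto simp: boxes_def)
    qed
    then show ?thesis by (simp add: arm_def card_image)
  qed
  have cond: "(real_of_int (leg y (int p, b)) / (real (arm d n y (int p, b)) + 1) \<le> real m / real n \<and>
     (arm d n y (int p, b) = 0 \<or> real m / real n < (real_of_int (leg y (int p, b)) + 1) / real (arm d n y (int p, b))))
    \<longleftrightarrow> int m * int q - r p - int m \<le> int n * b \<and> int n * b < int m * int q - r p + int n"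
    if p: "p < d * n" and q: "1 \<le> q" "q \<le> p" and b: "y (q - 1) < b" "b \<le> y q" for p q b
  proof -
    define l where "l = y p - b"
    define a where "a = p - q"
    have al: "arm d n y (int p, b) = a" "leg y (int p, b) = l"
      using arm[OF that] by (auto simp: a_def l_def leg_def)
    have "0 \<le> l" using mono[of q p] p q b by (simp add: l_def)
    have rn: "0 < real n" using n_pos by simp
    have "real_of_int l / (real a + 1) \<le> real m / real n \<longleftrightarrow> real_of_int l * real n \<le> real m * (real a + 1)"
      using rn by (simp add: divide_le_eq le_divide_eq pos_divide_le_eq pos_le_divide_eq field_simps)
    also have "\<dots> \<longleftrightarrow> real_of_int (l * int n) \<le> real_of_int (int m * (int a + 1))" by simp
    also have "\<dots> \<longleftrightarrow> l * int n \<le> int m * (int a + 1)" by (rule of_int_le_iff)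
    also have "\<dots> \<longleftrightarrow> int m * int q - r p - int m \<le> int n * b"
      using q by (simp add: l_def a_def r_def of_nat_diff algebra_simps)
    finally have 1: "real_of_int l / (real a + 1) \<le> real m / real n \<longleftrightarrow> int m * int q - r p - int m \<le> int n * b" .
    have "(a = 0 \<or> real m / real n < (real_of_int l + 1) / real a) \<longleftrightarrow> int m * int a < (l + 1) * int n"
    proof (cases "a = 0")
      case True then show ?thesis using \<open>0 \<le> l\<close> n_pos by simp
    next
      case False
      then have "real m / real n < (real_of_int l + 1) / real a \<longleftrightarrow> real m * real a < (real_of_int l + 1) * real n"
        using rn by (simp add: field_simps)
      also have "\<dots> \<longleftrightarrow> real_of_int (int m * int a) < real_of_int ((l + 1) * int n)" by simp
      also have "\<dots> \<longleftrightarrow> int m * int a < (l + 1) * int n" by (rule of_int_less_iff)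
      finally show ?thesis using False by simp
    qed
    also have "\<dots> \<longleftrightarrow> int n * b < int m * int q - r p + int n"
      using q by (simp add: l_def a_def r_def of_nat_diff algebra_simps)
    finally show ?thesis using 1 unfolding al by blast
  qed
  let ?D = "SIGMA p:{..<d * n}. SIGMA q:{1..p}. B p q"
  have "Z = (\<lambda>(p, q, b). (int p, b)) ` ?D"
  proof (intro set_eqI iffI)
    fix z assume z: "z \<in> Z"
    obtain x b where xb: "z = (x, b)" by force
    define p where "p = nat x"
    have zb: "(x, b) \<in> boxes d n y" using z unfolding xb Z_def by blast
    then have "0 \<le> x" "x < int (d * n)" "1 \<le> b" "b \<le> y (nat x)" unfolding boxes_def by auto
    then have x: "z = (int p, b)" "p < d * n" "1 \<le> b" "b \<le> y p"
      by (simp_all add: xb p_def nat_less_iff del: of_nat_mult)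
    define q where "q = (LEAST k. b \<le> y k)"
    have q: "b \<le> y q" "q \<le> p" unfolding q_def by (rule LeastI[of _ p], rule x(4)) (rule Least_le, rule x(4))
    have "q \<noteq> 0"
    proof
      assume "q = 0"
      then show False using q(1) x(3) y0 by simp
    qed
    then have q1: "1 \<le> q" "y (q - 1) < b" using not_less_Least[of "q - 1" "\<lambda>k. b \<le> y k"] by (auto simp: q_def[symmetric])
    have "b \<in> B p q" using cond[OF x(2) q1(1) q(2) q1(2) q(1)] z q q1 unfolding x(1) Z_def B_def by blast
    then show "z \<in> (\<lambda>(p, q, b). (int p, b)) ` ?D" using x q q1 by (intro image_eqI[of _ _ "(p, q, b)"]) auto
  next
    fix z assume "z \<in> (\<lambda>(p, q, b). (int p, b)) ` ?D"
    then obtain p q b where z: "z = (int p, b)" "p < d * n" "1 \<le> q" "q \<le> p" "b \<in> B p q" by auto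
    then have b: "y (q - 1) < b" "b \<le> y q" by (auto simp: B_def)
    have "q - 1 < d * n" using z by linarith
    then have "1 \<le> b" using DyckD(1)[OF y, of "q - 1"] b(1) by simp
    moreover have "b \<le> y p" using mono[of q p] z b(2) by simp
    moreover have "int p < int (d * n)" using z(2) by linarith
    ultimately have "z \<in> boxes d n y" using z(1) by (auto simp: boxes_def)
    then show "z \<in> Z" using cond[OF z(2,3,4) b] z(5) unfolding z(1) Z_def B_def by blast
  qed
  moreover have "inj_on (\<lambda>(p, q, b). (int p, b)) ?D"
  proof -
    have "\<not> q < q'" if "p < d * n" "1 \<le> q" "q \<le> p" "q' \<le> p" "b \<in> B p q" "b \<in> B p q'" for p q q' :: nat and b
    proof
      assume "q < q'"
      then have "y q \<le> y (q' - 1)" using that by (intro mono) auto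
      then show False using that(5,6) by (simp add: B_def)
    qed
    then show ?thesis unfolding inj_on_def by (auto; metis linorder_neqE_nat)
  qed
  ultimately have "card Z = card ?D" by (simp add: card_image)
  moreover have fB: "finite (B p q)" for p q by (rule finite_subset[of _ "{y (q - 1)..y q}"]) (auto simp: B_def)
  ultimately have "int (card Z) = (\<Sum>p<d * n. \<Sum>q\<in>{1..p}. int (card (B p q)))"
    by (simp add: card_SigmaI)
  also have "\<dots> = (\<Sum>p<d * n. \<Sum>q\<in>{1..p}. upper (r p - r q) - lower (r p - r (q - 1)))"
  proof (intro sum.cong refl)
    fix p q assume p: "p \<in> {..<d * n}" and q: "q \<in> {1..p}"
    define lo where "lo = int m * int q - r p - int m"
    define hi where "hi = int m * int q - r p + int n"
    have le: "lo \<le> hi" by (simp add: lo_def hi_def)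
    define A where "A Y = {b::int. b \<le> Y \<and> lo \<le> int n * b \<and> int n * b < hi}" for Y
    note cA = card_multiples[OF le, folded A_def]
    have yle: "y (q - 1) \<le> y q" using mono[of "q - 1" q] p q by simp
    have "B p q = A (y q) - A (y (q - 1))" "A (y (q - 1)) \<subseteq> A (y q)"
      using yle by (auto simp: A_def B_def lo_def hi_def)
    then have "int (card (B p q)) = int (card (A (y q))) - int (card (A (y (q - 1))))"
      using cA(1) by (simp add: card_Diff_subset card_mono of_nat_diff)
    moreover have "int (card (A (y q))) = upper (r p - r q)"
      unfolding cA(2) upper_def by (simp add: lo_def hi_def r_def algebra_simps)
    moreover have "int (card (A (y (q - 1)))) = lower (r p - r (q - 1))"
      unfolding cA(2) lower_def using q by (simp add: lo_def hi_def r_def of_nat_diff algebra_simps)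
    ultimately show "int (card (B p q)) = upper (r p - r q) - lower (r p - r (q - 1))" by simp
  qed
  also have "\<dots> = (\<Sum>p<d * n. (upper 0 - upper (r p)) + (\<Sum>q<p. upper (r p - r q) - lower (r p - r q)))"
  proof (rule sum.cong[OF refl])
    fix p
    have "(\<Sum>q\<in>{1..p}. upper (r p - r q) - lower (r p - r (q - 1)))
        = (\<Sum>q<p. upper (r p - r (Suc q)) - lower (r p - r q))"
      by (rule sum.reindex_bij_witness[of _ Suc "\<lambda>q. q - 1"]) auto
    also have "\<dots> = (\<Sum>q<p. (upper (r p - r (Suc q)) - upper (r p - r q)) + (upper (r p - r q) - lower (r p - r q)))"
      by (intro sum.cong) auto
    also have "\<dots> = (\<Sum>q<p. upper (r p - r (Suc q)) - upper (r p - r q)) + (\<Sum>q<p. upper (r p - r q) - lower (r p - r q))"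
      by (rule sum.distrib)
    also have "(\<Sum>q<p. upper (r p - r (Suc q)) - upper (r p - r q)) = upper (r p - r p) - upper (r p - r 0)"
      by (rule sum_lessThan_telescope)
    finally show "(\<Sum>q\<in>{1..p}. upper (r p - r q) - lower (r p - r (q - 1)))
      = (upper 0 - upper (r p)) + (\<Sum>q<p. upper (r p - r q) - lower (r p - r q))" using r0 by simp
  qed
  finally show ?thesis unfolding dinv_def Z_def[symmetric] by (simp add: sum.distrib dinv_pairs_def)
qed

text \<open>The boundary terms of \<open>int_dinv\<close> contribute \<open>n * floors 1 - m\<close> for each layer, which cancels the excess of
the constant in \<open>pairs_total\<close> over the row sums of \<open>abound\<close>.\<close>

lemma dim_stat_PsiSet:
  assumes y: "y \<in> Dyck d n m" and d: "0 < d"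
  shows "dim_stat d n m (PsiSet d n m y) = codinv d n m y"
proof -
  let ?G = "cycles (stage d y)"
  define r where "r x = int m * int x - int n * y x" for x
  note T = tower_stage[OF y d]
  have r: "stage d y (d - 1) = r" unfolding stage_last[OF d] r_def ..
  have sd: "Suc (d - 1) = d" "d - 1 < d" using d by auto
  have W: "rank_word d r" using rank_word_Dyck[OF y d] unfolding r_def .
  have fl1: "(int m + int n) div int n = floors 1 + 1" using n_pos by (simp add: floors_def)
  have "upper (r p) = carry (r p) + 1" if "p < d * n" for p
  proof -
    have "0 \<le> r p" using W that unfolding rank_word_def by blast
    then have "upper (r p) = (r p + int m + int n) div int n - r p div int n"
      using n_pos by (simp add: upper_def steps_def pos_imp_zdiv_nonneg_iff)
    then show ?thesis using n_pos by (simp add: carry_def)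
  qed
  have "(\<Sum>p<d * n. upper 0 - upper (r p)) = (\<Sum>p<d * n. floors 1 - carry (r p))"
  proof -
    have "0 \<le> floors 1" using n_pos by (simp add: floors_def pos_imp_zdiv_nonneg_iff)
    then have "upper 0 = floors 1 + 1" using fl1 by (simp add: upper_def steps_def)
    with \<open>\<And>p. p < d * n \<Longrightarrow> upper (r p) = carry (r p) + 1\<close> show ?thesis by simp
  qed
  also have "\<dots> = int (d * n) * floors 1 - (\<Sum>p<d * n. carry (r p))" by (simp add: sum_subtractf)
  also have "(\<Sum>p<d * n. carry (r p)) = (\<Sum>i<d. \<Sum>j<n. carry (?G i j))"
    using sum_tower[OF T sd(2), of carry] unfolding r sd .
  also have "\<dots> = int d * int m"
    using sum_carry(1)[OF gen_cycle_cycles[OF T], of _ 0] by simp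
  finally have 1: "int (dinv d n m y) = int d * (int n * floors 1) - int d * int m + dinv_pairs (d * n) r"
    using int_dinv[OF y d] unfolding r_def by simp
  have 2: "dinv_pairs (d * n) r + dim_pairs d ?G
      = (\<Sum>i<d. int m * int (i * n) + (\<Sum>p<n. floors (Suc p) - floors 1))"
    using pairs_total[OF T sd(2)] unfolding r sd .
  have fl: "(\<Sum>p<n. floors (Suc p) - floors 1) = (\<Sum>j<n. floors j) + int m - int n * floors 1"
  proof -
    have "(\<Sum>p<n. floors (Suc p)) - (\<Sum>p<n. floors p) = floors n - floors 0"
      unfolding sum_subtractf[symmetric] by (rule sum_lessThan_telescope)
    moreover have "floors n = int m" "floors 0 = 0" using n_pos by (auto simp: floors_def)
    ultimately show ?thesis by (simp add: sum_subtractf)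
  qed
  have "int (abound n m i j) = int m * int i + floors j" for i j
    by (simp add: abound_def floors_def zdiv_int mult.commute)
  then have 3: "int (delta (Gamma d n m)) = (\<Sum>i<d. int m * int (i * n)) + int d * (\<Sum>j<n. floors j)"
    unfolding delta_Gamma[OF d] by (simp add: sum.distrib algebra_simps)
  have "dinv_pairs (d * n) r + dim_pairs d ?G
      = (\<Sum>i<d. int m * int (i * n)) + int d * ((\<Sum>j<n. floors j) + int m - int n * floors 1)"
    unfolding 2 fl sum.distrib by simp
  then have "dim_pairs d ?G = int (delta (Gamma d n m)) - int (dinv d n m y)"
    unfolding 1 3 by (simp only: right_diff_distrib distrib_left)
  then show ?thesis
    unfolding PsiSet_eq[OF y d] dim_stat_modset[OF chain_cycles[OF T d] d] codinv_def .
qed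

section \<open>The enhanced rank\<close>

lemma real_le_slope_iff: "real_of_int b \<le> real m / real n * real_of_int x \<longleftrightarrow> int n * b \<le> int m * x"
proof -
  have "real_of_int b \<le> real m / real n * real_of_int x \<longleftrightarrow> real n * real_of_int b \<le> real m * real_of_int x"
    using n_pos by (simp add: field_simps)
  also have "\<dots> \<longleftrightarrow> real_of_int (int n * b) \<le> real_of_int (int m * x)" by simp
  also have "\<dots> \<longleftrightarrow> int n * b \<le> int m * x" by (rule of_int_le_iff)
  finally show ?thesis .
qed

lemma mem_Rplusbar:
  "(int x, b) \<in> Rplusbar d n m \<longleftrightarrow> x < d * n \<and> int n * b \<le> int m * int x"
proof -
  have "int x \<le> int (d * n) - 1 \<longleftrightarrow> x < d * n" by linarith
  then show ?thesis unfolding Rplusbar_def real_le_slope_iff by simp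
qed

lemma Rplusbar_cases:
  assumes "z \<in> Rplusbar d n m"
  obtains x b where "z = (int x, b)" "x < d * n" "int n * b \<le> int m * int x"
proof -
  obtain x' b where z: "z = (x', b)" by force
  then have "0 \<le> x'" using assms by (auto simp: Rplusbar_def)
  then obtain x where "x' = int x" by (metis nonneg_int_cases)
  then show ?thesis using that[of x b] z assms mem_Rplusbar by blast
qed

context
  fixes d y
  assumes y: "y \<in> Dyck d n m" and d: "0 < d"
begin

text \<open>The layer to which the rank in column \<open>x\<close> belongs.\<close>

abbreviation (input) level :: "nat \<Rightarrow> nat" where
  "level x \<equiv> inv (sperm d n m y (x mod n)) (x div n)"

lemma sperm_perm: "sperm d n m y (x mod n) permutes {..<d}"
  using sperm_permutes[OF y d, of "x mod n"] n_pos by simp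

lemma level_less: "x < d * n \<Longrightarrow> level x < d"
proof -
  assume "x < d * n"
  then have "x div n < d" by (rule less_mult_imp_div_less)
  then show ?thesis using permutes_in_image[OF permutes_inv[OF sperm_perm[of x]], of "x div n"] by simp
qed

lemma sperm_level: "sperm d n m y (x mod n) (level x) = x div n"
  by (rule permutes_inverses(1)[OF sperm_perm])

lemma rkhat_eq: "rkhat d n m y (int x, b) = int d * (int m * int x - int n * b) + int (level x)"
  by (simp add: rkhat_def rk_def)

lemma cycles_level: "x < d * n \<Longrightarrow> cycles (stage d y) (level x) x = int m * int x - int n * y x"
proof -
  assume x: "x < d * n"
  have g: "gen_cycle (cycles (stage d y) (level x))"
    by (rule gen_cycle_cycles[OF tower_stage[OF y d] level_less[OF x]])
  have "x mod n < n" using n_pos by simp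
  from cycles_sperm[OF y d this level_less[OF x]] show ?thesis
    unfolding sperm_level gen_cycle_mod[OF g] by simp
qed

lemma rkhat_nat:
  assumes "x < d * n" "int n * b \<le> int m * int x"
  shows "rkhat d n m y (int x, b) = int (d * nat (int m * int x - int n * b) + level x)"
  using assms by (simp add: rkhat_eq)

lemma floor_rkhat:
  assumes "z \<in> Rplusbar d n m"
  shows "\<lfloor>real_of_int (rkhat d n m y z) / real d\<rfloor> = rk n m z"
proof -
  from assms obtain x b where z: "z = (int x, b)" "x < d * n" by (rule Rplusbar_cases)
  have "\<lfloor>real_of_int (rkhat d n m y z) / real d\<rfloor> = rkhat d n m y z div int d"
    by (metis floor_divide_of_int_eq of_int_of_nat_eq)
  also have "\<dots> = rk n m z"
    using level_less[OF z(2)] d unfolding z(1) rkhat_eq by (simp add: rk_def)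
  finally show ?thesis .
qed

text \<open>In a column, ranks decrease with the height, and the top of the path has the rank of the generator.\<close>

lemma rkhat_mem_PsiSet:
  assumes "x < d * n" "int n * b \<le> int m * int x"
  shows "rkhat d n m y (int x, b) \<in> int ` PsiSet d n m y \<longleftrightarrow> b \<le> y x"
proof -
  let ?q = "int m * int x - int n * b"
  have g: "gen_cycle (cycles (stage d y) (level x))"
    by (rule gen_cycle_cycles[OF tower_stage[OF y d] level_less[OF assms(1)]])
  have c: "[?q = int m * int x] (mod int n)" by (simp add: cong_iff_dvd_diff)
  have "rkhat d n m y (int x, b) \<in> int ` PsiSet d n m y
      \<longleftrightarrow> d * nat ?q + level x \<in> modset d (cycles (stage d y))"
    unfolding rkhat_nat[OF assms] PsiSet_eq[OF y d] by (simp only: inj_image_mem_iff[OF inj_of_nat])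
  also have "\<dots> \<longleftrightarrow> ?q \<in> module_of (cycles (stage d y) (level x))"
    unfolding mem_modset[OF level_less[OF assms(1)]] using assms(2) by simp
  also have "\<dots> \<longleftrightarrow> int m * int x - int n * y x \<le> ?q"
    unfolding mem_module_iff[OF g c] cycles_level[OF assms(1)] ..
  also have "\<dots> \<longleftrightarrow> b \<le> y x" using n_pos by simp
  finally show ?thesis .
qed

text \<open>Quotient and remainder of \<open>rkhat\<close> modulo \<open>d\<close> are the rank and the layer. The rank determines the class of the
column modulo \<open>n\<close>, the layer then determines the column, and rank and column determine the height.\<close>

lemma bij_rkhat: "bij_betw (rkhat d n m y) (Rplusbar d n m) (range int)"
  unfolding bij_betw_def
proof
  show "inj_on (rkhat d n m y) (Rplusbar d n m)"
  proof (rule inj_onI)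
    fix z z' assume zz: "z \<in> Rplusbar d n m" "z' \<in> Rplusbar d n m" "rkhat d n m y z = rkhat d n m y z'"
    obtain x b where z: "z = (int x, b)" "x < d * n" "int n * b \<le> int m * int x"
      using zz(1) by (rule Rplusbar_cases)
    obtain x' b' where z': "z' = (int x', b')" "x' < d * n" "int n * b' \<le> int m * int x'"
      using zz(2) by (rule Rplusbar_cases)
    let ?q = "int m * int x - int n * b" and ?q' = "int m * int x' - int n * b'"
    have q: "?q = ?q'" using floor_rkhat[OF zz(1)] floor_rkhat[OF zz(2)] zz(3) z(1) z'(1) by (simp add: rk_def)
    then have lv: "level x = level x'" using zz(3) unfolding z(1) z'(1) rkhat_eq by simp
    have "[?q = int m * int x] (mod int n)" "[?q' = int m * int x'] (mod int n)"
      by (simp_all add: cong_iff_dvd_diff)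
    then have "[x = x'] (mod n)" unfolding q by (rule index_unique)
    then have md: "x mod n = x' mod n" by (simp add: cong_def)
    have dv: "x div n = x' div n"
      using sperm_level[of x] sperm_level[of x'] unfolding lv unfolding md by (rule trans[OF sym])
    have "x = x div n * n + x mod n" by simp
    also have "\<dots> = x'" unfolding dv md by simp
    finally have x: "x = x'" .
    then have "int n * b = int n * b'" using q by simp
    then have "b = b'" using n_pos by simp
    then show "z = z'" unfolding z(1) z'(1) x by simp
  qed
  show "rkhat d n m y ` Rplusbar d n m = range int"
  proof (intro equalityI subsetI)
    fix t assume "t \<in> rkhat d n m y ` Rplusbar d n m"
    then obtain z where z: "z \<in> Rplusbar d n m" "t = rkhat d n m y z" by blast
    from z(1) obtain x b where x: "z = (int x, b)" "x < d * n" "int n * b \<le> int m * int x" by (rule Rplusbar_cases)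
    show "t \<in> range int" unfolding z(2) x(1) rkhat_nat[OF x(2,3)] by blast
  next
    fix t assume "t \<in> range int"
    then obtain k where k: "t = int k" by blast
    let ?q = "int (k div d)" and ?i = "k mod d"
    obtain j where j: "j < n" "[?q = int m * int j] (mod int n)" using ex_index by blast
    have P: "sperm d n m y j permutes {..<d}" by (rule sperm_permutes[OF y d j(1)])
    define x where "x = sperm d n m y j ?i * n + j"
    have xd: "x div n = sperm d n m y j ?i" "x mod n = j" using j(1) by (simp_all add: x_def)
    have "sperm d n m y j ?i < d" using permutes_in_image[OF P, of ?i] d by simp
    then have "(sperm d n m y j ?i + 1) * n \<le> d * n" by (intro mult_right_mono) auto
    then have xl: "x < d * n" using j(1) by (simp add: x_def)
    have lv: "level x = ?i" unfolding xd by (rule permutes_inverses(2)[OF P])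
    have "[int m * int j = int m * int x] (mod int n)" unfolding cong_m_iff by (simp add: x_def cong_def)
    then have "[int m * int x = ?q] (mod int n)" using j(2) by (simp add: cong_def)
    then have "int n dvd int m * int x - ?q" by (simp add: cong_iff_dvd_diff)
    then obtain b where b: "int m * int x - ?q = int n * b" by blast
    then have q: "int m * int x - int n * b = ?q" by simp
    have "(int x, b) \<in> Rplusbar d n m" unfolding mem_Rplusbar using xl q by simp
    moreover have "rkhat d n m y (int x, b) = t"
      unfolding rkhat_eq q lv k by (metis mult_div_mod_eq of_nat_add of_nat_mult)
    ultimately show "t \<in> rkhat d n m y ` Rplusbar d n m" by blast
  qed
qed

lemma rkhat_image_gaps:
  "rkhat d n m y ` (Rplus d n m - boxes d n y) = int ` (UNIV - PsiSet d n m y)"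
proof -
  have Rp: "(int x, b) \<in> Rplus d n m \<longleftrightarrow> (int x, b) \<in> Rplusbar d n m \<and> 1 \<le> b" for x b
    by (auto simp: Rplus_def Rplusbar_def)
  have bx: "(int x, b) \<in> boxes d n y \<longleftrightarrow> 1 \<le> b \<and> b \<le> y x" if "x < d * n" for x b
  proof -
    have "int x \<le> int (d * n) - 1" using that by linarith
    then show ?thesis unfolding boxes_def by simp
  qed
  have sub: "Rplus d n m \<subseteq> Rplusbar d n m" by (auto simp: Rplus_def Rplusbar_def)
  have "Rplus d n m - boxes d n y = {z \<in> Rplusbar d n m. rkhat d n m y z \<notin> int ` PsiSet d n m y}"
  proof (intro set_eqI iffI)
    fix z assume z: "z \<in> Rplus d n m - boxes d n y"
    then have "z \<in> Rplusbar d n m" using sub by blast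
    then obtain x b where x: "z = (int x, b)" "x < d * n" "int n * b \<le> int m * int x" by (rule Rplusbar_cases)
    then have "\<not> b \<le> y x" using z Rp bx by blast
    then show "z \<in> {z \<in> Rplusbar d n m. rkhat d n m y z \<notin> int ` PsiSet d n m y}"
      using x rkhat_mem_PsiSet mem_Rplusbar by blast
  next
    fix z assume z: "z \<in> {z \<in> Rplusbar d n m. rkhat d n m y z \<notin> int ` PsiSet d n m y}"
    then have "z \<in> Rplusbar d n m" by blast
    then obtain x b where x: "z = (int x, b)" "x < d * n" "int n * b \<le> int m * int x" by (rule Rplusbar_cases)
    then have "y x < b" using z rkhat_mem_PsiSet[OF x(2,3)] by simp
    then have "1 \<le> b" using DyckD(1)[OF y x(2)] by simp
    then show "z \<in> Rplus d n m - boxes d n y"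
      using z x(1) Rp bx[OF x(2)] \<open>y x < b\<close> by auto
  qed
  moreover have "rkhat d n m y ` {z \<in> Rplusbar d n m. rkhat d n m y z \<notin> int ` PsiSet d n m y}
      = rkhat d n m y ` Rplusbar d n m - int ` PsiSet d n m y" by auto
  moreover have "rkhat d n m y ` Rplusbar d n m = range int" using bij_rkhat by (simp add: bij_betw_def)
  ultimately show ?thesis by (simp add: image_set_diff)
qed

end

end

theorem theorem3p22:
  fixes d n m :: nat
  assumes "d \<ge> 1" and "m > n" and "n > 1" and "coprime m n"
  shows
    "(\<forall>y\<in>Dyck d n m.
        (\<forall>u\<in>{1..d - 1}. pset d n m y u \<noteq> {}) \<and>
        (d \<ge> 2 \<longrightarrow>
           0 < pidx d n m y 1 \<and>
           (\<forall>u\<in>{1..<d - 1}. pidx d n m y u < pidx d n m y (u + 1)) \<and>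
           pidx d n m y (d - 1) \<le> (d - 1) * n)) \<and>
     bij_betw (PsiSet d n m) (Dyck d n m) (Adm d n m) \<and>
     (\<forall>y\<in>Dyck d n m.
        represents d n m (PsiSet d n m y) (Psi d n m y) \<and>
        e_stat d n m (PsiSet d n m y) = matrix_sum d n (Psi d n m y) \<and>
        matrix_sum d n (Psi d n m y) = path_size d n y \<and>
        dim_stat d n m (PsiSet d n m y) = codinv d n m y) \<and>
     (\<forall>y\<in>Dyck d n m.
        bij_betw (rkhat d n m y) (Rplusbar d n m) (range int) \<and>
        (\<forall>z\<in>Rplusbar d n m. \<lfloor>real_of_int (rkhat d n m y z) / real d\<rfloor> = rk n m z) \<and>
        rkhat d n m y ` (Rplus d n m - boxes d n y) = int ` (UNIV - PsiSet d n m y))"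
proof -
  interpret slope n m using assms by unfold_locales auto
  have d: "0 < d" using assms(1) by simp
  show ?thesis
  proof (intro conjI ballI impI)
    fix y assume y: "y \<in> Dyck d n m"
    note p = cut_stage_props[OF y d]
    show "pset d n m y u \<noteq> {}" if "u \<in> {1..d - 1}" for u using that d by (intro p(1)) auto
    show "0 < pidx d n m y 1" if "2 \<le> d" using that by (intro p(2)) auto
    show "pidx d n m y u < pidx d n m y (u + 1)" if "2 \<le> d" "u \<in> {1..<d - 1}" for u
      using that by (intro p(3)) auto
    show "pidx d n m y (d - 1) \<le> (d - 1) * n" if "2 \<le> d" using d by (intro p(4)) auto
    show "represents d n m (PsiSet d n m y) (Psi d n m y)" by (rule represents_PsiSet[OF y d])
    show "e_stat d n m (PsiSet d n m y) = matrix_sum d n (Psi d n m y)" by (rule e_stat_PsiSet[OF y d])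
    show "matrix_sum d n (Psi d n m y) = path_size d n y" by (rule matrix_sum_Psi[OF y d])
    show "dim_stat d n m (PsiSet d n m y) = codinv d n m y" by (rule dim_stat_PsiSet[OF y d])
    show "bij_betw (rkhat d n m y) (Rplusbar d n m) (range int)" by (rule bij_rkhat[OF y d])
    show "\<lfloor>real_of_int (rkhat d n m y z) / real d\<rfloor> = rk n m z" if "z \<in> Rplusbar d n m" for z
      by (rule floor_rkhat[OF y d that])
    show "rkhat d n m y ` (Rplus d n m - boxes d n y) = int ` (UNIV - PsiSet d n m y)"
      by (rule rkhat_image_gaps[OF y d])
  qed (rule bij_PsiSet[OF d])
qed

end
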